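(* Checking satisfiability of an auxiliary CSP instance is fixed-parameter tractable when parameterized by the sum of the number of variables, the number of constraints, and the depths of the segment representations of all constraints; that is, there is an algorithm deciding satisfiability of a given auxiliary CSP instance in time $f(p)\cdot N^{\mathcal{O}(1)}$ for some computable function $f$, where $p$ is this parameter and $N$ is the size of the instance encoding.
   Context: Let $(D,\le)$ be a finite totally ordered set with $D=\{a(1),\dots,a(|D|)\}$, $a(i)<a(j)$ iff $i<j$. A permutation $\pi:D\to D$ is a segment reversion of $D$ if there are integers $1=i_1<i_2<\dots<i_\ell=|D|+1$ such that for every $j$ and every integer $x$ with $i_j\le x<i_{j+1}$ we have $\pi(a(x))=a(i_{j+1}-1-(x-i_j))$; i.e., $D$ is partitioned into consecutive segments and each segment is reversed independently. A segment representation of depth $k$ of a permutation $\pi$ of $D$ is a sequence of $k$ segment reversions $\pi_1,\dots,\pi_k$ of $D$ with $\pi=\pi_k\circ\dots\circ\pi_1$. For finite totally ordered sets $(D_1,\le_1),(D_2,\le_2)$, a relation $R\subseteq D_1\times D_2$ is downwards-closed if $(a,b)\in R$, $a'\le_1 a$, $b'\le_2 b$ imply $(a',b')\in R$. A segment representation of a relation $R\subseteq D_1\times D_2$ of depth $k$ consists of a downwards-closed relation $R'\subseteq D_1\times D_2$, a segment representation of depth $k_1$ of a permutation $\pi_1$ of $D_1$ and a segment representation of depth $k_2$ of a permutation $\pi_2$ of $D_2$ with $k_1+k_2\le k$, such that $(a,b)\in R$ iff $(\pi_1(a),\pi_2(b))\in R'$. An auxiliary CSP instance consists of variables $x_1,\dots,x_k$,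 a totally ordered finite domain $(D_i,\le_i)$ for each $x_i$, and a set of binary constraints, each being a tuple $(x_{i_1},x_{i_2},R_C)$ with $R_C\subseteq D_{i_1}\times D_{i_2}$ given by a segment representation of some depth. An assignment maps each $x_i$ to an element of $D_i$; it is satisfying if for every constraint $(x_{i_1},x_{i_2},R_C)$ the pair of assigned values lies in $R_C$. *)

theory Defs
  imports Main "HOL-Combinatorics.Permutations"
begin

section \<open>Model of computation\<close>

text \<open>
  Algorithms are programs of a first-order, call-by-value functional language over binary trees
  (pure LISP without higher-order functions; compare the languages of N. D. Jones, \<^emph>\<open>Computability
  and Complexity from a Programming Perspective\<close>).  A program is a list of function bodies, in
  which a variable \<open>Var n\<close> denotes the \<open>n\<close>-th argument; the entry point is function 0.  The running
  time is the number of expression evaluations.  Each of them inspects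
  or allocates a number of nodes bounded in terms of the program, and equality of trees is not a
  primitive.  Hence, storing common subtrees only once, a Turing machine simulates \<open>t\<close> evaluations
  in time polynomial in \<open>t\<close> and the size of the input; conversely a Turing machine step takes a
  bounded number of evaluations.
  Both the computable functions and running times of the form f(p) * N^O(1) are
  therefore those of the Turing machine.
\<close>

datatype data = Atom | Pair data data

datatype exp =
    Var nat
  | AtomE
  | PairE exp exp
  | FstE exp
  | SndE exp
  | IfE exp exp exp
  | Call nat "exp list"

type_synonym program = "exp list"

fun data_fst :: "data \<Rightarrow> data" where
  "data_fst Atom = Atom"
| "data_fst (Pair a b) = a"

fun data_snd :: "data \<Rightarrow> data" where
  "data_snd Atom = Atom"
| "data_snd (Pair a b) = b"

text \<open>
  \<open>eval P env e v t\<close>: under the arguments \<open>env\<close>, expression \<open>e\<close> evaluates to \<open>v\<close> in time \<open>t\<close>.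
  Diverging evaluations, unbound variables and undefined functions have no derivation.
\<close>

inductive
  eval :: "program \<Rightarrow> data list \<Rightarrow> exp \<Rightarrow> data \<Rightarrow> nat \<Rightarrow> bool" and
  evals :: "program \<Rightarrow> data list \<Rightarrow> exp list \<Rightarrow> data list \<Rightarrow> nat \<Rightarrow> bool"
  for P :: program
where
  eval_Var: "n < length env \<Longrightarrow> eval P env (Var n) (env ! n) 1"
| eval_Atom: "eval P env AtomE Atom 1"
| eval_Pair: "eval P env e1 v1 t1 \<Longrightarrow> eval P env e2 v2 t2 \<Longrightarrow>
    eval P env (PairE e1 e2) (Pair v1 v2) (t1 + t2 + 1)"
| eval_Fst: "eval P env e v t \<Longrightarrow> eval P env (FstE e) (data_fst v) (t + 1)"
| eval_Snd: "eval P env e v t \<Longrightarrow> eval P env (SndE e) (data_snd v) (t + 1)"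
| eval_If_True: "eval P env e b t \<Longrightarrow> b \<noteq> Atom \<Longrightarrow> eval P env e1 v t1 \<Longrightarrow>
    eval P env (IfE e e1 e2) v (t + t1 + 1)"
| eval_If_False: "eval P env e Atom t \<Longrightarrow> eval P env e2 v t2 \<Longrightarrow>
    eval P env (IfE e e1 e2) v (t + t2 + 1)"
| eval_Call: "evals P env es vs t \<Longrightarrow> g < length P \<Longrightarrow> eval P vs (P ! g) v t' \<Longrightarrow>
    eval P env (Call g es) v (t + t' + 1)"
| evals_Nil: "evals P env [] [] 0"
| evals_Cons: "eval P env e v t \<Longrightarrow> evals P env es vs t' \<Longrightarrow>
    evals P env (e # es) (v # vs) (t + t')"

definition runs :: "program \<Rightarrow> data \<Rightarrow> data \<Rightarrow> nat \<Rightarrow> bool" where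
  "runs P x y t \<longleftrightarrow> P \<noteq> [] \<and> eval P [x] (P ! 0) y t"

lemma
  eval_deterministic: "eval P env e v t \<Longrightarrow> eval P env e v' t' \<Longrightarrow> v' = v \<and> t' = t" and
  evals_deterministic: "evals P env es vs t \<Longrightarrow> evals P env es vs' t' \<Longrightarrow> vs' = vs \<and> t' = t"
proof (induction arbitrary: v' t' and vs' t' rule: eval_evals.inducts)
  case (eval_Var n env)
  from eval_Var.prems show ?case by cases auto
next
  case (eval_Atom env)
  from eval_Atom.prems show ?case by cases auto
next
  case (eval_Pair env e1 v1 t1 e2 v2 t2)
  from eval_Pair.prems show ?case by cases (use eval_Pair.IH in blast)
next
  case (eval_Fst env e v t)
  from eval_Fst.prems show ?case by cases (use eval_Fst.IH in blast)
next
  case (eval_Snd env e v t)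
  from eval_Snd.prems show ?case by cases (use eval_Snd.IH in blast)
next
  case (eval_If_True env e b t e1 v t1 e2)
  from eval_If_True.prems show ?case
    by cases (use eval_If_True.IH eval_If_True.hyps in blast)+
next
  case (eval_If_False env e t e2 v t2 e1)
  from eval_If_False.prems show ?case
    by cases (use eval_If_False.IH in blast)+
next
  case (eval_Call env es vs t g v t2)
  from eval_Call.prems show ?case by cases (use eval_Call.IH in blast)
next
  case (evals_Nil env)
  from evals_Nil.prems show ?case by cases auto
next
  case (evals_Cons env e v t es vs t2)
  from evals_Cons.prems show ?case by cases (use evals_Cons.IH in blast)
qed

corollary runs_deterministic: "runs P x y t \<Longrightarrow> runs P x y' t' \<Longrightarrow> y' = y \<and> t' = t"
  unfolding runs_def using eval_deterministic by blast


section \<open>Encodings, computability and fixed-parameter tractability\<close>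

fun data_size :: "data \<Rightarrow> nat" where
  "data_size Atom = 1"
| "data_size (Pair a b) = data_size a + data_size b + 1"

definition enc_bool :: "bool \<Rightarrow> data" where
  "enc_bool b = (if b then Pair Atom Atom else Atom)"

text \<open>Binary notation, least significant bit first.\<close>

fun enc_nat :: "nat \<Rightarrow> data" where
  "enc_nat n = (if n = 0 then Atom else Pair (enc_bool (odd n)) (enc_nat (n div 2)))"

declare enc_nat.simps [simp del]

definition enc_list :: "('a \<Rightarrow> data) \<Rightarrow> 'a list \<Rightarrow> data" where
  "enc_list enc xs = foldr (\<lambda>x. Pair (enc x)) xs Atom"

definition enc_prod :: "('a \<Rightarrow> data) \<Rightarrow> ('b \<Rightarrow> data) \<Rightarrow> 'a \<times> 'b \<Rightarrow> data" where
  "enc_prod enc1 enc2 p = Pair (enc1 (fst p)) (enc2 (snd p))"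

definition computable :: "(nat \<Rightarrow> nat) \<Rightarrow> bool" where
  "computable f \<longleftrightarrow> (\<exists>P. \<forall>n. \<exists>t. runs P (enc_nat n) (enc_nat (f n)) t)"

text \<open>
  The problem to decide \<open>Q\<close> on the instances \<open>I\<close>, presented through the encoding \<open>enc\<close>, with
  parameter \<open>par\<close>.
\<close>

definition fixed_parameter_tractable ::
    "'i set \<Rightarrow> ('i \<Rightarrow> data) \<Rightarrow> ('i \<Rightarrow> nat) \<Rightarrow> ('i \<Rightarrow> bool) \<Rightarrow> bool" where
  "fixed_parameter_tractable I enc par Q \<longleftrightarrow>
    (\<exists>P f c. computable f \<and>
      (\<forall>x\<in>I. \<exists>t. runs P (enc x) (enc_bool (Q x)) t \<and> t \<le> f (par x) * data_size (enc x) ^ c))"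


section \<open>Segment representations\<close>

text \<open>
  A finite totally ordered set \<open>D = {a(1) < ... < a(|D|)}\<close> is given by the list of its elements in
  increasing order.  The elements are natural numbers, which serve as mere names: the order is that
  of the list.
\<close>

definition ordered_domain :: "nat list \<Rightarrow> bool" where
  "ordered_domain D \<longleftrightarrow> distinct D"

definition elt :: "nat list \<Rightarrow> nat \<Rightarrow> nat" where
  "elt D i = D ! (i - 1)"

definition dom_le :: "nat list \<Rightarrow> nat \<Rightarrow> nat \<Rightarrow> bool" where
  "dom_le D x y \<longleftrightarrow> (\<exists>i j. 1 \<le> i \<and> i \<le> j \<and> j \<le> length D \<and> x = elt D i \<and> y = elt D j)"

text \<open>Permutations of \<open>D\<close> are extended to the whole type by the identity.\<close>

definition segment_reversion :: "nat list \<Rightarrow> (nat \<Rightarrow> nat) \<Rightarrow> bool" where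
  "segment_reversion D \<pi> \<longleftrightarrow> \<pi> permutes set D \<and>
    (\<exists>bs. bs \<noteq> [] \<and> hd bs = 1 \<and> last bs = length D + 1 \<and> sorted_wrt (<) bs \<and>
      (\<forall>j. Suc j < length bs \<longrightarrow>
        (\<forall>x. bs ! j \<le> x \<and> x < bs ! Suc j \<longrightarrow>
          \<pi> (elt D x) = elt D (bs ! Suc j - 1 - (x - bs ! j)))))"

text \<open>\<open>compose [\<pi>\<^sub>1, \<dots>, \<pi>\<^sub>k] = \<pi>\<^sub>k \<circ> \<dots> \<circ> \<pi>\<^sub>1\<close>\<close>

definition compose :: "('a \<Rightarrow> 'a) list \<Rightarrow> 'a \<Rightarrow> 'a" where
  "compose ps = fold (\<circ>) ps id"

definition perm_segment_rep :: "nat list \<Rightarrow> nat \<Rightarrow> (nat \<Rightarrow> nat) list \<Rightarrow> (nat \<Rightarrow> nat) \<Rightarrow> bool" where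
  "perm_segment_rep D k ps \<pi> \<longleftrightarrow>
    length ps = k \<and> (\<forall>p\<in>set ps. segment_reversion D p) \<and> \<pi> = compose ps"

definition downwards_closed :: "nat list \<Rightarrow> nat list \<Rightarrow> (nat \<times> nat) set \<Rightarrow> bool" where
  "downwards_closed D1 D2 R \<longleftrightarrow>
    (\<forall>a b a' b'. (a, b) \<in> R \<and> dom_le D1 a' a \<and> dom_le D2 b' b \<longrightarrow> (a', b') \<in> R)"

record segment_rep =
  base_rel :: "(nat \<times> nat) set"
  revs1 :: "(nat \<Rightarrow> nat) list"
  revs2 :: "(nat \<Rightarrow> nat) list"

definition rel_segment_rep ::
    "nat list \<Rightarrow> nat list \<Rightarrow> nat \<Rightarrow> segment_rep \<Rightarrow> (nat \<times> nat) set \<Rightarrow> bool" where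
  "rel_segment_rep D1 D2 k S R \<longleftrightarrow>
    R \<subseteq> set D1 \<times> set D2 \<and>
    base_rel S \<subseteq> set D1 \<times> set D2 \<and> downwards_closed D1 D2 (base_rel S) \<and>
    (\<exists>k1 k2 \<pi>1 \<pi>2.
      perm_segment_rep D1 k1 (revs1 S) \<pi>1 \<and> perm_segment_rep D2 k2 (revs2 S) \<pi>2 \<and>
      k1 + k2 \<le> k \<and>
      (\<forall>a\<in>set D1. \<forall>b\<in>set D2. (a, b) \<in> R \<longleftrightarrow> (\<pi>1 a, \<pi>2 b) \<in> base_rel S))"

text \<open>The least \<open>k\<close> admitted by \<open>rel_segment_rep\<close>.\<close>

definition depth :: "segment_rep \<Rightarrow> nat" where
  "depth S = length (revs1 S) + length (revs2 S)"

lemma rel_segment_rep_depth_le: "rel_segment_rep D1 D2 k S R \<Longrightarrow> depth S \<le> k"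
  by (auto simp: rel_segment_rep_def perm_segment_rep_def depth_def)

lemma rel_segment_rep_depth: "rel_segment_rep D1 D2 k S R \<Longrightarrow> rel_segment_rep D1 D2 (depth S) S R"
  by (auto simp: rel_segment_rep_def perm_segment_rep_def depth_def)


section \<open>Auxiliary CSP instances\<close>

text \<open>
  Variables are the positions in the list of domains (counted from 0).
\<close>

record aux_constraint =
  var1 :: nat
  var2 :: nat
  crel :: "(nat \<times> nat) set"
  crep :: segment_rep

record aux_csp =
  domains :: "nat list list"
  constraints :: "aux_constraint list"

definition aux_csp_instance :: "aux_csp \<Rightarrow> bool" where
  "aux_csp_instance A \<longleftrightarrow>
    (\<forall>D\<in>set (domains A). ordered_domain D) \<and>
    (\<forall>C\<in>set (constraints A).
      var1 C < length (domains A) \<and> var2 C < length (domains A) \<and>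
      (\<exists>k. rel_segment_rep (domains A ! var1 C) (domains A ! var2 C) k (crep C) (crel C)))"

definition assignment :: "aux_csp \<Rightarrow> (nat \<Rightarrow> nat) \<Rightarrow> bool" where
  "assignment A \<alpha> \<longleftrightarrow> (\<forall>i<length (domains A). \<alpha> i \<in> set (domains A ! i))"

definition satisfying :: "aux_csp \<Rightarrow> (nat \<Rightarrow> nat) \<Rightarrow> bool" where
  "satisfying A \<alpha> \<longleftrightarrow> (\<forall>C\<in>set (constraints A). (\<alpha> (var1 C), \<alpha> (var2 C)) \<in> crel C)"

definition satisfiable :: "aux_csp \<Rightarrow> bool" where
  "satisfiable A \<longleftrightarrow> (\<exists>\<alpha>. assignment A \<alpha> \<and> satisfying A \<alpha>)"

definition csp_parameter :: "aux_csp \<Rightarrow> nat" where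
  "csp_parameter A = length (domains A) + length (constraints A) +
    (\<Sum>C\<leftarrow>constraints A. depth (crep C))"

text \<open>
  The input lists the elements of every domain in increasing order.  A constraint is given by its
  two variables and its segment representation only: the base relation as the list of its pairs,
  and every segment reversion as its table of values on the domain.
\<close>

definition enc_reversions :: "nat list \<Rightarrow> (nat \<Rightarrow> nat) list \<Rightarrow> data" where
  "enc_reversions D ps = enc_list (\<lambda>p. enc_list enc_nat (map p D)) ps"

definition enc_segment_rep :: "nat list \<Rightarrow> nat list \<Rightarrow> segment_rep \<Rightarrow> data" where
  "enc_segment_rep D1 D2 S =
    Pair (enc_list (enc_prod enc_nat enc_nat) (filter (\<lambda>p. p \<in> base_rel S) (List.product D1 D2)))
      (Pair (enc_reversions D1 (revs1 S)) (enc_reversions D2 (revs2 S)))"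

definition enc_constraint :: "nat list list \<Rightarrow> aux_constraint \<Rightarrow> data" where
  "enc_constraint Ds C =
    Pair (enc_nat (var1 C))
      (Pair (enc_nat (var2 C)) (enc_segment_rep (Ds ! var1 C) (Ds ! var2 C) (crep C)))"

definition enc_aux_csp :: "aux_csp \<Rightarrow> data" where
  "enc_aux_csp A =
    Pair (enc_list (enc_list enc_nat) (domains A))
      (enc_list (enc_constraint (domains A)) (constraints A))"

end

theory Submission
  imports Defs
begin

text \<open>
  A divide-and-conquer algorithm.  All domains are cut into blocks, and a pair of blocks is mixed if
  some constraint is neither full nor empty on it.  Composing \<open>k\<close> segment reversions
  spreads a block so mildly that every element lies in the permuted hull of blocks that all meet a
  set of at most \<open>3 ^ k\<close> elements.  As the boundary of a downwards-closed relation is a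
  staircase, the number of mixed pairs is therefore linear in the number of blocks.

  Let \<open>p\<close> be the parameter and \<open>u = 256 ^ (p + 1)\<close>.  Start with blocks shorter by the factor
  \<open>2 ^ u\<close>, and repeatedly cut the domains greedily into new blocks that have at most \<open>u\<close> mixed
  neighbours among the previous ones.  By linearity, the number of blocks shrinks geometrically down
  to \<open>O(p)\<close>, so after \<open>u\<close> rounds the common refinement consists of few short blocks, each with
  at most \<open>u * u + 5 * p\<close> mixed neighbours.  A solution selects one block per variable.  Only the
  tuples of blocks that are connected by mixed pairs, at most \<open>(2 ^ u) ^ 2\<close> of them, are solved
  recursively; between different components of a selection all constraints are full, so the
  solvable tuples can be combined freely.  With block length \<open>n\<close> this gives
  \<open>T(n) \<le> (2 ^ u) ^ 2 * T(n / 2 ^ u) + W\<close>, hence \<open>O(W * (2 ^ u) ^ 2 * n ^ 2)\<close>.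
\<close>


section \<open>Binary trees read as lists along the right spine\<close>

section \<open>Trees as lists\<close>

text \<open>A running time polynomial in \<open>n\<close> with an exponent independent of
  \<open>p\<close> requires that the number of recursive calls be a fixed power of the factor by
  which blocks shrink. All selections of one block per variable would give a power growing with the
  number of variables. The number of connected tuples, in contrast, is governed by the maximal
  degree in the graph of mixed pairs. A linear number of mixed pairs bounds only the average degree:
  one block may be mixed with almost all others. Recutting bounds degrees only relative to the
  previous partition. The common refinement makes the bound absolute: each of its blocks begins
  where a part of some partition begins and lies in that part, so a neighbour can be charged to that
  part; the last partition is so small that it needs no degree bound. The size of \<open>u\<close>
  meets two demands: it is at least 9 times the number of points that account for mixed pairs, which
  makes the excess of parts shrink by 4 per round, and \<open>2 ^ u\<close> absorbs the power of
  \<open>u\<close>, with exponent linear in \<open>p\<close>, that bounds the growth of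
  tuples.\<close>

fun sp :: "data \<Rightarrow> data list" where
  "sp Atom = []"
| "sp (Pair x xs) = x # sp xs"

fun ls :: "data list \<Rightarrow> data" where
  "ls [] = Atom"
| "ls (x # xs) = Pair x (ls xs)"

lemma sp_ls [simp]: "sp (ls xs) = xs"
  by (induction xs) auto

lemma ls_sp [simp]: "ls (sp d) = d"
  by (induction d) auto

lemma ls_eq_Atom [simp]: "ls xs = Atom \<longleftrightarrow> xs = []"
  by (cases xs) auto

lemma sp_eq_Nil [simp]: "sp d = [] \<longleftrightarrow> d = Atom"
  by (cases d) auto

lemma enc_list_ls: "enc_list e xs = ls (map e xs)"
  unfolding enc_list_def by (induction xs) auto

lemma sp_enc_list [simp]: "sp (enc_list e xs) = map e xs"
  by (simp add: enc_list_ls)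

lemma enc_bool_eq_Atom [simp]: "enc_bool b = Atom \<longleftrightarrow> \<not> b"
  by (simp add: enc_bool_def)

lemma size_pos [simp]: "0 < data_size d"
  by (cases d) auto

lemma data_size_enc_bool: "data_size (enc_bool b) \<le> 3"
  by (simp add: enc_bool_def)

lemma data_size_ls: "data_size (ls xs) = Suc (\<Sum>x\<leftarrow>xs. Suc (data_size x))"
  by (induction xs) auto

lemma length_le_size: "length (sp d) < data_size d"
  by (induction d) auto

lemma size_mem_sp: "x \<in> set (sp d) \<Longrightarrow> data_size x < data_size d"
  by (induction d) auto

lemma size_fst_le: "data_size (data_fst d) \<le> data_size d"
  by (cases d) auto

lemma size_snd_le: "data_size (data_snd d) \<le> data_size d"
  by (cases d) auto

lemma size_snd_less: "d \<noteq> Atom \<Longrightarrow> data_size (data_snd d) < data_size d"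
  by (cases d) auto

lemma sp_unfold: "d \<noteq> Atom \<Longrightarrow> sp d = data_fst d # sp (data_snd d)"
  by (cases d) auto

section \<open>Closure of polynomial-time expressions under the constructs of the language\<close>

section \<open>Polynomial time\<close>

abbreviation sz :: "data list \<Rightarrow> nat" where
  "sz env \<equiv> sum_list (map data_size env)"

text \<open>Polynomial bounds are kept in the form \<open>(sz env + 2) ^ c\<close>: as the base is
  at least 2, constants, sums and compositions are absorbed by raising the exponent. The size of the
  result needs a bound of its own, since values are shared and a tree can be exponentially larger
  than the time spent on it.\<close>

definition pt :: "program \<Rightarrow> nat \<Rightarrow> exp \<Rightarrow> (data list \<Rightarrow> data) \<Rightarrow> bool" where
  "pt P n e F \<longleftrightarrow> (\<exists>c. \<forall>env. length env = n \<longrightarrow>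
     (\<exists>t \<le> (sz env + 2) ^ c. eval P env e (F env) t) \<and> data_size (F env) \<le> (sz env + 2) ^ c)"

definition pts :: "program \<Rightarrow> nat \<Rightarrow> exp list \<Rightarrow> (data list \<Rightarrow> data list) \<Rightarrow> bool" where
  "pts P n es F \<longleftrightarrow> (\<exists>c. \<forall>env. length env = n \<longrightarrow>
     (\<exists>t \<le> (sz env + 2) ^ c. evals P env es (F env) t) \<and> sz (F env) \<le> (sz env + 2) ^ c)"

definition fn :: "program \<Rightarrow> nat \<Rightarrow> nat \<Rightarrow> (data list \<Rightarrow> data) \<Rightarrow> bool" where
  "fn P n g F \<longleftrightarrow> g < length P \<and> pt P n (P ! g) F"

lemma pow_mono: "a \<le> (s + 2) ^ c \<Longrightarrow> c \<le> d \<Longrightarrow> a \<le> (s + 2 :: nat) ^ d"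
  by (meson le_trans power_increasing le_add2 one_le_numeral)

lemma pow_add1: "a \<le> (s + 2) ^ c \<Longrightarrow> a + 1 \<le> (s + 2 :: nat) ^ Suc c"
proof -
  assume a: "a \<le> (s + 2) ^ c"
  have "1 \<le> (s + 2) ^ c" by simp
  hence "a + 1 \<le> 2 * (s + 2) ^ c" using a by linarith
  also have "\<dots> \<le> (s + 2) ^ Suc c" by simp
  finally show ?thesis .
qed

lemma pow_add: "a \<le> (s + 2) ^ c \<Longrightarrow> b \<le> (s + 2) ^ d \<Longrightarrow> a + b \<le> (s + 2 :: nat) ^ Suc (c + d)"
proof -
  assume a: "a \<le> (s + 2) ^ c" and b: "b \<le> (s + 2) ^ d"
  have "a + b \<le> 2 * (s + 2) ^ (c + d)"
    using pow_mono[OF a, of "c + d"] pow_mono[OF b, of "c + d"] by simp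
  also have "\<dots> \<le> (s + 2) ^ Suc (c + d)" by simp
  finally show ?thesis .
qed

lemma pow_comp: "a \<le> (s + 2) ^ c \<Longrightarrow> (a + 2) ^ d \<le> (s + 2 :: nat) ^ (Suc (Suc c) * d)"
proof -
  assume a: "a \<le> (s + 2) ^ c"
  have "a + 2 \<le> (s + 2) ^ Suc (Suc c)"
    using pow_add1[OF pow_add1[OF a]] by simp
  thus ?thesis by (metis power_mono power_mult le0)
qed

lemma ptI:
  assumes "\<And>env. length env = n \<Longrightarrow> \<exists>t \<le> (sz env + 2) ^ c. eval P env e (F env) t"
    and "\<And>env. length env = n \<Longrightarrow> data_size (F env) \<le> (sz env + 2) ^ c"
  shows "pt P n e F"
  using assms unfolding pt_def by blast

lemma pt_cong: "pt P n e F \<Longrightarrow> (\<And>env. length env = n \<Longrightarrow> F env = G env) \<Longrightarrow> pt P n e G"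
  unfolding pt_def by (metis (no_types, lifting))

lemma pts_cong: "pts P n e F \<Longrightarrow> (\<And>env. length env = n \<Longrightarrow> F env = G env) \<Longrightarrow> pts P n e G"
  unfolding pts_def by (metis (no_types, lifting))

lemma pt_Var: "i < n \<Longrightarrow> pt P n (Var i) (\<lambda>env. env ! i)"
proof (rule ptI[where c = 1], goal_cases)
  case (1 env)
  thus ?case using eval_Var[of i env P] by (intro exI[of _ 1]) simp
next
  case (2 env)
  hence "data_size (env ! i) \<le> sz env"
    by (intro member_le_sum_list) auto
  thus ?case by simp
qed

lemma pt_Atom: "pt P n AtomE (\<lambda>_. Atom)"
  by (rule ptI[where c = 1]) (auto intro!: exI[of _ 1] eval_evals.intros)

lemma pt_Pair:
  assumes "pt P n e1 F1" "pt P n e2 F2"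
  shows "pt P n (PairE e1 e2) (\<lambda>env. Pair (F1 env) (F2 env))"
proof -
  obtain c where c: "\<And>env. length env = n \<Longrightarrow>
     (\<exists>t \<le> (sz env + 2) ^ c. eval P env e1 (F1 env) t) \<and> data_size (F1 env) \<le> (sz env + 2) ^ c"
    using assms(1) unfolding pt_def by blast
  obtain d where d: "\<And>env. length env = n \<Longrightarrow>
     (\<exists>t \<le> (sz env + 2) ^ d. eval P env e2 (F2 env) t) \<and> data_size (F2 env) \<le> (sz env + 2) ^ d"
    using assms(2) unfolding pt_def by blast
  show ?thesis
  proof (rule ptI[where c = "Suc (Suc (c + d))"], goal_cases)
    case (1 env)
    then obtain t1 t2 where t: "t1 \<le> (sz env + 2) ^ c" "eval P env e1 (F1 env) t1"
      "t2 \<le> (sz env + 2) ^ d" "eval P env e2 (F2 env) t2" using c d by metis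
    from eval_Pair[OF t(2,4)] pow_add1[OF pow_add[OF t(1,3)]] show ?case by blast
  next
    case (2 env)
    with c d have "data_size (F1 env) \<le> (sz env + 2) ^ c" "data_size (F2 env) \<le> (sz env + 2) ^ d"
      by blast+
    from pow_add1[OF pow_add[OF this]] show ?case by simp
  qed
qed

lemma pt_Fst:
  assumes "pt P n e F"
  shows "pt P n (FstE e) (\<lambda>env. data_fst (F env))"
proof -
  obtain c where c: "\<And>env. length env = n \<Longrightarrow>
     (\<exists>t \<le> (sz env + 2) ^ c. eval P env e (F env) t) \<and> data_size (F env) \<le> (sz env + 2) ^ c"
    using assms(1) unfolding pt_def by blast
  show ?thesis
  proof (rule ptI[where c = "Suc c"], goal_cases)
    case (1 env)
    with c show ?case using eval_Fst pow_add1 by metis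
  next
    case (2 env)
    with c have "data_size (F env) \<le> (sz env + 2) ^ c" by blast
    with size_fst_le[of "F env"] show ?case using pow_mono[of _ "sz env" c "Suc c"] by force
  qed
qed

lemma pt_Snd:
  assumes "pt P n e F"
  shows "pt P n (SndE e) (\<lambda>env. data_snd (F env))"
proof -
  obtain c where c: "\<And>env. length env = n \<Longrightarrow>
     (\<exists>t \<le> (sz env + 2) ^ c. eval P env e (F env) t) \<and> data_size (F env) \<le> (sz env + 2) ^ c"
    using assms(1) unfolding pt_def by blast
  show ?thesis
  proof (rule ptI[where c = "Suc c"], goal_cases)
    case (1 env)
    with c show ?case using eval_Snd pow_add1 by metis
  next
    case (2 env)
    with c have "data_size (F env) \<le> (sz env + 2) ^ c" by blast
    with size_snd_le[of "F env"] show ?case using pow_mono[of _ "sz env" c "Suc c"] by force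
  qed
qed

lemma pt_If:
  assumes "pt P n b B" "pt P n e1 F1" "pt P n e2 F2"
  shows "pt P n (IfE b e1 e2) (\<lambda>env. if B env \<noteq> Atom then F1 env else F2 env)"
proof -
  obtain c where c: "\<And>env. length env = n \<Longrightarrow>
     (\<exists>t \<le> (sz env + 2) ^ c. eval P env b (B env) t) \<and> data_size (B env) \<le> (sz env + 2) ^ c"
    using assms(1) unfolding pt_def by blast
  obtain d1 where d1: "\<And>env. length env = n \<Longrightarrow>
     (\<exists>t \<le> (sz env + 2) ^ d1. eval P env e1 (F1 env) t) \<and> data_size (F1 env) \<le> (sz env + 2) ^ d1"
    using assms(2) unfolding pt_def by blast
  obtain d2 where d2: "\<And>env. length env = n \<Longrightarrow>
     (\<exists>t \<le> (sz env + 2) ^ d2. eval P env e2 (F2 env) t) \<and> data_size (F2 env) \<le> (sz env + 2) ^ d2"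
    using assms(3) unfolding pt_def by blast
  let ?d = "d1 + d2"
  show ?thesis
  proof (rule ptI[where c = "Suc (Suc (c + ?d))"], goal_cases)
    case (1 env)
    then obtain t1 where t1: "t1 \<le> (sz env + 2) ^ c" "eval P env b (B env) t1" using c by metis
    show ?case
    proof (cases "B env = Atom")
      case True
      from 1 d2 obtain t2 where t2: "t2 \<le> (sz env + 2) ^ d2" "eval P env e2 (F2 env) t2" by metis
      have "t2 \<le> (sz env + 2) ^ ?d" by (rule pow_mono[OF t2(1)]) simp
      from pow_add1[OF pow_add[OF t1(1) this]] eval_If_False[OF _ t2(2)] t1(2) True
      show ?thesis by auto
    next
      case False
      from 1 d1 obtain t2 where t2: "t2 \<le> (sz env + 2) ^ d1" "eval P env e1 (F1 env) t2" by metis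
      have "t2 \<le> (sz env + 2) ^ ?d" by (rule pow_mono[OF t2(1)]) simp
      from pow_add1[OF pow_add[OF t1(1) this]] eval_If_True[OF t1(2) _ t2(2)] False
      show ?thesis by auto
    qed
  next
    case (2 env)
    with d1 d2 have "data_size (F1 env) \<le> (sz env + 2) ^ d1" "data_size (F2 env) \<le> (sz env + 2) ^ d2"
      by blast+
    with pow_mono[of _ "sz env" d1 "Suc (Suc (c + ?d))"] pow_mono[of _ "sz env" d2 "Suc (Suc (c + ?d))"]
    show ?case by auto
  qed
qed

lemma pts_Nil: "pts P n [] (\<lambda>_. [])"
  unfolding pts_def by (auto intro!: exI[of _ 0] eval_evals.intros)

lemma pts_Cons:
  assumes "pt P n e F" "pts P n es Fs"
  shows "pts P n (e # es) (\<lambda>env. F env # Fs env)"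
proof -
  obtain c where c: "\<And>env. length env = n \<Longrightarrow>
     (\<exists>t \<le> (sz env + 2) ^ c. eval P env e (F env) t) \<and> data_size (F env) \<le> (sz env + 2) ^ c"
    using assms(1) unfolding pt_def by blast
  obtain d where d: "\<And>env. length env = n \<Longrightarrow>
     (\<exists>t \<le> (sz env + 2) ^ d. evals P env es (Fs env) t) \<and> sz (Fs env) \<le> (sz env + 2) ^ d"
    using assms(2) unfolding pts_def by blast
  show ?thesis unfolding pts_def
  proof (rule exI[of _ "Suc (c + d)"], intro allI impI conjI, goal_cases)
    case (1 env)
    then obtain t1 t2 where t: "t1 \<le> (sz env + 2) ^ c" "eval P env e (F env) t1"
      "t2 \<le> (sz env + 2) ^ d" "evals P env es (Fs env) t2" using c d by metis
    from evals_Cons[OF t(2,4)] pow_add[OF t(1,3)] show ?case by blast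
  next
    case (2 env)
    with c d have "data_size (F env) \<le> (sz env + 2) ^ c" "sz (Fs env) \<le> (sz env + 2) ^ d"
      by blast+
    from pow_add[OF this] show ?case by simp
  qed
qed

lemma pts_length:
  assumes "pts P n es F" "length env = n"
  shows "length (F env) = length es"
proof -
  obtain t where "evals P env es (F env) t" using assms unfolding pts_def by blast
  moreover have "evals P env es vs t \<Longrightarrow> length vs = length es" for vs
  proof (induction es arbitrary: vs t)
    case (Cons e es)
    from Cons.prems show ?case by cases (use Cons.IH in auto)
  qed (auto elim: evals.cases)
  ultimately show ?thesis by blast
qed

lemma pt_Call:
  assumes "fn P m g F" "pts P n es Fs" "length es = m"
  shows "pt P n (Call g es) (\<lambda>env. F (Fs env))"
proof -
  obtain c where c: "\<And>env. length env = m \<Longrightarrow>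
     (\<exists>t \<le> (sz env + 2) ^ c. eval P env (P ! g) (F env) t) \<and> data_size (F env) \<le> (sz env + 2) ^ c"
    using assms(1) unfolding pt_def fn_def by blast
  obtain d where d: "\<And>env. length env = n \<Longrightarrow>
     (\<exists>t \<le> (sz env + 2) ^ d. evals P env es (Fs env) t) \<and> sz (Fs env) \<le> (sz env + 2) ^ d"
    using assms(2) unfolding pts_def by blast
  have g: "g < length P" using assms(1) by (simp add: fn_def)
  let ?e = "Suc (Suc d) * c"
  show ?thesis
  proof (rule ptI[where c = "Suc (Suc (d + ?e))"], goal_cases)
    case (1 env)
    hence l: "length (Fs env) = m" using pts_length assms(2,3) by metis
    obtain t1 where t1: "t1 \<le> (sz env + 2) ^ d" "evals P env es (Fs env) t1" using d 1 by metis
    obtain t2 where t2: "t2 \<le> (sz (Fs env) + 2) ^ c" "eval P (Fs env) (P ! g) (F (Fs env)) t2"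
      using c l by metis
    have "t2 \<le> (sz env + 2) ^ ?e"
      using t2(1) pow_comp[of "sz (Fs env)" "sz env" d c] d[OF 1] le_trans by blast
    from pow_add1[OF pow_add[OF t1(1) this]] eval_Call[OF t1(2) g t2(2)] show ?case by blast
  next
    case (2 env)
    hence l: "length (Fs env) = m" using pts_length assms(2,3) by metis
    have "data_size (F (Fs env)) \<le> (sz env + 2) ^ ?e"
      using c[OF l] pow_comp[of "sz (Fs env)" "sz env" d c] d[OF 2] le_trans by blast
    thus ?case by (rule pow_mono) simp
  qed
qed

lemmas pt_intros = pt_Var pt_Atom pt_Pair pt_Fst pt_Snd pt_If pts_Nil pts_Cons

section \<open>Time of recursion on the first argument\<close>

section \<open>Loops\<close>

text \<open>The step \<open>h\<close> receives the recursive result in front of the current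
  arguments. A single time analysis of this scheme serves almost all recursive functions of the
  program.\<close>

definition loop :: "nat \<Rightarrow> nat \<Rightarrow> exp list \<Rightarrow> exp \<Rightarrow> exp" where
  "loop g h us b = IfE (Var 0) (Call h (Call g us # map Var [0..<length us])) b"

lemma evals_map_Var:
  "k + length vs = length env \<Longrightarrow> vs = drop k env \<Longrightarrow> evals P env (map Var [k..<length env]) vs (length vs)"
proof (induction vs arbitrary: k)
  case Nil
  thus ?case by (auto intro: eval_evals.intros)
next
  case (Cons v vs)
  have k: "k < length env" using Cons.prems by (metis drop_all leI list.discI)
  have "vs = drop (Suc k) env" using Cons.prems by (metis drop_Suc list.sel(3) tl_drop)
  hence IH: "evals P env (map Var [Suc k..<length env]) vs (length vs)"
    using Cons.prems by (intro Cons.IH) auto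
  have v: "env ! k = v" using Cons.prems(2) k by (metis nth_via_drop)
  have "evals P env (Var k # map Var [Suc k..<length env]) (v # vs) (1 + length vs)"
    by (rule evals_Cons) (use eval_Var[OF k] v IH in auto)
  thus ?case using k by (simp add: upt_conv_Cons)
qed

text \<open>
  The loop invariant \<open>I\<close> and the size bound \<open>Z\<close> are parameters of the conclusion, so that the
  exponent does not depend on them.
\<close>

lemma loop_time:
  assumes g: "P ! g = loop g h us b" "g < length P" "h < length P" "length us = n" "0 < n"
    and H: "pt P (Suc n) (P ! h) H" and U: "pts P n us U" and B: "pt P n b B"
  obtains c where
    "\<And>I Z F env. (\<And>v. v \<in> I \<Longrightarrow> length v = n \<and> sz v \<le> Z \<and> data_size (F v) \<le> Z \<and>
        (v ! 0 = Atom \<longrightarrow> F v = B v) \<and>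
        (v ! 0 \<noteq> Atom \<longrightarrow> U v \<in> I \<and> data_size (U v ! 0) < data_size (v ! 0) \<and> F v = H (F (U v) # v)))
      \<Longrightarrow> env \<in> I \<Longrightarrow> \<exists>t \<le> (Z + 2) ^ c. eval P env (P ! g) (F env) t"
proof -
  obtain c1 where c1: "\<And>env. length env = Suc n \<Longrightarrow> (\<exists>t \<le> (sz env + 2) ^ c1. eval P env (P ! h) (H env) t)"
    using H unfolding pt_def by blast
  obtain c2 where c2: "\<And>env. length env = n \<Longrightarrow> (\<exists>t \<le> (sz env + 2) ^ c2. evals P env us (U env) t)"
    using U unfolding pts_def by blast
  obtain c3 where c3: "\<And>env. length env = n \<Longrightarrow> (\<exists>t \<le> (sz env + 2) ^ c3. eval P env b (B env) t)"
    using B unfolding pt_def by blast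
  \<comment> \<open>The cost of one level. The step function sees the recursive result and the
    arguments, each of total size at most \<open>Z\<close>, hence \<open>2 * Z\<close>.\<close>
  define K where "K = (\<lambda>Z::nat. n + 4 + (2 * Z + 2) ^ c1 + (Z + 2) ^ c2 + (Z + 2) ^ c3)"
  \<comment> \<open>The first argument shrinks strictly from level to level, so its size bounds the
    number of levels.\<close>
  have K: "\<exists>t \<le> data_size (env ! 0) * K Z. eval P env (P ! g) (F env) t"
    if I: "\<And>v. v \<in> I \<Longrightarrow> length v = n \<and> sz v \<le> Z \<and> data_size (F v) \<le> Z \<and>
        (v ! 0 = Atom \<longrightarrow> F v = B v) \<and>
        (v ! 0 \<noteq> Atom \<longrightarrow> U v \<in> I \<and> data_size (U v ! 0) < data_size (v ! 0) \<and> F v = H (F (U v) # v))"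
      and env: "env \<in> I" for I Z F env
    using env
  proof (induction "data_size (env ! 0)" arbitrary: env rule: less_induct)
    case less
    note i = I[OF less.prems]
    have l: "length env = n" and s: "sz env \<le> Z" using i by auto
    have "eval P env (Var 0) (env ! 0) 1" using eval_Var[of 0 env P] l g(5) by simp
    show ?case
    proof (cases "env ! 0 = Atom")
      case True
      obtain t where t: "t \<le> (sz env + 2) ^ c3" "eval P env b (B env) t" using c3 l by blast
      have "(sz env + 2) ^ c3 \<le> (Z + 2) ^ c3" using s by (intro power_mono) auto
      hence "1 + t + 1 \<le> data_size (env ! 0) * K Z" using t(1) True unfolding K_def by simp
      moreover have "eval P env (P ! g) (F env) (1 + t + 1)"
        unfolding g loop_def using eval_If_False[of P env "Var 0" 1 b "B env" t] t(2) i True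
          \<open>eval P env (Var 0) (env ! 0) 1\<close> by auto
      ultimately show ?thesis by blast
    next
      case False
      hence u: "U env \<in> I" "data_size (U env ! 0) < data_size (env ! 0)" "F env = H (F (U env) # env)"
        using i by auto
      obtain t1 where t1: "t1 \<le> data_size (U env ! 0) * K Z" "eval P (U env) (P ! g) (F (U env)) t1"
        using less.hyps[OF u(2) u(1)] by blast
      obtain t2 where t2: "t2 \<le> (sz env + 2) ^ c2" "evals P env us (U env) t2" using c2 l by blast
      obtain t3 where t3: "t3 \<le> (sz (F (U env) # env) + 2) ^ c1"
        "eval P (F (U env) # env) (P ! h) (F env) t3"
        using c1[of "F (U env) # env"] l u(3) by auto
      have sr: "data_size (F (U env)) \<le> Z" using I[OF u(1)] by blast
      have a2: "(sz env + 2) ^ c2 \<le> (Z + 2) ^ c2" using s by (intro power_mono) auto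
      have a3: "(sz (F (U env) # env) + 2) ^ c1 \<le> (2 * Z + 2) ^ c1"
        using s sr by (intro power_mono) auto
      have e1: "eval P env (Call g us) (F (U env)) (t2 + t1 + 1)"
        by (rule eval_Call[OF t2(2) g(2) t1(2)])
      have e2: "evals P env (map Var [0..<length us]) env (length env)"
        using evals_map_Var[of 0 env env P] l g(4) by simp
      have e3: "eval P env (P ! g) (F env) (1 + ((t2 + t1 + 1) + length env + t3 + 1) + 1)"
        unfolding g(1) loop_def using \<open>eval P env (Var 0) (env ! 0) 1\<close> False
          eval_Call[OF evals_Cons[OF e1 e2] g(3) t3(2)]
        by (rule eval_If_True)
      have "1 + ((t2 + t1 + 1) + length env + t3 + 1) + 1 \<le> K Z + data_size (U env ! 0) * K Z"
        using t1(1) t2(1) t3(1) a2 a3 l unfolding K_def by simp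
      also have "\<dots> \<le> data_size (env ! 0) * K Z" using u(2)
        by (metis Suc_leI mult_Suc mult_le_mono1)
      finally show ?thesis using e3 by blast
    qed
  qed
  define d where "d = Suc (n + 6 + Suc (2 * c1 + c2) + c3)"
  have Kd: "K Z \<le> (Z + 2) ^ Suc d" for Z
  proof -
    have two: "m \<le> 2 ^ m" for m :: nat by (metis less_exp less_imp_le)
    have 1: "n + 4 \<le> (Z + 2) ^ (n + 4)"
      using two[of "n + 4"] power_mono[of 2 "Z + 2" "n + 4"] by linarith
    have "(2 * Z + 2) ^ c1 \<le> ((Z + 2) ^ 2) ^ c1"
      by (intro power_mono) (auto simp: power2_eq_square)
    hence 2: "(2 * Z + 2) ^ c1 \<le> (Z + 2) ^ (2 * c1)" by (simp add: power_mult)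
    have "K Z \<le> (Z + 2) ^ Suc (Suc (Suc (n + 4 + 2 * c1) + c2) + c3)"
      unfolding K_def by (intro pow_add 1 2) auto
    thus ?thesis by (rule pow_mono) (simp add: d_def)
  qed
  show thesis
  proof (rule that[of "Suc (Suc d)"], goal_cases)
    case (1 I Z F env)
    note I = 1(1) and env = 1(2)
    obtain t where t: "t \<le> data_size (env ! 0) * K Z" "eval P env (P ! g) (F env) t"
      using K[OF I env] by blast
    have l: "length env = n" "sz env \<le> Z" using I[OF env] by auto
    have "data_size (env ! 0) \<le> sz env"
      using l(1) g(5) by (intro member_le_sum_list) auto
    hence "data_size (env ! 0) \<le> Z + 2" using l(2) by simp
    hence "t \<le> (Z + 2) * (Z + 2) ^ Suc d" using t(1) mult_le_mono[OF _ Kd] le_trans by blast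
    thus ?case using t(2) by auto
  qed
qed

text \<open>The weight \<open>w\<close> dominates the size of the arguments and never grows along
  the recursion. The plain size can lack this property when an accumulator grows, as the counter of
  \<open>iLab\<close> does.\<close>

lemma fn_loop:
  assumes g: "P ! g = loop g h us b" "g < length P" "h < length P" "P ! h = e" "length us = n" "0 < n"
    and H: "pt P (Suc n) e H" and U: "pts P n us U" and B: "pt P n b B"
    and F0: "\<And>v. length v = n \<Longrightarrow> v ! 0 = Atom \<Longrightarrow> F v = B v"
    and F1: "\<And>v. length v = n \<Longrightarrow> v ! 0 \<noteq> Atom \<Longrightarrow> F v = H (F (U v) # v)"
    and m: "\<And>v. length v = n \<Longrightarrow> v ! 0 \<noteq> Atom \<Longrightarrow> data_size (U v ! 0) < data_size (v ! 0)"
    and w1: "\<And>v. length v = n \<Longrightarrow> sz v \<le> w v"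
    and w2: "\<And>v. length v = n \<Longrightarrow> v ! 0 \<noteq> Atom \<Longrightarrow> w (U v) \<le> w v"
    and w3: "\<And>v. length v = n \<Longrightarrow> w v \<le> (sz v + 2) ^ k"
    and s: "\<And>v. length v = n \<Longrightarrow> data_size (F v) \<le> (w v + 2) ^ l"
  shows "fn P n g F"
proof -
  obtain c where c: "\<And>I Z F env. (\<And>v. v \<in> I \<Longrightarrow> length v = n \<and> sz v \<le> Z \<and> data_size (F v) \<le> Z \<and>
        (v ! 0 = Atom \<longrightarrow> F v = B v) \<and>
        (v ! 0 \<noteq> Atom \<longrightarrow> U v \<in> I \<and> data_size (U v ! 0) < data_size (v ! 0) \<and> F v = H (F (U v) # v)))
      \<Longrightarrow> env \<in> I \<Longrightarrow> \<exists>t \<le> (Z + 2) ^ c. eval P env (P ! g) (F env) t"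
    using loop_time[OF g(1-3,5,6) H[folded g(4)] U B] by blast
  define e where "e = Suc (Suc k) * Suc l"
  have w_pow: "(w v + 2) ^ Suc l \<le> (sz v + 2) ^ e" if "length v = n" for v
    unfolding e_def by (rule pow_comp[OF w3[OF that]])
  have sF: "data_size (F v) \<le> (sz v + 2) ^ e" if "length v = n" for v
    using s[OF that] w_pow[OF that] pow_mono[of _ "w v" l "Suc l"] by (meson le_SucI le_refl le_trans)
  have "pt P n (P ! g) F"
  proof (rule ptI[where c = "Suc (Suc e) * c + e"], goal_cases)
    case (1 env)
    define I where "I = {v. length v = n \<and> w v \<le> w env}"
    have "\<exists>t \<le> ((sz env + 2) ^ e + 2) ^ c. eval P env (P ! g) (F env) t"
    proof (rule c[of I])
      show "env \<in> I" using 1 by (simp add: I_def)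
      fix v assume "v \<in> I"
      hence v: "length v = n" "w v \<le> w env" by (auto simp: I_def)
      have "(w v + 2) ^ Suc l \<le> (w env + 2) ^ Suc l" using v by (intro power_mono) auto
      hence z: "(w v + 2) ^ Suc l \<le> (sz env + 2) ^ e" using w_pow[OF 1] by linarith
      have "w v \<le> (w v + 2) ^ Suc l"
        using self_le_power[of "w v + 2" "Suc l"] by linarith
      hence "sz v \<le> (sz env + 2) ^ e" using w1[OF v(1)] z by linarith
      moreover have "data_size (F v) \<le> (sz env + 2) ^ e"
        using s[OF v(1)] z pow_mono[of _ "w v" l "Suc l"] by (meson le_SucI le_refl le_trans)
      moreover have "v ! 0 \<noteq> Atom \<longrightarrow> U v \<in> I"
        using w2[OF v(1)] v pts_length[OF U v(1)] g(5) by (auto simp: I_def)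
      ultimately show "length v = n \<and> sz v \<le> (sz env + 2) ^ e \<and> data_size (F v) \<le> (sz env + 2) ^ e \<and>
        (v ! 0 = Atom \<longrightarrow> F v = B v) \<and>
        (v ! 0 \<noteq> Atom \<longrightarrow> U v \<in> I \<and> data_size (U v ! 0) < data_size (v ! 0) \<and> F v = H (F (U v) # v))"
        using v F0 F1 m by blast
    qed
    then obtain t where t: "t \<le> ((sz env + 2) ^ e + 2) ^ c" "eval P env (P ! g) (F env) t" by blast
    have "t \<le> (sz env + 2) ^ (Suc (Suc e) * c)" using t(1) pow_comp[OF le_refl] le_trans by blast
    hence "t \<le> (sz env + 2) ^ (Suc (Suc e) * c + e)" by (rule pow_mono) simp
    thus ?case using t(2) by blast
  next
    case (2 env)
    from sF[OF 2] show ?case by (rule pow_mono) simp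
  qed
  thus ?thesis using g(2) by (simp add: fn_def)
qed

section \<open>The subroutines as mathematical functions\<close>

section \<open>The algorithm on trees\<close>

text \<open>
  An item \<open>i\<close> is a pair of a variable \<open>vr i\<close> and a block \<open>el i\<close> of consecutive elements of its domain.
\<close>

abbreviation "vr i \<equiv> data_fst i"
abbreviation "el i \<equiv> sp (data_snd i)"

abbreviation "cdoms C \<equiv> data_fst C"
abbreviation "cv1 C \<equiv> data_fst (data_snd C)"
abbreviation "cv2 C \<equiv> data_fst (data_snd (data_snd C))"
abbreviation "cbase C \<equiv> data_fst (data_snd (data_snd (data_snd C)))"
abbreviation "crevs1 C \<equiv> data_fst (data_snd (data_snd (data_snd (data_snd C))))"
abbreviation "crevs2 C \<equiv> data_snd (data_snd (data_snd (data_snd (data_snd C))))"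

fun tab :: "data list \<Rightarrow> data \<Rightarrow> data \<Rightarrow> data" where
  "tab [] ts a = a"
| "tab (x # xs) ts a = (if x = a then data_fst ts else tab xs (data_snd ts) a)"

fun tabs :: "data list \<Rightarrow> data list \<Rightarrow> data \<Rightarrow> data" where
  "tabs [] D a = a"
| "tabs (r # rs) D a = tabs rs D (tab D r a)"

definition rel :: "data \<Rightarrow> data \<Rightarrow> data \<Rightarrow> bool" where
  "rel C a b \<longleftrightarrow> Pair (tabs (sp (crevs1 C)) (sp (data_fst (cdoms C))) a)
     (tabs (sp (crevs2 C)) (sp (data_snd (cdoms C))) b) \<in> set (sp (cbase C))"

definition some_rel :: "bool \<Rightarrow> data \<Rightarrow> data list \<Rightarrow> data list \<Rightarrow> bool" where
  "some_rel f C P Q \<longleftrightarrow> (\<exists>p\<in>set P. \<exists>q\<in>set Q. rel C p q = f)"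

definition bad1 :: "bool \<Rightarrow> data \<Rightarrow> data \<Rightarrow> data \<Rightarrow> bool" where
  "bad1 m C i j \<longleftrightarrow> cv1 C = vr i \<and> cv2 C = vr j \<and> some_rel False C (el i) (el j) \<and>
     (m \<longrightarrow> some_rel True C (el i) (el j))"

text \<open>
  \<open>bad False\<close>: some constraint between the two blocks is violated by some pair, so that the
  blocks cannot be combined freely.  \<open>bad True\<close>: some constraint is neither full nor empty on
  them; only such mixed pairs require a recursive call.
\<close>

definition bad :: "bool \<Rightarrow> data list \<Rightarrow> data \<Rightarrow> data \<Rightarrow> bool" where
  "bad m cs i j \<longleftrightarrow> (\<exists>C\<in>set cs. bad1 m C i j \<or> bad1 m C j i)"

abbreviation nbrs :: "data list \<Rightarrow> data list \<Rightarrow> data \<Rightarrow> data list" where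
  "nbrs cs I i \<equiv> filter (bad True cs i) I"

definition start :: "data list \<Rightarrow> data \<Rightarrow> data \<Rightarrow> bool" where
  "start Js x v \<longleftrightarrow> (\<exists>j\<in>set Js. vr j = x \<and> data_fst (data_snd j) = v)"

text \<open>The element tested by \<open>start\<close> is the second one of \<open>G\<close>:
  putting an element in front of a part buries the former first element of that part, which must not
  be a forced starting point.\<close>

definition okP :: "nat \<Rightarrow> data list \<Rightarrow> data list \<Rightarrow> nat \<Rightarrow> data list \<Rightarrow> data \<Rightarrow> data \<Rightarrow> bool" where
  "okP s I cs u Js x G \<longleftrightarrow> length (sp G) \<le> s \<and> length (nbrs cs I (Pair x G)) \<le> u \<and>
     \<not> start Js x (data_fst (data_snd G))"

text \<open>Works from the right end: an element joins the part behind it if the enlarged part is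
  acceptable, and otherwise opens a new part. A fresh part is a singleton that is never tested by
  \<open>ok\<close>.\<close>

fun greedy :: "(data \<Rightarrow> bool) \<Rightarrow> data list \<Rightarrow> data list" where
  "greedy ok [] = []"
| "greedy ok (x # xs) = (case greedy ok xs of [] \<Rightarrow> [Pair x Atom]
     | G # Gs \<Rightarrow> if ok (Pair x G) then Pair x G # Gs else Pair x Atom # G # Gs)"

definition parts :: "nat \<Rightarrow> data list \<Rightarrow> data list \<Rightarrow> nat \<Rightarrow> data list \<Rightarrow> data list \<Rightarrow> data list" where
  "parts s I cs u Js S =
     concat (map (\<lambda>i. map (Pair (vr i)) (greedy (okP s I cs u Js (vr i)) (el i))) S)"

fun its :: "data list \<Rightarrow> data list \<Rightarrow> nat \<Rightarrow> data list \<Rightarrow> nat \<Rightarrow> nat \<Rightarrow> data list" where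
  "its it S n cs u 0 = it"
| "its it S n cs u (Suc l) = parts n (its it S n cs u l) cs u [] S"

fun alls :: "data list \<Rightarrow> data list \<Rightarrow> nat \<Rightarrow> data list \<Rightarrow> nat \<Rightarrow> nat \<Rightarrow> data list" where
  "alls it S n cs u 0 = it"
| "alls it S n cs u (Suc l) = its it S n cs u (Suc l) @ alls it S n cs u l"

text \<open>
  The partitions \<open>its\<close> are built such that every part has at most \<open>u\<close> mixed neighbours in the
  preceding partition.  Forcing cuts at all starting points recorded in \<open>alls\<close> makes the result a
  common refinement; its parts are short because those of the first partition are.
\<close>

definition refine :: "nat \<Rightarrow> nat \<Rightarrow> data list \<Rightarrow> nat \<Rightarrow> data list \<Rightarrow> data list" where
  "refine s n cs u S = parts n [] cs u (alls (parts s [] cs u [] S) S n cs u u) S"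

definition anyb :: "bool \<Rightarrow> data list \<Rightarrow> data list \<Rightarrow> data \<Rightarrow> bool" where
  "anyb m cs g i \<longleftrightarrow> (\<exists>j\<in>set g. bad m cs i j)"

definition ext :: "data list \<Rightarrow> data list \<Rightarrow> data \<Rightarrow> data list" where
  "ext cs F g = map (\<lambda>j. Pair j g) (filter (\<lambda>j. vr j \<notin> vr ` set (sp g) \<and> anyb True cs (sp g) j) F)"

definition growl :: "data list \<Rightarrow> data list \<Rightarrow> data list \<Rightarrow> data list" where
  "growl cs F L = concat (map (\<lambda>g. ext cs F g @ [g]) L)"

text \<open>Selections with at most one block per variable, grown from a single block by adding
  blocks mixed with one already chosen. Among them are the connected components of the selection
  induced by any solution.\<close>

definition grow :: "data list \<Rightarrow> data list \<Rightarrow> nat \<Rightarrow> data list" where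
  "grow cs F k = (growl cs F ^^ k) (map (\<lambda>i. Pair i Atom) F)"

definition incompat :: "data list \<Rightarrow> data list \<Rightarrow> data list \<Rightarrow> bool" where
  "incompat cs a g \<longleftrightarrow> (\<exists>i\<in>set a. vr i \<in> vr ` set g \<or> anyb False cs g i)"

definition cext :: "data list \<Rightarrow> data list \<Rightarrow> data \<Rightarrow> data list" where
  "cext cs G a = map (\<lambda>g. ls (sp g @ sp a)) (filter (\<lambda>g. \<not> incompat cs (sp a) (sp g)) G)"

definition covl :: "data list \<Rightarrow> data list \<Rightarrow> data list \<Rightarrow> data list" where
  "covl cs G A = concat (map (\<lambda>a. cext cs G a @ [a]) A)"

definition cover :: "data list \<Rightarrow> data list \<Rightarrow> nat \<Rightarrow> data list" where
  "cover cs G k = (covl cs G ^^ k) [Atom]"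

fun half :: "data list \<Rightarrow> data list" where
  "half (x # y # xs) = Atom # half xs"
| "half xs = []"

fun inc :: "data \<Rightarrow> data" where
  "inc Atom = Pair (Pair Atom Atom) Atom"
| "inc (Pair b r) = (if b \<noteq> Atom then Pair Atom (inc r) else Pair (Pair Atom Atom) r)"

fun lab :: "data list \<Rightarrow> data \<Rightarrow> data list" where
  "lab [] i = []"
| "lab (D # Ds) i = Pair i D # lab Ds (inc i)"

fun look :: "data list \<Rightarrow> data \<Rightarrow> data" where
  "look [] x = Atom"
| "look (d # ds) x = (if data_fst d = x then data_snd d else look ds x)"

text \<open>An encoded reversion is the bare list of its values; the two domains put in front of the
  constraint supply the keys of these tables.\<close>

definition att :: "data list \<Rightarrow> data list \<Rightarrow> data list" where
  "att ds cs = map (\<lambda>c. Pair (Pair (look ds (data_fst c)) (look ds (data_fst (data_snd c)))) c) cs"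

text \<open>Its length is the sum of the depths. Appended to the lists of domains and constraints it
  therefore gives the parameter in unary, without arithmetic.\<close>

definition revlists :: "data list \<Rightarrow> data list" where
  "revlists cs = concat (map (\<lambda>c. sp (data_fst (data_snd (data_snd (data_snd c)))) @
     sp (data_snd (data_snd (data_snd (data_snd c))))) cs)"

section \<open>The program\<close>

abbreviation (input) "iEq \<equiv> 82 :: nat"
abbreviation (input) "iApp \<equiv> 2 :: nat"
abbreviation (input) "iMem \<equiv> 4 :: nat"
abbreviation (input) "iTab \<equiv> 6 :: nat"
abbreviation (input) "iTabs \<equiv> 8 :: nat"
abbreviation (input) "iRel \<equiv> 10 :: nat"
abbreviation (input) "iRow \<equiv> 11 :: nat"
abbreviation (input) "iSome \<equiv> 13 :: nat"
abbreviation (input) "iBad1 \<equiv> 15 :: nat"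
abbreviation (input) "iBad \<equiv> 16 :: nat"
abbreviation (input) "iNbrs \<equiv> 18 :: nat"
abbreviation (input) "iLe \<equiv> 20 :: nat"
abbreviation (input) "iStart \<equiv> 22 :: nat"
abbreviation (input) "iOk \<equiv> 24 :: nat"
abbreviation (input) "iGreedy \<equiv> 25 :: nat"
abbreviation (input) "iTag \<equiv> 27 :: nat"
abbreviation (input) "iParts \<equiv> 29 :: nat"
abbreviation (input) "iRnd \<equiv> 31 :: nat"
abbreviation (input) "iAddr \<equiv> 33 :: nat"
abbreviation (input) "iAnyb \<equiv> 34 :: nat"
abbreviation (input) "iInset \<equiv> 36 :: nat"
abbreviation (input) "iExt \<equiv> 38 :: nat"
abbreviation (input) "iGrowl \<equiv> 40 :: nat"
abbreviation (input) "iSingles \<equiv> 42 :: nat"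
abbreviation (input) "iGrow \<equiv> 44 :: nat"
abbreviation (input) "iIncompat \<equiv> 46 :: nat"
abbreviation (input) "iCext \<equiv> 48 :: nat"
abbreviation (input) "iCovl \<equiv> 50 :: nat"
abbreviation (input) "iCover \<equiv> 52 :: nat"
abbreviation (input) "iLong \<equiv> 54 :: nat"
abbreviation (input) "iChk \<equiv> 56 :: nat"
abbreviation (input) "iHalf \<equiv> 58 :: nat"
abbreviation (input) "iHalves \<equiv> 60 :: nat"
abbreviation (input) "iSolve \<equiv> 62 :: nat"
abbreviation (input) "iStep \<equiv> 63 :: nat"
abbreviation (input) "iFilt \<equiv> 64 :: nat"
abbreviation (input) "iInc \<equiv> 66 :: nat"
abbreviation (input) "iLab \<equiv> 68 :: nat"
abbreviation (input) "iLook \<equiv> 70 :: nat"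
abbreviation (input) "iAtt \<equiv> 72 :: nat"
abbreviation (input) "iRevlists \<equiv> 74 :: nat"
abbreviation (input) "iDbl \<equiv> 76 :: nat"
abbreviation (input) "iPow \<equiv> 77 :: nat"
abbreviation (input) "iCat \<equiv> 79 :: nat"
abbreviation (input) "iFinal \<equiv> 81 :: nat"
abbreviation (input) "iMain2 \<equiv> 1 :: nat"
abbreviation (input) "iMain3 \<equiv> 83 :: nat"

abbreviation "TrueE \<equiv> PairE AtomE AtomE"
abbreviation "OrE a b \<equiv> IfE a TrueE b"
abbreviation "AndE a b \<equiv> IfE a b AtomE"
abbreviation "NotE a \<equiv> IfE a AtomE TrueE"

definition foldE :: "nat \<Rightarrow> nat \<Rightarrow> exp \<Rightarrow> exp" where
  "foldE g n b = loop g (Suc g) (SndE (Var 0) # map Var [1..<n]) b"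

text \<open>
  The entry after a loop is its step function; there \<open>Var 0\<close> is the result of the recursive call
  and the arguments of the loop are shifted by one.
\<close>

definition prog :: program where
  "prog = [
    Call iMain2 [Var 0, Call iLab [FstE (Var 0), AtomE]],
    \<comment> \<open>\<open>iMain2\<close>\<close>
    Call iMain3 [Call iCat [FstE (Var 0)], Var 1, Call iAtt [SndE (Var 0), Var 1],
      Call iApp [FstE (Var 0), Call iApp [SndE (Var 0), Call iRevlists [SndE (Var 0)]]]],
    foldE iApp 2 (Var 1),
      PairE (FstE (Var 1)) (Var 0),
    foldE iMem 2 AtomE,
      OrE (Call iEq [FstE (Var 1), Var 2]) (Var 0),
    loop iTab (Suc iTab) [SndE (Var 0), SndE (Var 1), Var 2] (Var 2),
      IfE (Call iEq [FstE (Var 1), Var 3]) (FstE (Var 2)) (Var 0),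
    loop iTabs (Suc iTabs) [SndE (Var 0), Var 1, Call iTab [Var 1, FstE (Var 0), Var 2]] (Var 2),
      Var 0,
    \<comment> \<open>\<open>iRel\<close>\<close>
    Call iMem [FstE (SndE (SndE (SndE (Var 0)))),
      PairE (Call iTabs [FstE (SndE (SndE (SndE (SndE (Var 0))))), FstE (FstE (Var 0)), Var 1])
        (Call iTabs [SndE (SndE (SndE (SndE (SndE (Var 0))))), SndE (FstE (Var 0)), Var 2])],
    foldE iRow 4 AtomE,
      IfE (Call iRel [Var 2, Var 3, FstE (Var 1)]) (OrE (Var 4) (Var 0)) (IfE (Var 4) (Var 0) TrueE),
    foldE iSome 4 AtomE,
      OrE (Call iRow [Var 3, Var 2, FstE (Var 1), Var 4]) (Var 0),
    \<comment> \<open>\<open>iBad1\<close>\<close>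
    AndE (Call iEq [FstE (SndE (Var 0)), FstE (Var 1)])
      (AndE (Call iEq [FstE (SndE (SndE (Var 0))), FstE (Var 2)])
        (AndE (Call iSome [SndE (Var 1), Var 0, SndE (Var 2), AtomE])
          (IfE (Var 3) (Call iSome [SndE (Var 1), Var 0, SndE (Var 2), TrueE]) TrueE))),
    foldE iBad 4 AtomE,
      OrE (Call iBad1 [FstE (Var 1), Var 2, Var 3, Var 4])
        (OrE (Call iBad1 [FstE (Var 1), Var 3, Var 2, Var 4]) (Var 0)),
    foldE iNbrs 3 AtomE,
      IfE (Call iBad [Var 3, Var 2, FstE (Var 1), TrueE]) (PairE (FstE (Var 1)) (Var 0)) (Var 0),
    loop iLe (Suc iLe) [SndE (Var 0), SndE (Var 1)] TrueE,
      AndE (Var 2) (Var 0),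
    foldE iStart 3 AtomE,
      OrE (AndE (Call iEq [FstE (FstE (Var 1)), Var 2]) (Call iEq [FstE (SndE (FstE (Var 1))), Var 3]))
        (Var 0),
    \<comment> \<open>\<open>iOk\<close>\<close>
    AndE (Call iLe [Var 0, Var 2])
      (AndE (Call iLe [Call iNbrs [Var 3, PairE (Var 1) (Var 0), Var 4], Var 5])
        (NotE (Call iStart [Var 6, Var 1, FstE (SndE (Var 0))]))),
    foldE iGreedy 7 AtomE,
      IfE (Var 0)
        (IfE (Call iOk [PairE (FstE (Var 1)) (FstE (Var 0)), Var 2, Var 3, Var 4, Var 5, Var 6, Var 7])
          (PairE (PairE (FstE (Var 1)) (FstE (Var 0))) (SndE (Var 0)))
          (PairE (PairE (FstE (Var 1)) AtomE) (Var 0)))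
        (PairE (PairE (FstE (Var 1)) AtomE) AtomE),
    foldE iTag 3 (Var 2),
      PairE (PairE (Var 2) (FstE (Var 1))) (Var 0),
    foldE iParts 6 AtomE,
      Call iTag [Call iGreedy [SndE (FstE (Var 1)), FstE (FstE (Var 1)), Var 2, Var 3, Var 4, Var 5, Var 6],
        FstE (FstE (Var 1)), Var 0],
    foldE iRnd 6 (PairE (Var 1) (Var 1)),
      Call iAddr [Call iParts [Var 3, Var 4, FstE (Var 0), Var 5, Var 6, AtomE], Var 0],
    \<comment> \<open>\<open>iAddr\<close>\<close>
    PairE (Var 0) (Call iApp [Var 0, SndE (Var 1)]),
    foldE iAnyb 4 AtomE,
      OrE (Call iBad [Var 3, Var 2, FstE (Var 1), Var 4]) (Var 0),
    foldE iInset 2 AtomE,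
      OrE (Call iEq [FstE (FstE (Var 1)), Var 2]) (Var 0),
    foldE iExt 4 (Var 3),
      IfE (Call iInset [Var 2, FstE (FstE (Var 1))]) (Var 0)
        (IfE (Call iAnyb [Var 2, FstE (Var 1), Var 3, TrueE]) (PairE (PairE (FstE (Var 1)) (Var 2)) (Var 0))
          (Var 0)),
    foldE iGrowl 3 AtomE,
      Call iExt [Var 2, FstE (Var 1), Var 3, PairE (FstE (Var 1)) (Var 0)],
    foldE iSingles 1 AtomE,
      PairE (PairE (FstE (Var 1)) AtomE) (Var 0),
    foldE iGrow 3 (Call iSingles [Var 1]),
      Call iGrowl [Var 0, Var 2, Var 3],
    foldE iIncompat 3 AtomE,
      OrE (Call iInset [Var 2, FstE (FstE (Var 1))])
        (OrE (Call iAnyb [Var 2, FstE (Var 1), Var 3, AtomE]) (Var 0)),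
    foldE iCext 4 (Var 3),
      IfE (Call iIncompat [Var 2, FstE (Var 1), Var 3]) (Var 0)
        (PairE (Call iApp [FstE (Var 1), Var 2]) (Var 0)),
    foldE iCovl 3 AtomE,
      Call iCext [Var 2, FstE (Var 1), Var 3, PairE (FstE (Var 1)) (Var 0)],
    foldE iCover 3 (PairE AtomE AtomE),
      Call iCovl [Var 0, Var 2, Var 3],
    foldE iLong 2 AtomE,
      OrE (Call iLe [Var 2, FstE (Var 1)]) (Var 0),
    foldE iChk 3 AtomE,
      OrE (Call iAnyb [Var 2, FstE (Var 1), Var 3, AtomE]) (Var 0),
    loop iHalf (Suc iHalf) [SndE (SndE (Var 0))] AtomE,
      IfE (SndE (Var 1)) (PairE AtomE (Var 0)) AtomE,
    foldE iHalves 2 (Var 1),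
      Call iHalf [Var 0],
    \<comment> \<open>\<open>iSolve\<close>\<close>
    IfE (SndE (Var 0)) (Call iStep [Call iHalves [Var 3, Var 0], Var 0, Var 1, Var 2, Var 3])
      (NotE (Call iChk [Var 1, Var 1, Var 2])),
    \<comment> \<open>\<open>iStep\<close>\<close>
    Call iLong [Call iCover [Var 2, Call iFilt [Call iGrow [Var 2,
        Call iFinal [Var 0, Var 1, Var 2, Var 3, Var 4], Var 3], Var 0, Var 3, Var 4], Var 3], Var 2],
    foldE iFilt 4 AtomE,
      IfE (Call iSolve [Var 2, FstE (Var 1), Var 3, Var 4]) (PairE (FstE (Var 1)) (Var 0)) (Var 0),
    foldE iInc 1 (PairE TrueE AtomE),
      IfE (FstE (Var 1)) (PairE AtomE (Var 0)) (PairE TrueE (SndE (Var 1))),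
    loop iLab (Suc iLab) [SndE (Var 0), Call iInc [Var 1]] AtomE,
      PairE (PairE (Var 2) (FstE (Var 1))) (Var 0),
    foldE iLook 2 AtomE,
      IfE (Call iEq [FstE (FstE (Var 1)), Var 2]) (SndE (FstE (Var 1))) (Var 0),
    foldE iAtt 2 AtomE,
      PairE (PairE (PairE (Call iLook [Var 2, FstE (FstE (Var 1))])
          (Call iLook [Var 2, FstE (SndE (FstE (Var 1)))])) (FstE (Var 1))) (Var 0),
    foldE iRevlists 1 AtomE,
      Call iApp [FstE (SndE (SndE (SndE (FstE (Var 1))))),
        Call iApp [SndE (SndE (SndE (SndE (FstE (Var 1))))), Var 0]],
    \<comment> \<open>\<open>iDbl\<close>\<close>
    Call iApp [Var 0, Var 0],
    foldE iPow 1 (Call iDbl [Call iDbl [Call iDbl [Call iDbl [Call iDbl [Call iDbl [Call iDbl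
      [Call iDbl [TrueE]]]]]]]]),
      Call iDbl [Call iDbl [Call iDbl [Call iDbl [Call iDbl [Call iDbl [Call iDbl
        [Call iDbl [Var 0]]]]]]]],
    foldE iCat 1 (PairE AtomE (PairE AtomE AtomE)),
      Call iApp [FstE (Var 1), Var 0],
    \<comment> \<open>\<open>iFinal\<close>\<close>
    Call iParts [Var 2, Var 1, AtomE, Var 3, Var 4,
      SndE (Call iRnd [Var 4, Call iParts [Var 2, Var 0, AtomE, Var 3, Var 4, AtomE], Var 2, Var 1, Var 3, Var 4])],
    \<comment> \<open>\<open>iEq\<close>\<close>
    IfE (Var 0)
      (AndE (Var 1) (AndE (Call iEq [FstE (Var 0), FstE (Var 1)]) (Call iEq [SndE (Var 0), SndE (Var 1)])))
      (NotE (Var 1)),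
    \<comment> \<open>\<open>iMain3\<close>\<close>
    Call iSolve [Var 0, Var 1, Var 2, Call iPow [Var 3]]
  ]"

lemma length_prog [simp]: "length prog = 84"
  by (simp add: prog_def)

section \<open>Every nonrecursive subroutine meets its specification in polynomial time\<close>

section \<open>Polynomial-time subroutines\<close>

lemma fn_plain:
  assumes "P ! g = e" "g < length P" "pt P n e F'" "\<And>v. length v = n \<Longrightarrow> F' v = F v"
  shows "fn P n g F"
  using assms pt_cong by (auto simp: fn_def)

lemma pts_fold_args:
  "pts P (Suc n) (SndE (Var 0) # map Var [1..<Suc n]) (\<lambda>v. data_snd (v ! 0) # drop 1 v)"
proof -
  have "pts P (Suc n) (map Var [k..<Suc n]) (drop k)" for k
  proof (induction "Suc n - k" arbitrary: k)
    case 0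
    hence "pts P (Suc n) (map Var [k..<Suc n]) (\<lambda>_. [])" by (auto intro: pts_Nil)
    thus ?case by (rule pts_cong) (use 0 in auto)
  next
    case (Suc d)
    hence k: "k < Suc n" by simp
    from Suc have "pts P (Suc n) (map Var [Suc k..<Suc n]) (drop (Suc k))" by simp
    hence "pts P (Suc n) (Var k # map Var [Suc k..<Suc n]) (\<lambda>v. v ! k # drop (Suc k) v)"
      by (intro pts_Cons pt_Var k)
    moreover have "v ! k # drop (Suc k) v = drop k v" if "length v = Suc n" for v :: "data list"
      using that k by (simp add: Cons_nth_drop_Suc)
    ultimately show ?case unfolding upt_conv_Cons[OF k] list.map(2) by (rule pts_cong)
  qed
  thus "pts P (Suc n) (SndE (Var 0) # map Var [1..<Suc n]) (\<lambda>v. data_snd (v ! 0) # drop 1 v)"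
    by (intro pts_Cons pt_Snd pt_Var) auto
qed

text \<open>Only the first argument changes, and it shrinks, so the size of the arguments serves as
  its own weight.\<close>

lemma fn_fold:
  assumes g: "P ! g = foldE g m b" "g < length P" "Suc g < length P" "P ! Suc g = e" "0 < m"
    and H: "pt P (Suc m) e H" and B: "pt P m b B"
    and F0: "\<And>es. length es = m - 1 \<Longrightarrow> F (Atom # es) = B (Atom # es)"
    and F1: "\<And>x xs es. length es = m - 1 \<Longrightarrow> F (Pair x xs # es) = H (F (xs # es) # Pair x xs # es)"
    and s: "\<And>x es. length es = m - 1 \<Longrightarrow> data_size (F (x # es)) \<le> (sz (x # es) + 2) ^ l"
  shows "fn P m g F"
proof -
  obtain n where m: "m = Suc n" using \<open>0 < m\<close> by (cases m) auto
  note H = H[unfolded m] and B = B[unfolded m] and g = g[unfolded m]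
  have F0: "\<And>es. length es = n \<Longrightarrow> F (Atom # es) = B (Atom # es)"
    and F1: "\<And>x xs es. length es = n \<Longrightarrow> F (Pair x xs # es) = H (F (xs # es) # Pair x xs # es)"
    and s: "\<And>x es. length es = n \<Longrightarrow> data_size (F (x # es)) \<le> (sz (x # es) + 2) ^ l"
    using F0 F1 s m by auto
  note U = pts_fold_args[of P n]
  have cases_v: thesis if "length v = Suc n" "\<And>x es. v = x # es \<Longrightarrow> length es = n \<Longrightarrow> thesis"
    for v :: "data list" and thesis using that by (cases v) auto
  show ?thesis unfolding m
  proof (rule fn_loop[OF g(1)[unfolded foldE_def] g(2,3,4) _ _ H U B, where w = sz and k = 1 and l = l])
    show "length (SndE (Var 0) # map Var [1..<Suc n]) = Suc n" by simp
  next
    fix v :: "data list" assume "length v = Suc n" "v ! 0 = Atom"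
    thus "F v = B v" using F0 by (cases v) auto
  next
    fix v :: "data list" assume v: "length v = Suc n" "v ! 0 \<noteq> Atom"
    then obtain x xs es where "v = Pair x xs # es" "length es = n"
      by (cases v; cases "v ! 0") auto
    thus "F v = H (F (data_snd (v ! 0) # drop 1 v) # v)"
      and "data_size ((data_snd (v ! 0) # drop 1 v) ! 0) < data_size (v ! 0)"
      and "sz (data_snd (v ! 0) # drop 1 v) \<le> sz v"
      using F1 by auto
  next
    fix v :: "data list" assume "length v = Suc n"
    thus "data_size (F v) \<le> (sz v + 2) ^ l" using s by (cases v) auto
  qed auto
qed

lemma size_ls_append: "data_size (ls (xs @ ys)) + 1 = data_size (ls xs) + data_size (ls ys)"
  by (simp add: data_size_ls)

lemma enc_bool_pow: "2 \<le> s \<Longrightarrow> data_size (enc_bool b) \<le> s ^ 2"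
  using data_size_enc_bool[of b] power_mono[of 2 s 2] by simp

text \<open>Equality recurses into both components and so falls outside the scheme
  \<open>loop\<close>. Its evaluations are charged to the nodes of the first tree, at most 20 per
  node.\<close>

lemma fn_eq: "fn prog 2 iEq (\<lambda>v. enc_bool (v ! 0 = v ! 1))"
proof -
  have P: "prog ! iEq = IfE (Var 0)
      (AndE (Var 1) (AndE (Call iEq [FstE (Var 0), FstE (Var 1)]) (Call iEq [SndE (Var 0), SndE (Var 1)])))
      (NotE (Var 1))"
    by (simp add: prog_def)
  have v0: "eval prog [a, b] (Var 0) a 1" and v1: "eval prog [a, b] (Var 1) b 1" for a b
    using eval_Var[of 0 "[a, b]" prog] eval_Var[of 1 "[a, b]" prog] by auto
  have T: "eval prog env TrueE (Pair Atom Atom) 3" for env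
    using eval_Pair[OF eval_Atom eval_Atom] by (simp add: eval_nat_numeral)
  have "\<exists>t \<le> 20 * data_size a. eval prog [a, b] (prog ! iEq) (enc_bool (a = b)) t" for a b
  proof (induction a arbitrary: b)
    case Atom
    show ?case
    proof (cases b)
      case Atom
      have "eval prog [Atom, b] (NotE (Var 1)) (Pair Atom Atom) (1 + 3 + 1)"
        using eval_If_False[OF _ T] v1[of Atom Atom] Atom by blast
      from eval_If_False[OF v0 this] show ?thesis unfolding P Atom
        by (intro exI[of _ 7]) (auto simp: enc_bool_def Atom)
    next
      case (Pair x y)
      have "eval prog [Atom, b] (NotE (Var 1)) Atom (1 + 1 + 1)"
        using eval_If_True[OF v1 _ eval_Atom] Pair by blast
      from eval_If_False[OF v0 this] show ?thesis unfolding P Pair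
        by (intro exI[of _ "1 + (1 + 1 + 1) + 1"]) (auto simp: enc_bool_def)
    qed
  next
    case (Pair a1 a2)
    show ?case
    proof (cases b)
      case Atom
      have "eval prog [Pair a1 a2, b] (AndE (Var 1) (AndE (Call iEq [FstE (Var 0), FstE (Var 1)])
         (Call iEq [SndE (Var 0), SndE (Var 1)]))) Atom (1 + 1 + 1)"
        using eval_If_False[OF _ eval_Atom] v1[of "Pair a1 a2" Atom] Atom by blast
      from eval_If_True[OF v0 _ this] show ?thesis unfolding P Atom
        by (intro exI[of _ "1 + (1 + 1 + 1) + 1"]) (auto simp: enc_bool_def)
    next
      case (Pair b1 b2)
      obtain t1 where t1: "t1 \<le> 20 * data_size a1" "eval prog [a1, b1] (prog ! iEq) (enc_bool (a1 = b1)) t1"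
        using Pair.IH(1) by blast
      obtain t2 where t2: "t2 \<le> 20 * data_size a2" "eval prog [a2, b2] (prog ! iEq) (enc_bool (a2 = b2)) t2"
        using Pair.IH(2) by blast
      note e = v0[of "Pair a1 a2" b] v1[of "Pair a1 a2" b]
      have f1: "evals prog [Pair a1 a2, b] [FstE (Var 0), FstE (Var 1)] [a1, b1] 4"
        using evals_Cons[OF eval_Fst[OF e(1)] evals_Cons[OF eval_Fst[OF e(2)] evals_Nil]] Pair by (simp add: eval_nat_numeral)
      have f2: "evals prog [Pair a1 a2, b] [SndE (Var 0), SndE (Var 1)] [a2, b2] 4"
        using evals_Cons[OF eval_Snd[OF e(1)] evals_Cons[OF eval_Snd[OF e(2)] evals_Nil]] Pair by (simp add: eval_nat_numeral)
      have c1: "eval prog [Pair a1 a2, b] (Call iEq [FstE (Var 0), FstE (Var 1)]) (enc_bool (a1 = b1)) (4 + t1 + 1)"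
        by (rule eval_Call[OF f1 _ t1(2)]) simp
      have c2: "eval prog [Pair a1 a2, b] (Call iEq [SndE (Var 0), SndE (Var 1)]) (enc_bool (a2 = b2)) (4 + t2 + 1)"
        by (rule eval_Call[OF f2 _ t2(2)]) simp
      have "\<exists>t \<le> t1 + t2 + 12. eval prog [Pair a1 a2, b] (AndE (Call iEq [FstE (Var 0), FstE (Var 1)])
          (Call iEq [SndE (Var 0), SndE (Var 1)])) (enc_bool (Pair a1 a2 = b)) t"
      proof (cases "a1 = b1")
        case True
        from eval_If_True[OF c1 _ c2, of AtomE] True show ?thesis
          by (intro exI[of _ "4 + t1 + 1 + (4 + t2 + 1) + 1"]) (auto simp: Pair)
      next
        case False
        from eval_If_False[OF c1[unfolded enc_bool_def if_not_P[OF False]] eval_Atom] False show ?thesis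
          by (intro exI[of _ "4 + t1 + 1 + 1 + 1"]) (auto simp: Pair enc_bool_def)
      qed
      then obtain t where t: "t \<le> t1 + t2 + 12" "eval prog [Pair a1 a2, b] (AndE (Call iEq [FstE (Var 0), FstE (Var 1)])
          (Call iEq [SndE (Var 0), SndE (Var 1)])) (enc_bool (Pair a1 a2 = b)) t" by blast
      have "b \<noteq> Atom" using Pair by simp
      from eval_If_True[OF v0 _ eval_If_True[OF v1 this t(2)]] t(1) t1(1) t2(1) show ?thesis
        unfolding P by (intro exI[of _ "1 + (1 + t + 1) + 1"]) auto
    qed
  qed
  note main = this
  have "pt prog 2 (prog ! iEq) (\<lambda>v. enc_bool (v ! 0 = v ! 1))"
  proof (rule ptI[where c = "Suc 5"], goal_cases)
    case (1 env)
    then obtain a b where env: "env = [a, b]"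
      by (metis (no_types, opaque_lifting) Suc_1 One_nat_def length_0_conv length_Suc_conv)
    obtain t where t: "t \<le> 20 * data_size a" "eval prog [a, b] (prog ! iEq) (enc_bool (a = b)) t"
      using main by blast
    have "(2::nat) ^ 5 \<le> (sz env + 2) ^ 5" by (intro power_mono) auto
    hence "20 \<le> (sz env + 2) ^ 5" by simp
    moreover have "data_size a \<le> sz env + 2" using env by simp
    ultimately have "20 * data_size a \<le> (sz env + 2) ^ 5 * (sz env + 2)"
      using mult_le_mono by blast
    also have "\<dots> = (sz env + 2) ^ Suc 5" by (rule power_Suc2[symmetric])
    finally have "t \<le> (sz env + 2) ^ Suc 5" using t(1) by (rule le_trans[rotated])
    thus ?case using t(2) unfolding env by (intro exI[of _ t]) (auto simp del: power_Suc)
  next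
    case (2 env)
    show ?case by (rule pow_mono[OF enc_bool_pow]) auto
  qed
  thus ?thesis by (simp add: fn_def)
qed

lemma fn_fold_bool:
  assumes "P ! g = foldE g m b" "g < length P" "Suc g < length P" "P ! Suc g = e" "0 < m"
    and "pt P (Suc m) e H" and "pt P m b B"
    and "\<And>es. length es = m - 1 \<Longrightarrow> B (Atom # es) = enc_bool (f (Atom # es))"
    and "\<And>x xs es. length es = m - 1 \<Longrightarrow>
      H (enc_bool (f (xs # es)) # Pair x xs # es) = enc_bool (f (Pair x xs # es))"
  shows "fn P m g (\<lambda>v. enc_bool (f v))"
proof (rule fn_fold[OF assms(1-7), where l = 2], goal_cases)
  case (1 es)
  thus ?case using assms(8) by metis
next
  case (2 x xs es)
  thus ?case using assms(9) by metis
next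
  case 3
  show ?case by (rule enc_bool_pow) simp
qed

lemma fn_app: "fn prog 2 iApp (\<lambda>v. ls (sp (v ! 0) @ sp (v ! 1)))"
  apply (rule fn_fold[where l = 1], (simp add: prog_def; fail)+)
     apply ((rule pt_intros | (simp; fail))+)
  subgoal for x es using size_ls_append[of "sp x" "sp (es ! 0)"] by (auto simp: length_Suc_conv)
  done

lemma fn_mem: "fn prog 2 iMem (\<lambda>v. enc_bool (v ! 1 \<in> set (sp (v ! 0))))"
  apply (rule fn_fold_bool, (simp add: prog_def; fail)+)
     apply ((rule pt_intros pt_Call[OF fn_eq] | (simp; fail))+)
  by (auto simp: enc_bool_def)

lemma size_tab: "data_size (tab D ts a) \<le> max (data_size ts) (data_size a)"
proof (induction D ts a rule: tab.induct)
  case (2 x xs ts a)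
  thus ?case using size_fst_le[of ts] size_snd_le[of ts] by auto
qed auto

lemma length_eq_3: "length v = 3 \<longleftrightarrow> (\<exists>a b c. v = [a, b, c])"
  by (auto simp: numeral_3_eq_3 length_Suc_conv)

lemma length_eq_2: "length v = 2 \<longleftrightarrow> (\<exists>a b. v = [a, b])"
  by (auto simp: numeral_2_eq_2 length_Suc_conv)

lemma fn_tab: "fn prog 3 iTab (\<lambda>v. tab (sp (v ! 0)) (v ! 1) (v ! 2))"
  apply (rule fn_loop[where w = sz and k = 1 and l = 1], (simp add: prog_def; fail)+)
            apply ((rule pt_intros pt_Call[OF fn_eq] | (simp; fail))+)
  subgoal for v using sp_unfold[of "v ! 0"] by auto
  subgoal for v using size_snd_less[of "v ! 0"] by auto
  subgoal by simp
  subgoal for v using size_snd_le[of "v ! 0"] size_snd_le[of "v ! 1"] by (auto simp: length_eq_3)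
  subgoal by simp
  subgoal for v using size_tab[of "sp (v ! 0)" "v ! 1" "v ! 2"] by (auto simp: length_eq_3)
  done

lemma size_tabs: "data_size (tabs rs D a) \<le> data_size (ls rs) + data_size a"
proof (induction rs D a rule: tabs.induct)
  case (2 r rs D a)
  thus ?case using size_tab[of D r a] by auto
qed auto

lemma fn_tabs: "fn prog 3 iTabs (\<lambda>v. tabs (sp (v ! 0)) (sp (v ! 1)) (v ! 2))"
  apply (rule fn_loop[where w = sz and k = 1 and l = 1], (simp add: prog_def; fail)+)
            apply ((rule pt_intros pt_Call[OF fn_tab] | (simp; fail))+)
  subgoal for v using sp_unfold[of "v ! 0"] by auto
  subgoal for v using size_snd_less[of "v ! 0"] by auto
  subgoal by simp
  subgoal for v using size_tab[of "sp (v ! 1)" "data_fst (v ! 0)" "v ! 2"]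
    by (cases "v ! 0") (auto simp: length_eq_3)
  subgoal by simp
  subgoal for v using size_tabs[of "sp (v ! 0)" "sp (v ! 1)" "v ! 2"] by (auto simp: length_eq_3)
  done

lemma fn_rel: "fn prog 3 iRel (\<lambda>v. enc_bool (rel (v ! 0) (v ! 1) (v ! 2)))"
  apply (rule fn_plain, (simp add: prog_def; fail)+)
   apply ((rule pt_intros pt_Call[OF fn_mem] pt_Call[OF fn_tabs] | (simp; fail))+)
  by (simp add: rel_def)

lemma fn_row: "fn prog 4 iRow
    (\<lambda>v. enc_bool (\<exists>q\<in>set (sp (v ! 0)). rel (v ! 1) (v ! 2) q = (v ! 3 \<noteq> Atom)))"
  apply (rule fn_fold_bool, (simp add: prog_def; fail)+)
     apply ((rule pt_intros pt_Call[OF fn_rel] | (simp; fail))+)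
  by (auto simp: enc_bool_def)

lemma fn_some: "fn prog 4 iSome
    (\<lambda>v. enc_bool (some_rel (v ! 3 \<noteq> Atom) (v ! 1) (sp (v ! 0)) (sp (v ! 2))))"
  unfolding some_rel_def
  apply (rule fn_fold_bool, (simp add: prog_def; fail)+)
     apply ((rule pt_intros pt_Call[OF fn_row] | (simp; fail))+)
  by (auto simp: enc_bool_def)

lemma fn_bad1: "fn prog 4 iBad1 (\<lambda>v. enc_bool (bad1 (v ! 3 \<noteq> Atom) (v ! 0) (v ! 1) (v ! 2)))"
  apply (rule fn_plain, (simp add: prog_def; fail)+)
   apply ((rule pt_intros pt_Call[OF fn_eq] pt_Call[OF fn_some] | (simp; fail))+)
  by (auto simp: bad1_def enc_bool_def)

lemma fn_bad: "fn prog 4 iBad (\<lambda>v. enc_bool (bad (v ! 3 \<noteq> Atom) (sp (v ! 0)) (v ! 1) (v ! 2)))"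
  unfolding bad_def
  apply (rule fn_fold_bool, (simp add: prog_def; fail)+)
     apply ((rule pt_intros pt_Call[OF fn_bad1] | (simp; fail))+)
  by (auto simp: enc_bool_def)

lemma size_filter: "data_size (ls (filter p xs)) \<le> data_size (ls xs)"
  by (induction xs) auto

lemma fn_nbrs: "fn prog 3 iNbrs (\<lambda>v. ls (nbrs (sp (v ! 2)) (sp (v ! 0)) (v ! 1)))"
  apply (rule fn_fold[where l = 1], (simp add: prog_def; fail)+)
     apply ((rule pt_intros pt_Call[OF fn_bad] | (simp; fail))+)
  subgoal for x es using size_filter[of _ "sp x"] by (simp add: trans_le_add1 le_SucI)
  done

lemma fn_le: "fn prog 2 iLe (\<lambda>v. enc_bool (length (sp (v ! 0)) \<le> length (sp (v ! 1))))"
  apply (rule fn_loop[where w = sz and k = 1 and l = 2], (simp add: prog_def; fail)+)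
            apply ((rule pt_intros | (simp; fail))+)
  subgoal for v by (simp add: enc_bool_def)
  subgoal for v using sp_unfold[of "v ! 0"] by (cases "v ! 1") (auto simp: enc_bool_def)
  subgoal for v using size_snd_less[of "v ! 0"] by auto
  subgoal by simp
  subgoal for v using size_snd_le[of "v ! 0"] size_snd_le[of "v ! 1"] by (auto simp: length_eq_2)
  subgoal by simp
  subgoal by (rule enc_bool_pow) simp
  done

lemma fn_start: "fn prog 3 iStart (\<lambda>v. enc_bool (start (sp (v ! 0)) (v ! 1) (v ! 2)))"
  unfolding start_def
  apply (rule fn_fold_bool, (simp add: prog_def; fail)+)
     apply ((rule pt_intros pt_Call[OF fn_eq] | (simp; fail))+)
  by (auto simp: enc_bool_def)

lemma fn_ok: "fn prog 7 iOk (\<lambda>v. enc_bool (okP (length (sp (v ! 2))) (sp (v ! 3)) (sp (v ! 4))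
    (length (sp (v ! 5))) (sp (v ! 6)) (v ! 1) (v ! 0)))"
  apply (rule fn_plain, (simp add: prog_def; fail)+)
   apply ((rule pt_intros pt_Call[OF fn_le] pt_Call[OF fn_nbrs] pt_Call[OF fn_start] | (simp; fail))+)
  by (auto simp: okP_def enc_bool_def)

lemma size_greedy: "data_size (ls (greedy ok xs)) \<le> 3 * data_size (ls xs)"
  by (induction xs) (auto split: list.splits)

lemma fn_greedy: "fn prog 7 iGreedy (\<lambda>v. ls (greedy (okP (length (sp (v ! 2))) (sp (v ! 3)) (sp (v ! 4))
    (length (sp (v ! 5))) (sp (v ! 6)) (v ! 1)) (sp (v ! 0))))"
  apply (rule fn_fold[where l = 3], (simp add: prog_def; fail)+)
     apply ((rule pt_intros pt_Call[OF fn_ok] | (simp; fail))+)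
  subgoal by (auto split: list.splits)
  subgoal for x es
  proof -
    have "data_size (ls (greedy p (sp x))) \<le> 3 * (sz (x # es) + 2)" for p
      using size_greedy[of p "sp x"] by simp
    also have "\<dots> \<le> 2 ^ 2 * (sz (x # es) + 2)" by simp
    also have "\<dots> \<le> (sz (x # es) + 2) ^ 2 * (sz (x # es) + 2)"
      by (intro mult_right_mono power_mono) auto
    also have "\<dots> = (sz (x # es) + 2) ^ 3" by (simp add: power3_eq_cube power2_eq_square)
    finally show ?thesis by simp
  qed
  done

lemma size_tag: "data_size (ls (map (Pair x) ps @ rest)) \<le> data_size (ls ps) * (data_size x + 2) + data_size (ls rest)"
  by (induction ps) (auto simp: algebra_simps)

lemma le_pow3:
  fixes a s :: nat
  assumes "a \<le> 3 * s ^ 2 + 3 * s + 2"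
  shows "a \<le> (s + 2) ^ 3"
  using assms by (simp add: power2_eq_square power3_eq_cube algebra_simps)

lemma fn_tag: "fn prog 3 iTag (\<lambda>v. ls (map (Pair (v ! 1)) (sp (v ! 0)) @ sp (v ! 2)))"
  apply (rule fn_fold[where l = 3], (simp add: prog_def; fail)+)
     apply ((rule pt_intros | (simp; fail))+)
  subgoal for x es
  proof -
    assume "length es = 3 - 1"
    then obtain a b where es: "es = [a, b]" by (auto simp: length_eq_2)
    have "data_size (ls (map (Pair a) (sp x) @ sp b)) \<le> data_size x * (data_size a + 2) + data_size b"
      using size_tag[of a "sp x" "sp b"] by simp
    also have "\<dots> \<le> sz (x # es) * (sz (x # es) + 2) + sz (x # es)"
      by (intro add_mono mult_mono) (auto simp: es)
    also have "\<dots> \<le> (sz (x # es) + 2) ^ 3"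
      by (rule le_pow3) (simp add: power2_eq_square algebra_simps)
    finally show ?thesis by (simp add: es)
  qed
  done

lemma size_parts: "data_size (ls (parts s I cs u Js S)) \<le> 3 * data_size (ls S) ^ 2"
proof (induction S)
  case (Cons i S)
  let ?g = "greedy (okP s I cs u Js (vr i)) (el i)" and ?T = "data_size (ls S)" and ?i = "data_size i"
  have "data_size (ls (parts s I cs u Js (i # S))) \<le>
      data_size (ls ?g) * (data_size (vr i) + 2) + data_size (ls (parts s I cs u Js S))"
    using size_tag[of "vr i" ?g] by (simp add: parts_def)
  also have "data_size (ls ?g) * (data_size (vr i) + 2) \<le> (3 * ?i) * (?i + 2)"
    using size_greedy[of "okP s I cs u Js (vr i)" "el i"] size_fst_le[of i] size_snd_le[of i]
    by (intro mult_mono) auto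
  also have "(3 * ?i) * (?i + 2) + data_size (ls (parts s I cs u Js S)) \<le> 3 * ?i * (?i + 2) + 3 * ?T ^ 2"
    using Cons.IH by simp
  also have "\<dots> \<le> 3 * data_size (ls (i # S)) ^ 2"
    by (simp add: power2_eq_square algebra_simps)
  finally show ?case by simp
qed (simp add: parts_def)

lemma le_pow4:
  fixes a s :: nat
  assumes "a \<le> 3 * s ^ 2"
  shows "a \<le> (s + 2) ^ 4"
proof -
  have "3 * s ^ 2 \<le> 2 ^ 2 * (s + 2) ^ 2" by (intro mult_mono power_mono) auto
  also have "\<dots> \<le> (s + 2) ^ 2 * (s + 2) ^ 2" by (intro mult_right_mono power_mono) auto
  also have "\<dots> = (s + 2) ^ 4" by (simp flip: power_add)
  finally show ?thesis using assms by simp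
qed

lemma fn_parts: "fn prog 6 iParts (\<lambda>v. ls (parts (length (sp (v ! 1))) (sp (v ! 2)) (sp (v ! 3))
    (length (sp (v ! 4))) (sp (v ! 5)) (sp (v ! 0))))"
  apply (rule fn_fold[where l = 4], (simp add: prog_def; fail)+)
     apply ((rule pt_intros pt_Call[OF fn_tag] pt_Call[OF fn_greedy] | (simp; fail))+)
  subgoal by (simp add: parts_def)
  subgoal by (simp add: parts_def)
  subgoal for x es
  proof -
    have "data_size (ls (parts s I cs u Js (sp x))) \<le> 3 * (sz (x # es)) ^ 2" for s I cs u Js
      by (rule le_trans[OF size_parts]) (intro mult_le_mono power_mono; simp)
    from le_pow4[OF this] show ?thesis by simp
  qed
  done

lemma fn_addr: "fn prog 2 iAddr (\<lambda>v. Pair (v ! 0) (ls (sp (v ! 0) @ sp (data_snd (v ! 1)))))"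
  apply (rule fn_plain, (simp add: prog_def; fail)+)
   apply ((rule pt_intros pt_Call[OF fn_app] | (simp; fail))+)
  done

lemma size_its: "data_size (ls (its it S n cs u k)) \<le> data_size (ls it) + 3 * data_size (ls S) ^ 2"
  using size_parts[of n _ cs u "[]" S] by (cases k) (auto intro: trans_le_add2)

lemma size_alls: "data_size (ls (alls it S n cs u k)) \<le> data_size (ls it) + k * (data_size (ls it) + 3 * data_size (ls S) ^ 2)"
proof (induction k)
  case (Suc k)
  thus ?case using size_ls_append[of "its it S n cs u (Suc k)" "alls it S n cs u k"] size_its[of it S n cs u "Suc k"]
    by simp
qed simp

lemma fn_rnd: "fn prog 6 iRnd (\<lambda>v.
    Pair (ls (its (sp (v ! 1)) (sp (v ! 2)) (length (sp (v ! 3))) (sp (v ! 4)) (length (sp (v ! 5))) (length (sp (v ! 0)))))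
      (ls (alls (sp (v ! 1)) (sp (v ! 2)) (length (sp (v ! 3))) (sp (v ! 4)) (length (sp (v ! 5))) (length (sp (v ! 0))))))"
  apply (rule fn_fold[where l = 5], (simp add: prog_def; fail)+)
     apply ((rule pt_intros pt_Call[OF fn_addr] pt_Call[OF fn_parts] | (simp; fail))+)
  subgoal for x es
  proof -
    assume "length es = 6 - 1"
    then obtain a b c d e where es: "es = [a, b, c, d, e]" by (auto simp: eval_nat_numeral length_Suc_conv)
    let ?s = "sz (x # es)" and ?k = "length (sp x)"
    define t1 where "t1 = data_size (ls (its (sp a) (sp b) (length (sp c)) (sp d) (length (sp e)) ?k))"
    define t2 where "t2 = data_size (ls (alls (sp a) (sp b) (length (sp c)) (sp d) (length (sp e)) ?k))"
    have b: "3 * data_size b ^ 2 \<le> 3 * ?s ^ 2" by (intro mult_le_mono power_mono) (auto simp: es)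
    have 1: "t1 \<le> ?s + 3 * ?s ^ 2"
      unfolding t1_def by (rule le_trans[OF size_its]) (intro add_mono mult_le_mono power_mono; simp add: es)
    have "t2 \<le> data_size a + ?k * (data_size a + 3 * data_size b ^ 2)"
      unfolding t2_def using size_alls[of "sp a" "sp b" "length (sp c)" "sp d" "length (sp e)" ?k] by simp
    also have "\<dots> \<le> ?s + ?s * (?s + 3 * ?s ^ 2)"
      using length_le_size[of x] b by (intro add_mono mult_mono) (auto simp: es)
    finally have "Suc (t1 + t2) \<le> 2 ^ 2 * (?s + 2) ^ 3"
      using 1 by (simp add: power2_eq_square power3_eq_cube algebra_simps)
    also have "\<dots> \<le> (?s + 2) ^ 2 * (?s + 2) ^ 3" by (intro mult_right_mono power_mono) auto
    also have "\<dots> = (?s + 2) ^ 5" by (simp flip: power_add)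
    finally show ?thesis by (simp add: t1_def t2_def es)
  qed
  done

lemma fn_anyb: "fn prog 4 iAnyb (\<lambda>v. enc_bool (anyb (v ! 3 \<noteq> Atom) (sp (v ! 2)) (sp (v ! 0)) (v ! 1)))"
  unfolding anyb_def
  apply (rule fn_fold_bool, (simp add: prog_def; fail)+)
     apply ((rule pt_intros pt_Call[OF fn_bad] | (simp; fail))+)
  by (auto simp: enc_bool_def)

lemma fn_inset: "fn prog 2 iInset (\<lambda>v. enc_bool (v ! 1 \<in> vr ` set (sp (v ! 0))))"
  apply (rule fn_fold_bool, (simp add: prog_def; fail)+)
     apply ((rule pt_intros pt_Call[OF fn_eq] | (simp; fail))+)
  by (auto simp: enc_bool_def)

lemma size_map_filter:
  assumes "\<And>x. data_size (f x) \<le> data_size x + k + 1"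
  shows "data_size (ls (map f (filter p xs) @ rest)) \<le> data_size (ls xs) * (k + 2) + data_size (ls rest)"
proof (induction xs)
  case (Cons x xs)
  have "data_size (f x) \<le> data_size x + k + 1" by (rule assms)
  with Cons show ?case by (auto simp: algebra_simps)
qed simp

lemma size_ext: "data_size (ls (ext cs F g @ rest)) \<le> data_size (ls F) * (data_size g + 2) + data_size (ls rest)"
  unfolding ext_def by (rule size_map_filter) auto

lemma size_cext: "data_size (ls (cext cs G a @ rest)) \<le> data_size (ls G) * (data_size a + 2) + data_size (ls rest)"
  unfolding cext_def
proof (rule size_map_filter)
  fix g show "data_size (ls (sp g @ sp a)) \<le> data_size g + data_size a + 1"
    using size_ls_append[of "sp g" "sp a"] by simp
qed

lemma size_concat_snoc:
  assumes "\<And>g rest. data_size (ls (E g @ rest)) \<le> f * (data_size g + 2) + data_size (ls rest)"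
  shows "data_size (ls (concat (map (\<lambda>g. E g @ [g]) L))) \<le> data_size (ls L) * (1 + 2 * f)"
proof (induction L)
  case (Cons g L)
  let ?r = "concat (map (\<lambda>g. E g @ [g]) L)"
  have "data_size (ls (E g @ g # ?r)) \<le> f * (data_size g + 2) + data_size (ls (g # ?r))" by (rule assms)
  also have "\<dots> \<le> f * (2 * data_size g + 2) + (data_size g + 1 + data_size (ls ?r))" by simp
  also have "\<dots> \<le> data_size (ls (g # L)) * (1 + 2 * f)" using Cons by (simp add: algebra_simps)
  finally show ?case by simp
qed simp

lemma size_growl: "data_size (ls (growl cs F L)) \<le> data_size (ls L) * (1 + 2 * data_size (ls F))"
  unfolding growl_def by (rule size_concat_snoc[OF size_ext])

lemma size_covl: "data_size (ls (covl cs G A)) \<le> data_size (ls A) * (1 + 2 * data_size (ls G))"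
  unfolding covl_def by (rule size_concat_snoc[OF size_cext])

lemma fn_ext: "fn prog 4 iExt (\<lambda>v. ls (ext (sp (v ! 2)) (sp (v ! 0)) (v ! 1) @ sp (v ! 3)))"
  apply (rule fn_fold[where l = 3], (simp add: prog_def; fail)+)
     apply ((rule pt_intros pt_Call[OF fn_inset] pt_Call[OF fn_anyb] | (simp; fail))+)
  subgoal by (simp add: ext_def)
  subgoal by (simp add: ext_def)
  subgoal for x es
  proof -
    assume "length es = 4 - 1"
    then obtain a b c where es: "es = [a, b, c]" by (auto simp: length_eq_3)
    have "data_size (ls (ext (sp b) (sp x) a @ sp c)) \<le> data_size x * (data_size a + 2) + data_size c"
      using size_ext[of "sp b" "sp x" a "sp c"] by simp
    also have "\<dots> \<le> sz (x # es) * (sz (x # es) + 2) + sz (x # es)"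
      by (intro add_mono mult_mono) (auto simp: es)
    also have "\<dots> \<le> (sz (x # es) + 2) ^ 3"
      by (rule le_pow3) (simp add: power2_eq_square algebra_simps)
    finally show ?thesis by (simp add: es)
  qed
  done

lemma fn_growl: "fn prog 3 iGrowl (\<lambda>v. ls (growl (sp (v ! 2)) (sp (v ! 1)) (sp (v ! 0))))"
  apply (rule fn_fold[where l = 3], (simp add: prog_def; fail)+)
     apply ((rule pt_intros pt_Call[OF fn_ext] | (simp; fail))+)
  subgoal by (simp add: growl_def)
  subgoal by (simp add: growl_def)
  subgoal for x es
  proof -
    assume "length es = 3 - 1"
    then obtain a b where es: "es = [a, b]" by (auto simp: length_eq_2)
    have "data_size (ls (growl (sp b) (sp a) (sp x))) \<le> data_size x * (1 + 2 * data_size a)"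
      using size_growl[of "sp b" "sp a" "sp x"] by simp
    also have "\<dots> \<le> sz (x # es) * (1 + 2 * sz (x # es))"
      by (intro mult_mono) (auto simp: es)
    also have "\<dots> \<le> (sz (x # es) + 2) ^ 3"
      by (rule le_pow3) (simp add: power2_eq_square algebra_simps)
    finally show ?thesis by (simp add: es)
  qed
  done

lemma fn_singles: "fn prog 1 iSingles (\<lambda>v. ls (map (\<lambda>i. Pair i Atom) (sp (v ! 0))))"
  apply (rule fn_fold[where l = 3], (simp add: prog_def; fail)+)
     apply ((rule pt_intros | (simp; fail))+)
  subgoal for x es
  proof -
    have "data_size (ls (map (\<lambda>i. Pair i Atom) xs)) \<le> 3 * data_size (ls xs)" for xs
      by (induction xs) auto
    from this[of "sp x"] have "data_size (ls (map (\<lambda>i. Pair i Atom) (sp x))) \<le> (sz (x # es) + 2) ^ 3"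
      by (intro le_pow3) simp
    thus ?thesis by simp
  qed
  done

lemma fn_incompat: "fn prog 3 iIncompat (\<lambda>v. enc_bool (incompat (sp (v ! 2)) (sp (v ! 0)) (sp (v ! 1))))"
  unfolding incompat_def
  apply (rule fn_fold_bool, (simp add: prog_def; fail)+)
     apply ((rule pt_intros pt_Call[OF fn_inset] pt_Call[OF fn_anyb] | (simp; fail))+)
  by (auto simp: enc_bool_def)

lemma fn_cext: "fn prog 4 iCext (\<lambda>v. ls (cext (sp (v ! 2)) (sp (v ! 0)) (v ! 1) @ sp (v ! 3)))"
  apply (rule fn_fold[where l = 3], (simp add: prog_def; fail)+)
     apply ((rule pt_intros pt_Call[OF fn_incompat] pt_Call[OF fn_app] | (simp; fail))+)
  subgoal by (simp add: cext_def)
  subgoal by (simp add: cext_def)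
  subgoal for x es
  proof -
    assume "length es = 4 - 1"
    then obtain a b c where es: "es = [a, b, c]" by (auto simp: length_eq_3)
    have "data_size (ls (cext (sp b) (sp x) a @ sp c)) \<le> data_size x * (data_size a + 2) + data_size c"
      using size_cext[of "sp b" "sp x" a "sp c"] by simp
    also have "\<dots> \<le> sz (x # es) * (sz (x # es) + 2) + sz (x # es)"
      by (intro add_mono mult_mono) (auto simp: es)
    also have "\<dots> \<le> (sz (x # es) + 2) ^ 3"
      by (rule le_pow3) (simp add: power2_eq_square algebra_simps)
    finally show ?thesis by (simp add: es)
  qed
  done

lemma fn_covl: "fn prog 3 iCovl (\<lambda>v. ls (covl (sp (v ! 2)) (sp (v ! 1)) (sp (v ! 0))))"
  apply (rule fn_fold[where l = 3], (simp add: prog_def; fail)+)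
     apply ((rule pt_intros pt_Call[OF fn_cext] | (simp; fail))+)
  subgoal by (simp add: covl_def)
  subgoal by (simp add: covl_def)
  subgoal for x es
  proof -
    assume "length es = 3 - 1"
    then obtain a b where es: "es = [a, b]" by (auto simp: length_eq_2)
    have "data_size (ls (covl (sp b) (sp a) (sp x))) \<le> data_size x * (1 + 2 * data_size a)"
      using size_covl[of "sp b" "sp a" "sp x"] by simp
    also have "\<dots> \<le> sz (x # es) * (1 + 2 * sz (x # es))"
      by (intro mult_mono) (auto simp: es)
    also have "\<dots> \<le> (sz (x # es) + 2) ^ 3"
      by (rule le_pow3) (simp add: power2_eq_square algebra_simps)
    finally show ?thesis by (simp add: es)
  qed
  done

lemma fn_long: "fn prog 2 iLong (\<lambda>v. enc_bool (\<exists>a\<in>set (sp (v ! 0)). length (sp (v ! 1)) \<le> length (sp a)))"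
  apply (rule fn_fold_bool, (simp add: prog_def; fail)+)
     apply ((rule pt_intros pt_Call[OF fn_le] | (simp; fail))+)
  by (auto simp: enc_bool_def)

lemma fn_chk: "fn prog 3 iChk (\<lambda>v. enc_bool (\<exists>i\<in>set (sp (v ! 0)). anyb False (sp (v ! 2)) (sp (v ! 1)) i))"
  apply (rule fn_fold_bool, (simp add: prog_def; fail)+)
     apply ((rule pt_intros pt_Call[OF fn_anyb] | (simp; fail))+)
  by (auto simp: enc_bool_def)

lemma size_half: "data_size (ls (half xs)) \<le> data_size (ls xs)"
proof (induction xs rule: half.induct)
  case (1 x y xs)
  thus ?case by (simp add: Suc_leI)
qed auto

lemma fn_half: "fn prog 1 iHalf (\<lambda>v. ls (half (sp (v ! 0))))"
proof -
  have half: "half (sp d) = (if data_snd d = Atom then [] else Atom # half (sp (data_snd (data_snd d))))" for d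
    by (cases d rule: data_snd.cases; cases "data_snd d" rule: data_snd.cases) auto
  show ?thesis
  apply (rule fn_loop[where w = sz and k = 1 and l = 1], (simp add: prog_def; fail)+)
            apply ((rule pt_intros | (simp; fail))+)
  subgoal for v using half[of "v ! 0"] by simp
  subgoal for v using size_snd_less[of "v ! 0"] size_snd_le[of "data_snd (v ! 0)"] by auto
  subgoal by simp
  subgoal for v using size_snd_le[of "v ! 0"] size_snd_le[of "data_snd (v ! 0)"] by (auto simp: length_Suc_conv)
  subgoal by simp
  subgoal for v using size_half[of "sp (v ! 0)"] by (auto simp: length_Suc_conv)
  done
qed

lemma size_halves: "data_size (ls ((half ^^ k) xs)) \<le> data_size (ls xs)"
  by (induction k) (auto intro: size_half[THEN le_trans])

lemma fn_halves: "fn prog 2 iHalves (\<lambda>v. ls ((half ^^ length (sp (v ! 0))) (sp (v ! 1))))"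
  apply (rule fn_fold[where l = 1], (simp add: prog_def; fail)+)
     apply ((rule pt_intros pt_Call[OF fn_half] | (simp; fail))+)
  subgoal for x es using size_halves[of "length (sp x)" "sp (es ! 0)"] by (auto simp: length_Suc_conv)
  done

lemma fn_final: "fn prog 5 iFinal (\<lambda>v. ls (refine (length (sp (v ! 0))) (length (sp (v ! 1))) (sp (v ! 3))
    (length (sp (v ! 4))) (sp (v ! 2))))"
  unfolding refine_def
  apply (rule fn_plain, (simp add: prog_def; fail)+)
   apply ((rule pt_intros pt_Call[OF fn_parts] pt_Call[OF fn_rnd] | (simp; fail))+)
  done

lemma size_inc: "data_size (inc d) \<le> data_size d + 4"
proof (induction d rule: inc.induct)
  case (2 b r)
  thus ?case by (cases b) auto
qed simp

lemma fn_inc: "fn prog 1 iInc (\<lambda>v. inc (v ! 0))"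
  apply (rule fn_fold[where l = 2], (simp add: prog_def; fail)+)
     apply ((rule pt_intros | (simp; fail))+)
  subgoal for x es
  proof -
    have "data_size (inc x) \<le> (sz (x # es) + 2) * 2" using size_inc[of x] by simp
    also have "\<dots> \<le> (sz (x # es) + 2) * (sz (x # es) + 2)" by (intro mult_mono) auto
    finally show ?thesis by (simp add: power2_eq_square)
  qed
  done

text \<open>\<open>inc\<close> adds at most 4 to the size of the counter while the list loses at
  least one cell, so \<open>4 * data_size (ls Ds) + data_size i\<close> does not grow along the
  recursion. The same expression is the weight in \<open>fn_lab\<close>.\<close>

lemma size_lab: "data_size (ls (lab Ds i)) \<le> (4 * data_size (ls Ds) + data_size i) ^ 2"
proof (induction Ds i rule: lab.induct)
  case (2 D Ds i)
  let ?w = "4 * data_size (ls (D # Ds)) + data_size i" and ?w' = "4 * data_size (ls Ds) + data_size (inc i)"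
  have d: "1 \<le> 4 * data_size D" using size_pos[of D] by linarith
  have w: "?w' + 4 * data_size D \<le> ?w" using size_inc[of i] by simp
  have "?w' ^ 2 + (data_size i + data_size D + 2) \<le> ?w' * ?w + 4 * data_size D * ?w"
  proof (rule add_mono)
    show "?w' ^ 2 \<le> ?w' * ?w" unfolding power2_eq_square using w by (intro mult_left_mono) auto
    have "data_size i + data_size D + 2 \<le> 1 * ?w" by simp
    also have "\<dots> \<le> 4 * data_size D * ?w" using d by (intro mult_right_mono) auto
    finally show "data_size i + data_size D + 2 \<le> 4 * data_size D * ?w" .
  qed
  also have "\<dots> = (?w' + 4 * data_size D) * ?w" by (simp add: algebra_simps)
  also have "\<dots> \<le> ?w * ?w" using w by (intro mult_right_mono) auto
  finally show ?case using 2 by (simp add: power2_eq_square)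
qed simp

lemma fn_lab: "fn prog 2 iLab (\<lambda>v. ls (lab (sp (v ! 0)) (v ! 1)))"
  apply (rule fn_loop[where w = "\<lambda>v. 4 * data_size (v ! 0) + data_size (v ! 1)" and k = 3 and l = 2],
      (simp add: prog_def; fail)+)
            apply ((rule pt_intros pt_Call[OF fn_inc] | (simp; fail))+)
  subgoal for v using sp_unfold[of "v ! 0"] by auto
  subgoal for v using size_snd_less[of "v ! 0"] by auto
  subgoal for v by (auto simp: length_eq_2)
  subgoal for v using size_inc[of "v ! 1"] by (cases "v ! 0") (auto simp: length_eq_2 Suc_le_eq intro: add_mono)
  subgoal for v
  proof -
    assume "length v = 2"
    hence "4 * data_size (v ! 0) + data_size (v ! 1) \<le> 4 * sz v" by (auto simp: length_eq_2)
    also have "\<dots> \<le> 3 * sz v ^ 2 + 3 * sz v + 2" using le_square[of "sz v"] unfolding power2_eq_square by linarith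
    finally show ?thesis by (rule le_pow3)
  qed
  subgoal for v
  proof -
    have "data_size (ls (lab (sp (v ! 0)) (v ! 1))) \<le> (4 * data_size (v ! 0) + data_size (v ! 1)) ^ 2"
      using size_lab[of "sp (v ! 0)" "v ! 1"] by simp
    also have "\<dots> \<le> (4 * data_size (v ! 0) + data_size (v ! 1) + 2) ^ 2" by (intro power_mono) auto
    finally show ?thesis .
  qed
  done

lemma size_look: "data_size (look ds x) \<le> data_size (ls ds)"
proof (induction ds)
  case (Cons d ds)
  thus ?case using size_snd_le[of d] by auto
qed simp

lemma fn_look: "fn prog 2 iLook (\<lambda>v. look (sp (v ! 0)) (v ! 1))"
  apply (rule fn_fold[where l = 1], (simp add: prog_def; fail)+)
     apply ((rule pt_intros pt_Call[OF fn_eq] | (simp; fail))+)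
  subgoal for x es using size_look[of "sp x" "es ! 0"] by simp
  done

lemma size_att: "data_size (ls (att ds cs)) \<le> data_size (ls cs) * (2 * data_size (ls ds) + 3)"
proof (induction cs)
  case (Cons c cs)
  have "data_size (ls (att ds (c # cs))) \<le> 2 * data_size (ls ds) + data_size c + 3 + data_size (ls (att ds cs))"
    using size_look[of ds "data_fst c"] size_look[of ds "data_fst (data_snd c)"] by (simp add: att_def)
  also have "\<dots> \<le> data_size (ls (c # cs)) * (2 * data_size (ls ds) + 3)"
    using Cons by (simp add: algebra_simps)
  finally show ?case .
qed (simp add: att_def)

lemma fn_att: "fn prog 2 iAtt (\<lambda>v. ls (att (sp (v ! 1)) (sp (v ! 0))))"
  apply (rule fn_fold[where l = 3], (simp add: prog_def; fail)+)
     apply ((rule pt_intros pt_Call[OF fn_look] | (simp; fail))+)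
  subgoal by (simp add: att_def)
  subgoal by (simp add: att_def)
  subgoal for x es
  proof -
    assume "length es = 2 - 1"
    then obtain a where es: "es = [a]" by (auto simp: length_Suc_conv)
    have "data_size (ls (att (sp a) (sp x))) \<le> data_size x * (2 * data_size a + 3)"
      using size_att[of "sp a" "sp x"] by simp
    also have "\<dots> \<le> sz (x # es) * (2 * sz (x # es) + 3)"
      by (intro mult_mono) (auto simp: es)
    also have "\<dots> \<le> (sz (x # es) + 2) ^ 3"
      by (rule le_pow3) (simp add: power2_eq_square algebra_simps)
    finally show ?thesis by (simp add: es)
  qed
  done

lemma size_snd_pow_le: "data_size ((data_snd ^^ k) d) \<le> data_size d"
  by (induction k) (auto intro: size_snd_le[THEN le_trans])

lemma size_revlists: "data_size (ls (revlists cs)) \<le> data_size (ls cs)"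
proof (induction cs)
  case (Cons c cs)
  let ?r = "data_snd (data_snd (data_snd c))" and ?xs = "revlists cs"
  have 1: "data_size (ls (revlists (c # cs))) + 2 =
     data_size (data_fst ?r) + (data_size (data_snd ?r) + data_size (ls ?xs))"
    using size_ls_append[of "sp (data_fst ?r)" "sp (data_snd ?r) @ ?xs"] size_ls_append[of "sp (data_snd ?r)" ?xs]
    by (simp add: revlists_def)
  have "data_size ?r \<le> data_size c" by (meson le_trans size_snd_le)
  hence "data_size (data_fst ?r) + data_size (data_snd ?r) \<le> data_size c + 1"
    using size_pos[of c] by (cases ?r) (auto simp: Suc_le_eq)
  with 1 Cons show ?case by simp
qed (simp add: revlists_def)

lemma fn_revlists: "fn prog 1 iRevlists (\<lambda>v. ls (revlists (sp (v ! 0))))"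
  apply (rule fn_fold[where l = 1], (simp add: prog_def; fail)+)
     apply ((rule pt_intros pt_Call[OF fn_app] | (simp; fail))+)
  subgoal by (simp add: revlists_def)
  subgoal by (simp add: revlists_def)
  subgoal for x es using size_revlists[of "sp x"] by simp
  done

lemma fn_dbl: "fn prog 1 iDbl (\<lambda>v. ls (sp (v ! 0) @ sp (v ! 0)))"
  apply (rule fn_plain, (simp add: prog_def; fail)+)
   apply ((rule pt_intros pt_Call[OF fn_app] | (simp; fail))+)
  done

lemma size_cat: "data_size (ls (concat (map sp ds) @ xs)) \<le> data_size (ls ds) + data_size (ls xs)"
proof (induction ds)
  case (Cons d ds)
  thus ?case using size_ls_append[of "sp d" "concat (map sp ds) @ xs"] by simp
qed simp

lemma fn_cat: "fn prog 1 iCat (\<lambda>v. ls (concat (map sp (sp (v ! 0))) @ [Atom, Atom]))"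
  apply (rule fn_fold[where l = 3], (simp add: prog_def; fail)+)
     apply ((rule pt_intros pt_Call[OF fn_app] | (simp; fail))+)
  subgoal for x es
  proof -
    have "data_size (ls (concat (map sp (sp x)) @ [Atom, Atom])) \<le> sz (x # es) + 5"
      using size_cat[of "sp x" "[Atom, Atom]"] by simp
    also have "1 \<le> sz (x # es)" using size_pos[of x] by (simp add: Suc_le_eq)
    hence "sz (x # es) + 5 \<le> 3 * sz (x # es) ^ 2 + 3 * sz (x # es) + 2"
      using le_square[of "sz (x # es)"] unfolding power2_eq_square by linarith
    also have "\<dots> \<le> (sz (x # es) + 2) ^ 3" by (rule le_pow3) simp
    finally have "data_size (ls (concat (map sp (sp x)) @ [Atom, Atom])) \<le> (sz (x # es) + 2) ^ 3" .
    thus ?thesis by simp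
  qed
  done

section \<open>Solvable connected tuples decide satisfiability\<close>

section \<open>Correctness of one level of the recursion\<close>

text \<open>Constraints with a variable outside \<open>S\<close> are ignored, so that partial
  selections of blocks are subproblems of the same kind.\<close>

definition sat :: "data list \<Rightarrow> data list \<Rightarrow> bool" where
  "sat cs S \<longleftrightarrow> (\<exists>\<alpha>. (\<forall>i\<in>set S. \<alpha> (vr i) \<in> set (el i)) \<and>
     (\<forall>C\<in>set cs. cv1 C \<in> vr ` set S \<longrightarrow> cv2 C \<in> vr ` set S \<longrightarrow> rel C (\<alpha> (cv1 C)) (\<alpha> (cv2 C))))"

lemma bad_commute: "bad m cs i j = bad m cs j i"
  by (auto simp: bad_def)

lemma distinct_vr_inj: "distinct (map vr S) \<Longrightarrow> i \<in> set S \<Longrightarrow> j \<in> set S \<Longrightarrow> vr i = vr j \<Longrightarrow> i = j"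
  by (simp add: distinct_map inj_on_def)

lemma image_disjointI: "(\<And>i. i \<in> A \<Longrightarrow> f i \<notin> f ` B) \<Longrightarrow> f ` B \<inter> f ` A = {}"
  by (simp add: disjoint_iff) (metis imageE)

lemma cover_0 [simp]: "cover cs G 0 = [Atom]" and cover_Suc: "cover cs G (Suc k) = covl cs G (cover cs G k)"
  by (simp_all add: cover_def)

lemma grow_0 [simp]: "grow cs F 0 = map (\<lambda>i. Pair i Atom) F" and grow_Suc: "grow cs F (Suc k) = growl cs F (grow cs F k)"
  by (simp_all add: grow_def)

lemma set_growl: "g \<in> set (growl cs F L) \<longleftrightarrow> g \<in> set L \<or> (\<exists>g'\<in>set L. g \<in> set (ext cs F g'))"
  by (auto simp: growl_def)

lemma set_ext: "g \<in> set (ext cs F g') \<longleftrightarrow>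
    (\<exists>j\<in>set F. g = Pair j g' \<and> vr j \<notin> vr ` set (sp g') \<and> anyb True cs (sp g') j)"
  by (auto simp: ext_def)

lemma set_covl: "a \<in> set (covl cs G A) \<longleftrightarrow> a \<in> set A \<or>
    (\<exists>a'\<in>set A. \<exists>g\<in>set G. a = ls (sp g @ sp a') \<and> \<not> incompat cs (sp a') (sp g))"
  by (auto simp: covl_def cext_def)

lemma grow_inv:
  "g \<in> set (grow cs F k) \<Longrightarrow> set (sp g) \<subseteq> set F \<and> distinct (map vr (sp g)) \<and> sp g \<noteq> []"
proof (induction k arbitrary: g)
  case (Suc k)
  from Suc.prems show ?case unfolding grow_Suc set_growl
  proof (elim disjE bexE)
    fix g' assume "g' \<in> set (grow cs F k)" "g \<in> set (ext cs F g')"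
    thus ?thesis using Suc.IH[of g'] by (auto simp: set_ext)
  qed (rule Suc.IH)
qed auto

lemma cover_inv:
  assumes "\<And>g. g \<in> set G \<Longrightarrow> set (sp g) \<subseteq> set F \<and> distinct (map vr (sp g))"
  shows "a \<in> set (cover cs G k) \<Longrightarrow> set (sp a) \<subseteq> set F \<and> distinct (map vr (sp a))"
proof (induction k arbitrary: a)
  case (Suc k)
  from Suc.prems show ?case unfolding cover_Suc set_covl
  proof (elim disjE bexE conjE)
    fix a' g assume a': "a' \<in> set (cover cs G k)" and g: "g \<in> set G"
      and a: "a = ls (sp g @ sp a')" and c: "\<not> incompat cs (sp a') (sp g)"
    have "vr i \<notin> vr ` set (sp g)" if "i \<in> set (sp a')" for i using c that by (auto simp: incompat_def)
    hence d: "vr ` set (sp g) \<inter> vr ` set (sp a') = {}" by (rule image_disjointI)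
    have "set (sp a') \<subseteq> set F" "distinct (map vr (sp a'))" using Suc.IH[OF a'] by auto
    moreover have "set (sp g) \<subseteq> set F" "distinct (map vr (sp g))" using assms[OF g] by auto
    ultimately show ?thesis using d by (simp add: a)
  qed (rule Suc.IH)
qed auto

text \<open>The two solutions have disjoint sets of variables and can be glued. A constraint across
  them cannot fail, because \<open>incompat\<close> already rejects pairs of blocks with a single
  violating pair of elements.\<close>

lemma sat_append:
  assumes "sat cs a" "sat cs g" "\<not> incompat cs a g"
  shows "sat cs (g @ a)"
proof -
  obtain \<alpha> where \<alpha>: "\<And>i. i \<in> set a \<Longrightarrow> \<alpha> (vr i) \<in> set (el i)"
    "\<And>C. C \<in> set cs \<Longrightarrow> cv1 C \<in> vr ` set a \<Longrightarrow> cv2 C \<in> vr ` set a \<Longrightarrow> rel C (\<alpha> (cv1 C)) (\<alpha> (cv2 C))"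
    using assms(1) by (auto simp: sat_def)
  obtain \<beta> where \<beta>: "\<And>i. i \<in> set g \<Longrightarrow> \<beta> (vr i) \<in> set (el i)"
    "\<And>C. C \<in> set cs \<Longrightarrow> cv1 C \<in> vr ` set g \<Longrightarrow> cv2 C \<in> vr ` set g \<Longrightarrow> rel C (\<beta> (cv1 C)) (\<beta> (cv2 C))"
    using assms(2) by (auto simp: sat_def)
  define \<gamma> where "\<gamma> x = (if x \<in> vr ` set g then \<beta> x else \<alpha> x)" for x
  have disj: "vr i \<notin> vr ` set g" if "i \<in> set a" for i using assms(3) that by (auto simp: incompat_def)
  have \<gamma>g: "\<gamma> (vr i) = \<beta> (vr i)" if "i \<in> set g" for i using that by (auto simp: \<gamma>_def)
  have \<gamma>a: "\<gamma> (vr i) = \<alpha> (vr i)" if "i \<in> set a" for i using disj[OF that] by (auto simp: \<gamma>_def)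
  have cross: "rel C (\<gamma> (cv1 C)) (\<gamma> (cv2 C))"
    if C: "C \<in> set cs" and i: "i \<in> set a" and j: "j \<in> set g"
      and o: "cv1 C = vr i \<and> cv2 C = vr j \<or> cv1 C = vr j \<and> cv2 C = vr i" for C i j
  proof -
    have "\<not> bad False cs i j" using assms(3) i j by (auto simp: incompat_def anyb_def)
    hence n: "\<not> bad1 False C i j" "\<not> bad1 False C j i" using C by (auto simp: bad_def)
    have e: "\<gamma> (vr i) \<in> set (el i)" "\<gamma> (vr j) \<in> set (el j)"
      using \<alpha>(1) \<beta>(1) i j \<gamma>a \<gamma>g by auto
    from o show ?thesis
      using n e unfolding bad1_def some_rel_def by auto
  qed
  show ?thesis unfolding sat_def
  proof (intro exI[of _ \<gamma>] conjI ballI impI)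
    fix i assume "i \<in> set (g @ a)"
    thus "\<gamma> (vr i) \<in> set (el i)" using \<alpha>(1) \<beta>(1) \<gamma>a \<gamma>g by auto
  next
    fix C assume C: "C \<in> set cs" "cv1 C \<in> vr ` set (g @ a)" "cv2 C \<in> vr ` set (g @ a)"
    then obtain i j where ij: "i \<in> set g \<union> set a" "j \<in> set g \<union> set a" "cv1 C = vr i" "cv2 C = vr j" by auto
    show "rel C (\<gamma> (cv1 C)) (\<gamma> (cv2 C))"
    proof (cases "i \<in> set g"; cases "j \<in> set g")
      assume "i \<in> set g" "j \<in> set g"
      thus ?thesis using \<beta>(2)[OF C(1)] \<gamma>g ij by auto
    next
      assume "i \<in> set g" "j \<notin> set g"
      thus ?thesis using cross[of C j i] C(1) ij by auto
    next
      assume "i \<notin> set g" "j \<in> set g"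
      thus ?thesis using cross[of C i j] C(1) ij by auto
    next
      assume "i \<notin> set g" "j \<notin> set g"
      thus ?thesis using \<alpha>(2)[OF C(1)] \<gamma>a ij by auto
    qed
  qed
qed

lemma cover_sat:
  assumes "\<And>g. g \<in> set G \<Longrightarrow> sat cs (sp g)"
  shows "a \<in> set (cover cs G k) \<Longrightarrow> sat cs (sp a)"
proof (induction k arbitrary: a)
  case 0
  thus ?case by (auto simp: sat_def)
next
  case (Suc k)
  from Suc.prems show ?case unfolding cover_Suc set_covl
    using Suc.IH assms sat_append by auto
qed

text \<open>Correctness holds for every refinement that covers \<open>S\<close>; how the blocks are
  cut matters only for the running time.\<close>

locale refinement =
  fixes cs S F :: "data list"
  assumes distinct_S: "distinct (map vr S)"
    and F_sub: "\<And>j. j \<in> set F \<Longrightarrow> \<exists>i\<in>set S. vr j = vr i \<and> set (el j) \<subseteq> set (el i)"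
    and F_all: "\<And>i v. i \<in> set S \<Longrightarrow> v \<in> set (el i) \<Longrightarrow> \<exists>j\<in>set F. vr j = vr i \<and> v \<in> set (el j)"
begin

lemma vr_card: "card (vr ` set S) = length S"
  using distinct_S by (metis distinct_card length_map list.set_map)

lemma length_le_S:
  assumes "set g \<subseteq> set F" "distinct (map vr g)"
  shows "length g \<le> length S"
proof -
  have "vr ` set g \<subseteq> vr ` set S" using assms(1) F_sub by fastforce
  hence "card (vr ` set g) \<le> length S" using card_mono[of "vr ` set S"] vr_card by auto
  thus ?thesis using assms(2) by (metis distinct_card length_map list.set_map)
qed

lemma grow_length_le: "g \<in> set (grow cs F k) \<Longrightarrow> length (sp g) \<le> length S"
  using grow_inv length_le_S by blast

text \<open>The blocks of a cover have distinct variables taken from \<open>S\<close>. If there are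
  at least \<open>length S\<close> of them, every variable of \<open>S\<close> occurs, and a
  solution of the cover solves \<open>S\<close>.\<close>

lemma cover_sound:
  assumes a: "a \<in> set (cover cs (filter (\<lambda>g. sat cs (sp g)) (grow cs F l)) k)" and len: "length S \<le> length (sp a)"
  shows "sat cs S"
proof -
  have F: "set (sp a) \<subseteq> set F \<and> distinct (map vr (sp a))"
    by (rule cover_inv[OF _ a]) (use grow_inv in \<open>fastforce simp del: sp_eq_Nil\<close>)
  have "sat cs (sp a)" by (rule cover_sat[OF _ a]) auto
  then obtain \<alpha> where \<alpha>: "\<And>i. i \<in> set (sp a) \<Longrightarrow> \<alpha> (vr i) \<in> set (el i)"
    "\<And>C. C \<in> set cs \<Longrightarrow> cv1 C \<in> vr ` set (sp a) \<Longrightarrow> cv2 C \<in> vr ` set (sp a) \<Longrightarrow> rel C (\<alpha> (cv1 C)) (\<alpha> (cv2 C))"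
    by (auto simp: sat_def)
  have sub: "vr ` set (sp a) \<subseteq> vr ` set S" using F F_sub by fastforce
  have "card (vr ` set (sp a)) = length (sp a)" using F by (metis distinct_card length_map list.set_map)
  hence eq: "vr ` set (sp a) = vr ` set S"
    using sub len vr_card by (intro card_seteq) auto
  show ?thesis unfolding sat_def
  proof (intro exI[of _ \<alpha>] conjI ballI impI)
    fix i assume i: "i \<in> set S"
    then obtain j where j: "j \<in> set (sp a)" "vr j = vr i" using eq by (metis imageE image_eqI)
    obtain i' where "i' \<in> set S" "vr j = vr i'" "set (el j) \<subseteq> set (el i')" using F_sub j F by blast
    thus "\<alpha> (vr i) \<in> set (el i)" using distinct_vr_inj[OF distinct_S, of i i'] i \<alpha>(1)[OF j(1)] j(2) by auto
  next
    fix C assume "C \<in> set cs" "cv1 C \<in> vr ` set S" "cv2 C \<in> vr ` set S"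
    thus "rel C (\<alpha> (cv1 C)) (\<alpha> (cv2 C))" using \<alpha>(2) eq by auto
  qed
qed

text \<open>A solution selects one block \<open>\<tau> i\<close> for each item. The components of
  this selection under mixedness are generated by \<open>grow\<close>, are solvable by the same
  solution, and can be assembled by \<open>cover\<close> one after the other.\<close>

lemma cover_complete:
  assumes "sat cs S"
  shows "\<exists>a\<in>set (cover cs (filter (\<lambda>g. sat cs (sp g)) (grow cs F (length S))) (length S)). length S \<le> length (sp a)"
proof -
  let ?k = "length S" and ?L = "grow cs F (length S)"
  let ?G = "filter (\<lambda>g. sat cs (sp g)) ?L"
  obtain \<alpha> where \<alpha>: "\<And>i. i \<in> set S \<Longrightarrow> \<alpha> (vr i) \<in> set (el i)"
    "\<And>C. C \<in> set cs \<Longrightarrow> cv1 C \<in> vr ` set S \<Longrightarrow> cv2 C \<in> vr ` set S \<Longrightarrow> rel C (\<alpha> (cv1 C)) (\<alpha> (cv2 C))"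
    using assms by (auto simp: sat_def)
  have "\<forall>i\<in>set S. \<exists>j\<in>set F. vr j = vr i \<and> \<alpha> (vr i) \<in> set (el j)"
    using F_all \<alpha>(1) by blast
  then obtain \<tau> where \<tau>: "\<And>i. i \<in> set S \<Longrightarrow> \<tau> i \<in> set F \<and> vr (\<tau> i) = vr i \<and> \<alpha> (vr i) \<in> set (el (\<tau> i))"
    by metis
  define T where "T = \<tau> ` set S"
  have T_F: "T \<subseteq> set F" and T_fin: "finite T" and T_\<alpha>: "\<And>j. j \<in> T \<Longrightarrow> \<alpha> (vr j) \<in> set (el j)"
    and T_vr: "\<And>j. j \<in> T \<Longrightarrow> vr j \<in> vr ` set S"
    using \<tau> by (auto simp: T_def)
  have T_inj: "i = j" if "i \<in> T" "j \<in> T" "vr i = vr j" for i j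
    using that \<tau> distinct_vr_inj[OF distinct_S] unfolding T_def by (metis imageE)
  have T_notin: "vr j \<notin> vr ` X" if "j \<in> T" "X \<subseteq> T" "j \<notin> X" for j X
  proof
    assume "vr j \<in> vr ` X"
    then obtain i where "i \<in> X" "vr j = vr i" by auto
    thus False using T_inj[of j i] that by auto
  qed
  have "inj_on \<tau> (set S)"
    using \<tau> distinct_vr_inj[OF distinct_S] by (metis inj_onI)
  hence T_card: "card T = ?k"
    unfolding T_def using distinct_S by (simp add: card_image distinct_card distinct_map)
  have len_T: "length g \<le> ?k" if "set g \<subseteq> T" "distinct (map vr g)" for g
    using that T_F length_le_S by blast
  have T_sat: "sat cs g" if "set g \<subseteq> T" for g
  proof -
    have "vr ` set g \<subseteq> vr ` set S" using that T_vr by auto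
    thus ?thesis unfolding sat_def using that T_\<alpha> \<alpha>(2) by (intro exI[of _ \<alpha>]) (simp add: subset_iff)
  qed
  \<comment> \<open>The component of \<open>i\<close> within \<open>T'\<close>. Each round adds a
    mixed neighbour as long as one is left, and a tuple never has more than \<open>length S\<close>
    blocks, so \<open>length S\<close> rounds reach a closed tuple.\<close>
  have comp: "\<exists>g\<in>set ?L. set (sp g) \<subseteq> T' \<and> i \<in> set (sp g) \<and> distinct (map vr (sp g)) \<and>
      (\<forall>j\<in>T' - set (sp g). \<not> anyb True cs (sp g) j)" if T': "T' \<subseteq> T" and i: "i \<in> T'" for T' i
  proof -
    have "\<exists>g\<in>set (grow cs F t). set (sp g) \<subseteq> T' \<and> i \<in> set (sp g) \<and> distinct (map vr (sp g)) \<and>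
      ((\<forall>j\<in>T' - set (sp g). \<not> anyb True cs (sp g) j) \<or> t < length (sp g))" for t
    proof (induction t)
      case 0
      have "Pair i Atom \<in> set (grow cs F 0)" using i T' T_F by auto
      thus ?case using i by force
    next
      case (Suc t)
      then obtain g where g: "g \<in> set (grow cs F t)" "set (sp g) \<subseteq> T'" "i \<in> set (sp g)" "distinct (map vr (sp g))"
        "(\<forall>j\<in>T' - set (sp g). \<not> anyb True cs (sp g) j) \<or> t < length (sp g)" by blast
      show ?case
      proof (cases "\<forall>j\<in>T' - set (sp g). \<not> anyb True cs (sp g) j")
        case True
        have "g \<in> set (grow cs F (Suc t))" using g(1) by (simp add: grow_Suc set_growl)
        thus ?thesis using g True by blast
      next
        case False
        then obtain j where j: "j \<in> T'" "j \<notin> set (sp g)" "anyb True cs (sp g) j" by blast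
        have nj: "vr j \<notin> vr ` set (sp g)" by (rule T_notin) (use j g(2) T' in auto)
        hence "Pair j g \<in> set (ext cs F g)" using j T' T_F by (auto simp: set_ext)
        hence "Pair j g \<in> set (grow cs F (Suc t))" using g(1) by (auto simp: grow_Suc set_growl)
        moreover have "Suc t < length (sp (Pair j g))" using g(5) False by auto
        ultimately show ?thesis using g j nj by (intro bexI[of _ "Pair j g"]) auto
      qed
    qed
    from this[of ?k] obtain g where g: "g \<in> set ?L" "set (sp g) \<subseteq> T'" "i \<in> set (sp g)" "distinct (map vr (sp g))"
      "(\<forall>j\<in>T' - set (sp g). \<not> anyb True cs (sp g) j) \<or> ?k < length (sp g)" by blast
    have "\<not> ?k < length (sp g)" using len_T[of "sp g"] g(2,4) T' by fastforce
    thus ?thesis using g by blast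
  qed
  \<comment> \<open>The collected set has no mixed neighbour in the rest of \<open>T\<close>, so
    further components can be searched for in the rest alone. Each round adds at least one block
    until \<open>T\<close> is exhausted.\<close>
  have "\<exists>a\<in>set (cover cs ?G t). set (sp a) \<subseteq> T \<and> distinct (map vr (sp a)) \<and>
      (\<forall>i\<in>set (sp a). \<forall>j\<in>T - set (sp a). \<not> bad True cs i j) \<and> (set (sp a) = T \<or> t \<le> length (sp a))" for t
  proof (induction t)
    case (Suc t)
    then obtain a where a: "a \<in> set (cover cs ?G t)" "set (sp a) \<subseteq> T" "distinct (map vr (sp a))"
      "\<And>i j. i \<in> set (sp a) \<Longrightarrow> j \<in> T - set (sp a) \<Longrightarrow> \<not> bad True cs i j"
      "set (sp a) = T \<or> t \<le> length (sp a)" by blast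
    show ?case
    proof (cases "set (sp a) = T")
      case True
      thus ?thesis using a by (intro bexI[of _ a]) (auto simp: cover_Suc set_covl)
    next
      case False
      then obtain i where i: "i \<in> T - set (sp a)" using a(2) by blast
      from comp[of "T - set (sp a)" i] i obtain g where g: "g \<in> set ?L" "set (sp g) \<subseteq> T - set (sp a)" "i \<in> set (sp g)"
        "distinct (map vr (sp g))" "\<And>j. j \<in> T - set (sp a) - set (sp g) \<Longrightarrow> \<not> anyb True cs (sp g) j" by auto
      have gG: "g \<in> set ?G" using g(1,2) T_sat[of "sp g"] by auto
      have cT: "rel C (\<alpha> (vr i)) (\<alpha> (vr j))" if "C \<in> set cs" "cv1 C = vr i" "cv2 C = vr j" "i \<in> T" "j \<in> T" for C i j
        using \<alpha>(2)[OF that(1)] that T_vr by auto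
      have "\<not> incompat cs (sp a) (sp g)"
      proof
        assume "incompat cs (sp a) (sp g)"
        then obtain i where i: "i \<in> set (sp a)" "vr i \<in> vr ` set (sp g) \<or> anyb False cs (sp g) i"
          by (auto simp: incompat_def)
        have "vr i \<notin> vr ` set (sp g)" by (rule T_notin) (use i(1) a(2) g(2) in auto)
        with i obtain j where j: "j \<in> set (sp g)" "bad False cs i j" by (auto simp: anyb_def)
        have T: "i \<in> T" "j \<in> T" "j \<in> T - set (sp a)" using i j a g by auto
        obtain C where C: "C \<in> set cs" "bad1 False C i j \<or> bad1 False C j i" using j by (auto simp: bad_def)
        \<comment> \<open>The solution satisfies \<open>C\<close> on the two selected blocks. A
          constraint violated somewhere on them is thus mixed, which contradicts the closure of the
          collected set.\<close>
        have "bad1 True C i j \<or> bad1 True C j i"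
          using C cT[OF C(1), of i j] cT[OF C(1), of j i] T T_\<alpha> unfolding bad1_def some_rel_def by metis
        hence "bad True cs i j" using C(1) by (auto simp: bad_def)
        thus False using a(4) i(1) T by blast
      qed
      hence c: "ls (sp g @ sp a) \<in> set (cover cs ?G (Suc t))"
        using a(1) gG by (auto simp: cover_Suc set_covl)
      have "vr ` set (sp g) \<inter> vr ` set (sp a) = {}"
      proof -
        have "vr i \<notin> vr ` set (sp g)" if "i \<in> set (sp a)" for i
          by (rule T_notin) (use that a(2) g(2) in auto)
        thus ?thesis by (rule image_disjointI)
      qed
      hence d: "distinct (map vr (sp g @ sp a))" using a(3) g(4) by (simp add: Int_commute)
      have cl: "\<not> bad True cs i j" if "i \<in> set (sp g @ sp a)" "j \<in> T - set (sp g @ sp a)" for i j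
        using that a(4) g(5)[of j] bad_commute[of True cs i j] by (auto simp: anyb_def)
      have "Suc t \<le> length (sp g @ sp a)" using a(5) False g(3) by (cases g) auto
      moreover have "set (sp g @ sp a) \<subseteq> T" using a(2) g(2) by auto
      ultimately show ?thesis using d cl by (intro bexI[OF _ c]) (simp only: sp_ls, blast)
    qed
  qed auto
  from this[of ?k] obtain a where a: "a \<in> set (cover cs ?G ?k)" "set (sp a) \<subseteq> T" "distinct (map vr (sp a))"
    "set (sp a) = T \<or> ?k \<le> length (sp a)" by blast
  have "set (sp a) = T \<Longrightarrow> length (sp a) = ?k"
    using a(3) T_card by (metis distinct_card distinct_map)
  hence "length S \<le> length (sp a)" using a(4) by auto
  thus ?thesis using a(1) by (rule bexI)
qed

theorem cover_correct:
  "(\<exists>a\<in>set (cover cs (filter (\<lambda>g. sat cs (sp g)) (grow cs F (length S))) (length S)). length S \<le> length (sp a)) \<longleftrightarrow> sat cs S"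
  using cover_sound cover_complete by blast

end

text \<open>With one-element blocks only one assignment is left. Testing all pairs, a block with
  itself included, also catches constraints from a variable to itself.\<close>

lemma sat_singletons:
  assumes "distinct (map vr S)" "\<And>i. i \<in> set S \<Longrightarrow> length (el i) = 1"
  shows "sat cs S \<longleftrightarrow> \<not> (\<exists>i\<in>set S. anyb False cs S i)"
proof -
  have el: "\<exists>v. el i = [v]" if "i \<in> set S" for i
    using assms(2)[OF that] by (auto simp: length_Suc_conv)
  show ?thesis
  proof
    assume "sat cs S"
    then obtain \<alpha> where \<alpha>: "\<And>i. i \<in> set S \<Longrightarrow> \<alpha> (vr i) \<in> set (el i)"
      "\<And>C. C \<in> set cs \<Longrightarrow> cv1 C \<in> vr ` set S \<Longrightarrow> cv2 C \<in> vr ` set S \<Longrightarrow> rel C (\<alpha> (cv1 C)) (\<alpha> (cv2 C))"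
      by (auto simp: sat_def)
    have e: "set (el i) = {\<alpha> (vr i)}" if "i \<in> set S" for i
      using el[OF that] \<alpha>(1)[OF that] by auto
    show "\<not> (\<exists>i\<in>set S. anyb False cs S i)"
    proof
      assume "\<exists>i\<in>set S. anyb False cs S i"
      then obtain i j C where ij: "i \<in> set S" "j \<in> set S" "C \<in> set cs" "bad1 False C i j"
        by (auto simp: anyb_def bad_def)
      have "rel C (\<alpha> (vr i)) (\<alpha> (vr j))" using \<alpha>(2)[of C] ij by (auto simp: bad1_def)
      thus False using ij(4) e[OF ij(1)] e[OF ij(2)] by (simp add: bad1_def some_rel_def)
    qed
  next
    assume n: "\<not> (\<exists>i\<in>set S. anyb False cs S i)"
    define \<alpha> where "\<alpha> x = hd (el (SOME i. i \<in> set S \<and> vr i = x))" for x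
    have some: "(SOME i'. i' \<in> set S \<and> vr i' = vr i) = i" if "i \<in> set S" for i
      using that distinct_vr_inj[OF assms(1)] by (intro some_equality) auto
    have e: "el i = [\<alpha> (vr i)]" if "i \<in> set S" for i
      using el[OF that] some[OF that] by (auto simp: \<alpha>_def)
    show "sat cs S" unfolding sat_def
    proof (intro exI[of _ \<alpha>] conjI ballI impI)
      fix C assume C: "C \<in> set cs" "cv1 C \<in> vr ` set S" "cv2 C \<in> vr ` set S"
      then obtain i j where ij: "i \<in> set S" "j \<in> set S" "cv1 C = vr i" "cv2 C = vr j" by auto
      have "\<not> bad False cs i j" using n ij by (auto simp: anyb_def)
      hence "\<not> bad1 False C i j" using C(1) by (auto simp: bad_def)
      thus "rel C (\<alpha> (cv1 C)) (\<alpha> (cv2 C))" using ij e by (simp add: bad1_def some_rel_def)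
    qed (use e in auto)
  qed
qed

section \<open>Size of the parts, disjointness of blocks, and forced cuts\<close>

section \<open>Greedy partitions\<close>

lemma data_fst_hd: "d \<noteq> Atom \<Longrightarrow> data_fst d = hd (sp d)"
  by (cases d) auto

lemma greedy_concat [simp]: "concat (map sp (greedy ok xs)) = xs"
  by (induction xs) (auto split: list.splits)

lemma greedy_ne_Atom: "G \<in> set (greedy ok xs) \<Longrightarrow> G \<noteq> Atom"
  by (induction xs arbitrary: G) (auto split: list.splits if_splits)

lemma greedy_ok: "G \<in> set (greedy ok xs) \<Longrightarrow> ok G \<or> length (sp G) = 1"
  by (induction xs arbitrary: G) (auto split: list.splits if_splits)

lemma greedy_eq_Nil [simp]: "greedy ok xs = [] \<longleftrightarrow> xs = []"
  by (cases xs) (auto split: list.splits)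

lemma greedy_block: "G \<in> set (greedy ok xs) \<Longrightarrow> \<exists>as bs. xs = as @ sp G @ bs"
proof -
  assume "G \<in> set (greedy ok xs)"
  then obtain us vs where "greedy ok xs = us @ G # vs" by (auto simp: in_set_conv_decomp)
  hence "concat (map sp (us @ G # vs)) = xs" by (metis greedy_concat)
  thus ?thesis by auto
qed

text \<open>A cut in front of a part means that one more element would have made it longer than
  \<open>s\<close>, so it has at least \<open>s\<close> elements; only the first part may be
  shorter. The maximum with 1 covers \<open>s = 0\<close>.\<close>

lemma greedy_count_size:
  assumes "\<And>G. length (sp G) \<le> s \<Longrightarrow> ok G"
  shows "greedy ok xs = G # Gs \<Longrightarrow> length Gs * max 1 s + length (sp G) \<le> length xs"
proof (induction xs arbitrary: G Gs)
  case (Cons x xs)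
  show ?case
  proof (cases "greedy ok xs")
    case Nil
    thus ?thesis using Cons.prems by auto
  next
    case (Cons G' Gs')
    note IH = Cons.IH[OF Cons]
    show ?thesis
    proof (cases "ok (Pair x G')")
      case True
      thus ?thesis using Cons.prems Cons IH by auto
    next
      case False
      hence "s \<le> length (sp G')" using assms[of "Pair x G'"] by (cases "length (sp (Pair x G')) \<le> s") auto
      moreover have "G' \<noteq> Atom" using greedy_ne_Atom[of G' ok xs] Cons by simp
      hence "1 \<le> length (sp G')" by (cases G') auto
      ultimately have "max 1 s \<le> length (sp G')" by simp
      moreover have "G = Pair x Atom" "Gs = G' # Gs'" using Cons.prems Cons False by auto
      ultimately show ?thesis using IH by (simp del: max.bounded_iff)
    qed
  qed
qed simp

definition gparts :: "(data \<Rightarrow> data \<Rightarrow> bool) \<Rightarrow> data list \<Rightarrow> data list" where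
  "gparts ok S = concat (map (\<lambda>i. map (Pair (vr i)) (greedy (ok (vr i)) (el i))) S)"

lemma parts_gparts: "parts s I cs u Js S = gparts (okP s I cs u Js) S"
  by (simp add: parts_def gparts_def)

lemma mem_gparts: "j \<in> set (gparts ok S) \<longleftrightarrow>
    (\<exists>i\<in>set S. vr j = vr i \<and> data_snd j \<in> set (greedy (ok (vr i)) (el i)) \<and> j \<noteq> Atom)"
  by (cases j) (auto simp: gparts_def image_iff)

lemma gparts_Cons: "gparts ok (i # S) = map (Pair (vr i)) (greedy (ok (vr i)) (el i)) @ gparts ok S"
  by (simp add: gparts_def)

definition blk :: "(data \<Rightarrow> data list) \<Rightarrow> data \<Rightarrow> bool" where
  "blk dm i \<longleftrightarrow> (\<exists>as bs. dm (vr i) = as @ el i @ bs)"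

definition hit :: "(data \<times> data) set \<Rightarrow> data \<Rightarrow> bool" where
  "hit H i \<longleftrightarrow> (\<exists>w\<in>set (el i). (vr i, w) \<in> H)"

text \<open>Distinctness of this list expresses that blocks of the same variable are disjoint and
  without repetitions. Cutting blocks into parts leaves the list unchanged.\<close>

definition plist :: "data list \<Rightarrow> (data \<times> data) list" where
  "plist I = concat (map (\<lambda>i. map (\<lambda>w. (vr i, w)) (el i)) I)"

lemma plist_append [simp]: "plist (I @ J) = plist I @ plist J"
  by (simp add: plist_def)

lemma plist_Cons: "plist (i # I) = map (\<lambda>w. (vr i, w)) (el i) @ plist I"
  by (simp add: plist_def)

lemma set_plist: "(x, w) \<in> set (plist I) \<longleftrightarrow> (\<exists>i\<in>set I. vr i = x \<and> w \<in> set (el i))"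
  by (auto simp: plist_def)

lemma plist_map_Pair: "plist (map (Pair x) Gs) = map (\<lambda>w. (x, w)) (concat (map sp Gs))"
  by (induction Gs) (auto simp: plist_def)

lemma plist_gparts [simp]: "plist (gparts ok S) = plist S"
  by (induction S) (simp_all add: gparts_Cons plist_map_Pair plist_Cons, simp_all add: gparts_def plist_def)

text \<open>The blocks are disjoint, so each block that is hit uses up a point of \<open>H\<close>
  of its own.\<close>

lemma hit_count:
  assumes "distinct (plist I)" "finite H"
  shows "length (filter (hit H) I) \<le> card H"
  using assms
proof (induction I arbitrary: H)
  case (Cons i I)
  let ?p = "(\<lambda>w. (vr i, w)) ` set (el i)"
  have d: "distinct (plist I)" and disj: "?p \<inter> set (plist I) = {}"
    using Cons.prems(1) by (auto simp: plist_Cons)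
  have "filter (hit H) I = filter (hit (H - ?p)) I"
  proof (rule filter_cong[OF refl])
    fix j assume j: "j \<in> set I"
    have "(vr j, w) \<notin> ?p" if "w \<in> set (el j)" for w
    proof -
      have "(vr j, w) \<in> set (plist I)" using j that by (auto simp: set_plist)
      thus ?thesis using disj by blast
    qed
    thus "hit H j = hit (H - ?p) j" by (auto simp: hit_def)
  qed
  hence IH: "length (filter (hit H) I) \<le> card (H - ?p)" using Cons.IH[OF d] Cons.prems(2) by simp
  show ?case
  proof (cases "hit H i")
    case True
    then obtain w where "w \<in> set (el i)" "(vr i, w) \<in> H" by (auto simp: hit_def)
    hence "H - ?p \<subset> H" by blast
    hence "card (H - ?p) < card H" by (rule psubset_card_mono[OF Cons.prems(2)])
    thus ?thesis using IH True by simp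
  next
    case False
    thus ?thesis using IH card_mono[OF Cons.prems(2), of "H - ?p"] by auto
  qed
qed simp

lemma distinct_plist:
  assumes "distinct (map vr S)" "\<And>i. i \<in> set S \<Longrightarrow> distinct (el i)"
  shows "distinct (plist S)"
  using assms
proof (induction S)
  case (Cons i S)
  have "distinct (map (\<lambda>w. (vr i, w)) (el i))" using Cons.prems(2) by (simp add: distinct_map inj_on_def)
  moreover have "(vr i, w) \<notin> set (plist S)" for w using Cons.prems(1) by (auto simp: set_plist image_iff)
  ultimately show ?case using Cons by (auto simp: plist_Cons)
qed (simp add: plist_def)

lemma plist_disjoint:
  assumes "distinct (plist I)" "i \<in> set I" "j \<in> set I" "vr i = vr j" "w \<in> set (el i)" "w \<in> set (el j)"
  shows "i = j"
  using assms
proof (induction I)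
  case (Cons k I)
  have "(vr k, v) \<notin> set (plist I)" if "v \<in> set (el k)" for v
    using Cons.prems(1) that by (auto simp: plist_Cons)
  hence n: "l \<notin> set I \<or> vr l \<noteq> vr k \<or> v \<notin> set (el l)" if "v \<in> set (el k)" for l v
    using that by (auto simp: set_plist)
  show ?case
  proof (cases "i = k \<or> j = k")
    case True
    thus ?thesis using n[of w i] n[of w j] Cons.prems by auto
  next
    case False
    thus ?thesis using Cons by (auto simp: plist_Cons)
  qed
qed simp

text \<open>Mixedness is witnessed by two pairs of elements, one allowed and one forbidden, and
  these survive in larger blocks.\<close>

lemma bad_mono:
  assumes "bad True cs i j" "vr i' = vr i" "set (el i) \<subseteq> set (el i')" "vr j' = vr j" "set (el j) \<subseteq> set (el j')"
  shows "bad True cs i' j'"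
  using assms unfolding bad_def bad1_def some_rel_def by (simp only:) blast

text \<open>If \<open>F\<close> met two parts, the later one would begin inside \<open>F\<close>, at
  an element of its tail. A part beginning at the head of \<open>F\<close> is harmless, hence
  \<open>tl F\<close>.\<close>

lemma block_in_part:
  assumes "concat Gs = as @ F @ bs" "\<And>G. G \<in> set Gs \<Longrightarrow> G \<noteq> []" "\<And>w. w \<in> set (tl F) \<Longrightarrow> w \<notin> hd ` set Gs" "Gs \<noteq> []"
  shows "\<exists>G\<in>set Gs. set F \<subseteq> set G"
  using assms
proof (induction Gs arbitrary: as)
  case (Cons G R)
  show ?case
  proof (cases "F = []")
    case False
    from Cons.prems(1) have "G @ concat R = as @ (F @ bs)" by simp
    then consider us where "G @ us = as" "concat R = us @ F @ bs" | G' where "G = as @ G'" "G' @ concat R = F @ bs" "G' \<noteq> []"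
      by (auto simp: append_eq_append_conv2) (metis append_Nil2)+
    thus ?thesis
    proof cases
      case 1
      have "R \<noteq> []" using 1(2) False by auto
      thus ?thesis using Cons.IH[OF 1(2)] Cons.prems by auto
    next
      case 2
      then obtain us where "G' = F @ us \<or> F = G' @ us \<and> concat R = us @ bs"
        by (auto simp: append_eq_append_conv2)
      then consider "G' = F @ us" | us where "F = G' @ us" "us \<noteq> []" "concat R = us @ bs"
        by (cases "us = []") auto
      thus ?thesis
      proof cases
        case 1
        thus ?thesis using 2(1) by auto
      next
        case u: 2
        then obtain G2 R2 where R: "R = G2 # R2" by (cases R) auto
        have "hd us = hd G2" using u Cons.prems(2)[of G2] R by (cases us; cases G2) auto
        moreover have "hd us \<in> set (tl F)" using u 2(3) by (cases G') auto
        ultimately show ?thesis using Cons.prems(3)[of "hd us"] R by auto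
      qed
    qed
  qed auto
qed simp

text \<open>Forced cuts are respected: a part is extended in front only if its former first element
  is not a forced start.\<close>

lemma greedy_tl_not_start:
  assumes "\<And>G. ok G \<Longrightarrow> \<not> st (data_fst (data_snd G))"
  shows "F \<in> set (greedy ok xs) \<Longrightarrow> w \<in> set (tl (sp F)) \<Longrightarrow> \<not> st w"
proof (induction xs arbitrary: F w)
  case (Cons x xs)
  show ?case
  proof (cases "greedy ok xs")
    case Nil
    thus ?thesis using Cons.prems by auto
  next
    case (Cons G Gs)
    show ?thesis
    proof (cases "ok (Pair x G) \<and> F = Pair x G")
      case True
      hence "\<not> st (data_fst G)" using assms by fastforce
      moreover have "G \<noteq> Atom" using greedy_ne_Atom[of G ok xs] Cons by simp
      ultimately show ?thesis using Cons.IH[of G w] Cons Cons.prems(2) True by (cases G) auto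
    next
      case False
      hence "F \<in> set (greedy ok xs) \<or> F = Pair x Atom"
        using Cons.prems(1) Cons by (auto split: if_splits)
      thus ?thesis using Cons.IH Cons.prems(2) by auto
    qed
  qed
qed simp

lemma greedy_hd_first: "greedy ok xs = G # Gs \<Longrightarrow> hd (sp G) = hd xs"
  by (cases xs) (auto split: list.splits if_splits)

text \<open>The converse: where forced starts are the only reason to reject a part, there are no
  other cuts, apart from the beginning of the list.\<close>

lemma greedy_hd_start:
  assumes "\<And>G. length (sp G) \<le> n \<Longrightarrow> \<not> ok G \<Longrightarrow> st (data_fst (data_snd G))" "length xs \<le> n"
  shows "greedy ok xs = G # Gs \<Longrightarrow> F \<in> set Gs \<Longrightarrow> st (hd (sp F))"
  using assms(2)
proof (induction xs arbitrary: G Gs F)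
  case (Cons x xs)
  show ?case
  proof (cases "greedy ok xs")
    case Nil
    thus ?thesis using Cons.prems by auto
  next
    case (Cons G' Gs')
    have G': "G' \<in> set (greedy ok xs)" using Cons by simp
    obtain as bs where ab: "xs = as @ sp G' @ bs" using greedy_block[OF G'] by blast
    have hdG: "data_fst G' = hd (sp G')" using greedy_ne_Atom[OF G'] by (cases G') auto
    show ?thesis
    proof (cases "ok (Pair x G')")
      case True
      thus ?thesis using Cons.IH[OF Cons, of F] Cons.prems Cons by auto
    next
      case False
      have "length (sp (Pair x G')) \<le> n" using ab Cons.prems(3) by auto
      hence "st (hd (sp G'))" using assms(1)[of "Pair x G'"] False hdG by auto
      moreover have "Gs = G' # Gs'" using Cons.prems(1) Cons False by auto
      hence "F = G' \<or> F \<in> set Gs'" using Cons.prems(2) by simp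
      ultimately show ?thesis using Cons.IH[OF Cons, of F] Cons.prems(3) by auto
    qed
  qed
qed simp

section \<open>Few parts and few mixed neighbours\<close>

section \<open>Counting\<close>

lemma sum_list_le_const: "(\<And>x. x \<in> set xs \<Longrightarrow> f x \<le> (c :: nat)) \<Longrightarrow> (\<Sum>x\<leftarrow>xs. f x) \<le> length xs * c"
  by (induction xs) (auto intro: add_mono)

text \<open>
  The number of mixed pairs is linear in the number of blocks: each \<open>H1 i\<close> and \<open>H2 i\<close> meets at
  most \<open>h\<close> blocks of a partition.  A mixed pair charged to \<open>H2\<close> needs a block with at least two
  elements, since a singleton cannot be cut further.
\<close>

locale neat =
  fixes cs :: "data list" and dm :: "data \<Rightarrow> data list" and H1 H2 :: "data \<Rightarrow> (data \<times> data) set"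
    and h u :: nat
  assumes distinct_dm: "\<And>x. distinct (dm x)"
    and finite_H: "\<And>i. finite (H1 i)" "\<And>i. finite (H2 i)"
    and card_H: "\<And>i. card (H1 i) \<le> h" "\<And>i. card (H2 i) \<le> h"
    and mixed_hit: "\<And>i j. blk dm i \<Longrightarrow> blk dm j \<Longrightarrow> bad True cs i j \<Longrightarrow>
      hit (H1 i) j \<or> 2 \<le> length (el i) \<and> hit (H2 j) i"
    and h_le: "9 * h \<le> u"
begin

text \<open>One fixed set \<open>H1 i\<close> accounts for all but the second kind of neighbours,
  hence for at most \<open>h\<close> of them. Those of the second kind hit \<open>i\<close> itself
  and can be charged to the cuts around it.\<close>

lemma nbrs_count:
  assumes "blk dm i" "\<And>j. j \<in> set I \<Longrightarrow> blk dm j" "distinct (plist I)"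
  shows "length (nbrs cs I i) \<le> h + length (filter (\<lambda>j. 2 \<le> length (el i) \<and> hit (H2 j) i) I)"
proof -
  have "length (nbrs cs I i) \<le> length (filter (hit (H1 i)) I) + length (filter (\<lambda>j. 2 \<le> length (el i) \<and> hit (H2 j) i) I)"
    using assms(2)
  proof (induction I)
    case (Cons j I)
    thus ?case using mixed_hit[OF assms(1), of j] by auto
  qed simp
  also have "length (filter (hit (H1 i)) I) \<le> h"
    using hit_count[OF assms(3) finite_H(1)] card_H(1) le_trans by blast
  finally show ?thesis by simp
qed

definition hits :: "data \<Rightarrow> data list \<Rightarrow> nat" where
  "hits j Ps = length (filter (hit (H2 j)) Ps)"

lemma hits_simps [simp]: "hits j [] = 0" "hits j (p # Ps) = of_bool (hit (H2 j) p) + hits j Ps"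
    "hits j (Ps @ Qs) = hits j Ps + hits j Qs"
  by (auto simp: hits_def)

text \<open>
  Each cut is charged to the more than \<open>u\<close> mixed neighbours of the rejected block, which consists
  of a part and the last element of the preceding part.
\<close>

lemma greedy_count_deg:
  assumes I: "\<And>j. j \<in> set I \<Longrightarrow> blk dm j" "distinct (plist I)" and n: "length xs \<le> n"
    and b: "dm x = as @ xs @ bs"
  shows "greedy (okP n I cs u [] x) xs = G # Gs \<Longrightarrow>
    length Gs * (u + 1) \<le> h * length Gs +
      (\<Sum>j\<leftarrow>I. hits j [Pair x G] + 2 * hits j (map (Pair x) Gs))"
  using n b
proof (induction xs arbitrary: G Gs as)
  case (Cons v xs)
  show ?case
  proof (cases "greedy (okP n I cs u [] x) xs")
    case Nil
    thus ?thesis using Cons.prems by auto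
  next
    case (Cons G' Gs')
    have G': "G' \<in> set (greedy (okP n I cs u [] x) xs)" using Cons by simp
    have "length xs \<le> n" "dm x = (as @ [v]) @ xs @ bs" using Cons.prems by auto
    note IH = Cons.IH[OF Cons this]
    have mono: "hits j [Pair x G'] \<le> hits j [Pair x (Pair v G')]" for j
      by (auto simp: hit_def)
    show ?thesis
    proof (cases "okP n I cs u [] x (Pair v G')")
      case True
      hence G: "G = Pair v G'" "Gs = Gs'" using Cons.prems(1) Cons by auto
      have "(\<Sum>j\<leftarrow>I. hits j [Pair x G'] + 2 * hits j (map (Pair x) Gs')) \<le>
        (\<Sum>j\<leftarrow>I. hits j [Pair x G] + 2 * hits j (map (Pair x) Gs))"
        unfolding G by (intro sum_list_mono add_mono mono) auto
      hence "length Gs' * (u + 1) \<le> h * length Gs' +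
        (\<Sum>j\<leftarrow>I. hits j [Pair x G] + 2 * hits j (map (Pair x) Gs))" using IH by simp
      thus ?thesis using G(2) by simp
    next
      case False
      hence G: "G = Pair v Atom" "Gs = G' # Gs'" using Cons.prems(1) Cons by auto
      let ?i = "Pair x (Pair v G')"
      have con: "xs = sp G' @ concat (map sp Gs')"
        using greedy_concat[of "okP n I cs u [] x" xs] Cons by simp
      have "length (sp (Pair v G')) \<le> n" using con Cons.prems(2) by simp
      hence "u + 1 \<le> length (nbrs cs I ?i)"
        using False by (auto simp: okP_def start_def)
      also have "blk dm ?i" unfolding blk_def using Cons.prems(3) con
        by (intro exI[of _ as] exI[of _ "concat (map sp Gs') @ bs"]) simp
      hence "length (nbrs cs I ?i) \<le> h + length (filter (\<lambda>j. 2 \<le> length (el ?i) \<and> hit (H2 j) ?i) I)"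
        by (rule nbrs_count[OF _ I])
      \<comment> \<open>A set hitting the rejected block hits \<open>v\<close> or \<open>G'\<close>.
        A part is thus charged at most twice: for the cut behind it, through its last element, and
        for the cut in front of it. The current first part has no cut in front of it and is counted
        once.\<close>
      also have "length (filter (\<lambda>j. 2 \<le> length (el ?i) \<and> hit (H2 j) ?i) I) \<le>
          (\<Sum>j\<leftarrow>I. hits j [Pair x (Pair v Atom)] + hits j [Pair x G'])"
        by (induction I) (auto simp: hit_def)
      finally have "u + 1 \<le> h + (\<Sum>j\<leftarrow>I. hits j [Pair x (Pair v Atom)] + hits j [Pair x G'])" by simp
      with IH have "length Gs' * (u + 1) + (u + 1) \<le> (h * length Gs' + h) +
         ((\<Sum>j\<leftarrow>I. hits j [Pair x G'] + 2 * hits j (map (Pair x) Gs')) +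
          (\<Sum>j\<leftarrow>I. hits j [Pair x (Pair v Atom)] + hits j [Pair x G']))" by linarith
      also have "(\<Sum>j\<leftarrow>I. hits j [Pair x G'] + 2 * hits j (map (Pair x) Gs')) +
          (\<Sum>j\<leftarrow>I. hits j [Pair x (Pair v Atom)] + hits j [Pair x G']) =
          (\<Sum>j\<leftarrow>I. hits j [Pair x G] + 2 * hits j (map (Pair x) Gs))"
        unfolding G by (simp add: sum_list_addf[symmetric] algebra_simps)
      finally show ?thesis using G by simp
    qed
  qed
qed simp

text \<open>The first part of each item of \<open>S\<close> has no cut in front of it; the term
  \<open>length S * (u + 1)\<close> pays for these.\<close>

lemma gparts_count_deg:
  assumes I: "\<And>j. j \<in> set I \<Longrightarrow> blk dm j" "distinct (plist I)"
    and S: "\<And>i. i \<in> set S \<Longrightarrow> blk dm i \<and> length (el i) \<le> n"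
  shows "length (gparts (okP n I cs u []) S) * (u + 1) \<le> length S * (u + 1) +
    h * length (gparts (okP n I cs u []) S) + 2 * (\<Sum>j\<leftarrow>I. hits j (gparts (okP n I cs u []) S))"
  using S
proof (induction S)
  case (Cons i S)
  let ?P = "gparts (okP n I cs u []) S" and ?g = "greedy (okP n I cs u [] (vr i)) (el i)"
  have IH: "length ?P * (u + 1) \<le> length S * (u + 1) + h * length ?P + 2 * (\<Sum>j\<leftarrow>I. hits j ?P)"
    using Cons by simp
  have "length ?g * (u + 1) \<le> (u + 1) + h * length ?g + 2 * (\<Sum>j\<leftarrow>I. hits j (map (Pair (vr i)) ?g))"
  proof (cases ?g)
    case (Cons G Gs)
    obtain as bs where ab: "dm (vr i) = as @ el i @ bs" using Cons.prems[of i] by (auto simp: blk_def)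
    have "length (el i) \<le> n" using Cons.prems[of i] by simp
    from greedy_count_deg[OF I this ab Cons]
    have "length Gs * (u + 1) \<le> h * length Gs +
      (\<Sum>j\<leftarrow>I. hits j [Pair (vr i) G] + 2 * hits j (map (Pair (vr i)) Gs))" .
    also have "(\<Sum>j\<leftarrow>I. hits j [Pair (vr i) G] + 2 * hits j (map (Pair (vr i)) Gs)) \<le>
        (\<Sum>j\<leftarrow>I. 2 * hits j (map (Pair (vr i)) ?g))"
      unfolding Cons by (intro sum_list_mono) auto
    finally have "length Gs * (u + 1) \<le> h * length Gs + 2 * (\<Sum>j\<leftarrow>I. hits j (map (Pair (vr i)) ?g))"
      by (simp add: sum_list_const_mult)
    thus ?thesis using Cons by simp
  qed simp
  with IH have "(length ?g + length ?P) * (u + 1) \<le> (length S + 1) * (u + 1) + h * (length ?g + length ?P) +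
      2 * ((\<Sum>j\<leftarrow>I. hits j (map (Pair (vr i)) ?g)) + (\<Sum>j\<leftarrow>I. hits j ?P))"
    by (simp add: algebra_simps)
  thus ?case by (simp add: gparts_Cons sum_list_addf)
qed (simp add: gparts_def)

text \<open>Double counting: the new parts are disjoint as well, so each \<open>j\<close> of
  \<open>I\<close> hits at most \<open>h\<close> of them, and all charges together are at most
  \<open>2 * length I * h\<close>. Each part costs \<open>u + 1 - h\<close>, which is at least
  \<open>8 * h\<close> because \<open>9 * h \<le> u\<close>. Dividing gives eight times the number
  of parts at most \<open>9 * length S + 2 * length I\<close>.\<close>

lemma next_level_count:
  assumes I: "\<And>j. j \<in> set I \<Longrightarrow> blk dm j" "distinct (plist I)"
    and S: "\<And>i. i \<in> set S \<Longrightarrow> blk dm i \<and> length (el i) \<le> n" "distinct (plist S)"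
  shows "4 * length (parts n I cs u [] S) \<le> 5 * length S + length I"
proof -
  let ?P = "parts n I cs u [] S"
  have d: "distinct (plist ?P)" using S(2) by (simp add: parts_gparts)
  have "hits j ?P \<le> h" for j
    unfolding hits_def using hit_count[OF d finite_H(2)] card_H(2) le_trans by blast
  hence "(\<Sum>j\<leftarrow>I. hits j ?P) \<le> length I * h" by (intro sum_list_le_const) auto
  hence 1: "length ?P * (u + 1) \<le> length S * (u + 1) + h * length ?P + 2 * (length I * h)"
    using gparts_count_deg[OF I S(1)] unfolding parts_gparts by fastforce
  define w where "w = u + 1 - h"
  have u: "u + 1 = w + h" "8 * h \<le> w" "0 < w" using h_le by (auto simp: w_def)
  have "length ?P * w \<le> length S * (w + h) + 2 * length I * h"
    using 1 unfolding u(1) by (simp add: algebra_simps)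
  hence "8 * (length ?P * w) \<le> 8 * length S * w + length S * (8 * h) + 2 * length I * (8 * h)"
    by (simp add: algebra_simps)
  also have "\<dots> \<le> 8 * length S * w + length S * w + 2 * length I * w"
    using u(2) by (intro add_mono mult_left_mono) auto
  also have "\<dots> = (9 * length S + 2 * length I) * w" by (simp add: algebra_simps)
  finally have "(8 * length ?P) * w \<le> (9 * length S + 2 * length I) * w" by (simp add: algebra_simps)
  hence "8 * length ?P \<le> 9 * length S + 2 * length I" using u(3) by simp
  thus ?thesis by simp
qed

end

lemma mem_alls: "j \<in> set (alls it S n cs u k) \<longleftrightarrow> (\<exists>l\<le>k. j \<in> set (its it S n cs u l))"
proof (induction k)
  case (Suc k)
  show ?case by (simp only: alls.simps set_append Un_iff Suc le_Suc_eq) blast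
qed simp

locale level = neat +
  fixes S :: "data list" and n :: nat
  assumes distinct_S: "distinct (map vr S)"
    and blk_S: "\<And>i. i \<in> set S \<Longrightarrow> blk dm i"
    and length_S: "\<And>i. i \<in> set S \<Longrightarrow> length (el i) \<le> n"
begin

abbreviation "k \<equiv> length S"
text \<open>The parts of \<open>J 0\<close> are short, and those of \<open>J (Suc l)\<close> have
  few mixed neighbours in \<open>J l\<close>. The degree of a partition relative to itself is never
  controlled directly.\<close>

abbreviation "J \<equiv> its (parts (n div 2 ^ u) [] cs u [] S) S n cs u"
abbreviation "F \<equiv> refine (n div 2 ^ u) n cs u S"

lemma distinct_el: "i \<in> set S \<Longrightarrow> distinct (el i)"
  using blk_S distinct_dm unfolding blk_def by (metis distinct_append)

lemma distinct_plist_S: "distinct (plist S)"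
  by (rule distinct_plist[OF distinct_S distinct_el])

lemma J_gparts: "\<exists>ok. J l = gparts ok S"
  by (cases l) (auto simp: parts_gparts)

lemma gparts_blk:
  assumes "j \<in> set (gparts ok S)"
  shows "blk dm j"
proof -
  obtain i where i: "i \<in> set S" "vr j = vr i" "data_snd j \<in> set (greedy (ok (vr i)) (el i))"
    using assms by (auto simp: mem_gparts)
  obtain as bs where "el i = as @ el j @ bs" using greedy_block[OF i(3)] by blast
  moreover obtain as' bs' where "dm (vr i) = as' @ el i @ bs'" using blk_S[OF i(1)] by (auto simp: blk_def)
  ultimately have "dm (vr j) = (as' @ as) @ el j @ (bs @ bs')" using i(2) by simp
  thus ?thesis unfolding blk_def by blast
qed

lemma J_blk: "j \<in> set (J l) \<Longrightarrow> blk dm j"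
  using gparts_blk J_gparts by metis

lemma J_plist: "distinct (plist (J l))"
  using J_gparts[of l] distinct_plist_S by auto

text \<open>Rounding \<open>n div 2 ^ u\<close> down costs the factor 2, and the possibly short
  first part of each item costs the summand 1.\<close>

lemma J0_count: "length (J 0) \<le> k * (1 + 2 * 2 ^ u)"
proof -
  let ?s = "n div 2 ^ u"
  have ok: "okP ?s [] cs u [] x G" if "length (sp G) \<le> ?s" for x G
    using that by (simp add: okP_def start_def)
  have "length (greedy (okP ?s [] cs u [] (vr i)) (el i)) \<le> 1 + 2 * 2 ^ u" if i: "i \<in> set S" for i
  proof (cases "greedy (okP ?s [] cs u [] (vr i)) (el i)")
    case (Cons G Gs)
    have "n = 2 ^ u * ?s + n mod 2 ^ u" by simp
    moreover have "n mod 2 ^ u < 2 ^ u" by simp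
    ultimately have "n < 2 ^ u * ?s + 2 ^ u" by linarith
    also have "\<dots> \<le> 2 * 2 ^ u * max 1 ?s" by (auto simp: max_def)
    finally have "n < 2 * 2 ^ u * max 1 ?s" .
    moreover have "length Gs * max 1 ?s \<le> n"
      using greedy_count_size[of ?s, OF ok Cons] length_S[OF i] by linarith
    ultimately have "length Gs * max 1 ?s < 2 * 2 ^ u * max 1 ?s" by linarith
    hence "length Gs < 2 * 2 ^ u" by (rule mult_less_cancel2[THEN iffD1, THEN conjunct2])
    thus ?thesis using Cons by simp
  qed simp
  hence "(\<Sum>i\<leftarrow>S. length (greedy (okP ?s [] cs u [] (vr i)) (el i))) \<le> k * (1 + 2 * 2 ^ u)"
    by (rule sum_list_le_const)
  thus ?thesis by (simp add: parts_gparts gparts_def length_concat comp_def)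
qed

text \<open>The recurrence \<open>4 * a (l + 1) \<le> 5 * k + a l\<close> has a fixed point at five
  thirds of \<open>k\<close>, below \<open>2 * k\<close>; the excess over it is divided by 4 in each
  round.\<close>

lemma J_count: "4 ^ l * length (J l) \<le> 2 * k * 4 ^ l + length (J 0)"
proof (induction l)
  case (Suc l)
  have "4 * length (J (Suc l)) \<le> 5 * k + length (J l)"
    unfolding its.simps
    by (rule next_level_count) (use J_blk J_plist blk_S length_S distinct_plist_S in auto)
  hence "4 ^ l * (4 * length (J (Suc l))) \<le> 4 ^ l * (5 * k + length (J l))" by (rule mult_left_mono) simp
  also have "\<dots> = 4 ^ l * 5 * k + 4 ^ l * length (J l)" by (simp add: algebra_simps)
  also have "\<dots> \<le> 4 ^ l * 8 * k + length (J 0)" using Suc by (simp add: algebra_simps)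
  finally show ?case by (simp add: algebra_simps)
qed simp

lemma J_le: "length (J l) \<le> 5 * k * 2 ^ u"
proof -
  have "4 ^ l * length (J l) \<le> 4 ^ l * (2 * k + length (J 0))"
    by (rule le_trans[OF J_count]) (simp add: algebra_simps)
  hence "length (J l) \<le> 2 * k + length (J 0)" by simp
  also have "\<dots> \<le> 2 * k + (k + 2 * k * 2 ^ u)" using J0_count by (simp add: algebra_simps)
  also have "\<dots> \<le> 5 * k * 2 ^ u"
    using mult_le_mono2[of 1 "2 ^ u" "3 * k"] by (simp add: algebra_simps)
  finally show ?thesis .
qed

text \<open>The \<open>u\<close> rounds divide an initial excess of order \<open>k * 2 ^ u\<close>
  by \<open>4 ^ u\<close>.\<close>

lemma J_last: "length (J u) \<le> 5 * k"
proof -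
  have "4 ^ u * length (J u) \<le> 2 * k * 4 ^ u + k * (1 + 2 * 2 ^ u)"
    by (rule le_trans[OF J_count]) (simp add: J0_count[simplified])
  also have "k * (1 + 2 * 2 ^ u) \<le> k * (4 ^ u + 2 * 4 ^ u)"
    by (intro mult_left_mono add_mono power_mono) auto
  finally have "4 ^ u * length (J u) \<le> 4 ^ u * (5 * k)" by (simp add: algebra_simps)
  thus ?thesis by simp
qed

lemma h_le_u: "h \<le> u"
  using h_le by simp

text \<open>Accepted parts satisfy the bound by \<open>okP\<close>. Singletons escape this test, but
  the second alternative of \<open>mixed_hit\<close> is impossible for them, so they have at most
  \<open>h\<close> neighbours.\<close>

lemma J_deg:
  assumes "i \<in> set (J (Suc l))"
  shows "length (nbrs cs (J l) i) \<le> u"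
proof -
  obtain i0 where i: "i0 \<in> set S" "vr i = vr i0" "data_snd i \<in> set (greedy (okP n (J l) cs u [] (vr i0)) (el i0))"
    "i \<noteq> Atom" using assms by (auto simp: parts_gparts mem_gparts)
  hence pair: "i = Pair (vr i0) (data_snd i)" by (cases i) auto
  consider "okP n (J l) cs u [] (vr i0) (data_snd i)" | "length (el i) = 1" using greedy_ok[OF i(3)] by blast
  thus ?thesis
  proof cases
    case 1
    thus ?thesis using pair by (simp add: okP_def)
  next
    case 2
    have "filter (\<lambda>j. 2 \<le> length (el i) \<and> hit (H2 j) i) (J l) = []" using 2 by simp
    moreover have "length (nbrs cs (J l) i) \<le> h + length (filter (\<lambda>j. 2 \<le> length (el i) \<and> hit (H2 j) i) (J l))"
      by (rule nbrs_count[OF J_blk[OF assms] J_blk J_plist])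
    ultimately show ?thesis using h_le_u by simp
  qed
qed

lemma F_gparts: "F = gparts (okP n [] cs u (alls (parts (n div 2 ^ u) [] cs u [] S) S n cs u u)) S"
  by (simp add: refine_def parts_gparts)

lemma F_blk: "j \<in> set F \<Longrightarrow> blk dm j"
  using gparts_blk F_gparts by metis

lemma F_plist: "distinct (plist F)"
  using F_gparts distinct_plist_S by simp

lemma F_ne: "j \<in> set F \<Longrightarrow> el j \<noteq> []"
  using greedy_ne_Atom by (auto simp: F_gparts mem_gparts)

lemma gparts_ne: "j \<in> set (gparts ok S) \<Longrightarrow> el j \<noteq> []"
  using greedy_ne_Atom by (auto simp: mem_gparts)

text \<open>All first elements of parts of \<open>J l\<close> are forced cuts of \<open>F\<close>,
  so no such part begins strictly inside a block of \<open>F\<close>.\<close>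

lemma F_below:
  assumes i: "i \<in> set F" and l: "l \<le> u"
  obtains j where "j \<in> set (J l)" "vr j = vr i" "set (el i) \<subseteq> set (el j)"
proof -
  let ?A = "alls (parts (n div 2 ^ u) [] cs u [] S) S n cs u u"
  obtain ok where ok: "J l = gparts ok S" using J_gparts by blast
  obtain i0 where i0: "i0 \<in> set S" "vr i = vr i0" "data_snd i \<in> set (greedy (okP n [] cs u ?A (vr i0)) (el i0))"
    using i by (auto simp: F_gparts mem_gparts)
  obtain as bs where ab: "el i0 = as @ el i @ bs" using greedy_block[OF i0(3)] by blast
  let ?g = "greedy (ok (vr i0)) (el i0)"
  have el_ne: "el i0 \<noteq> []" using ab F_ne[OF i] by auto
  have "\<exists>G\<in>set (map sp ?g). set (el i) \<subseteq> set G"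
  proof (rule block_in_part)
    show "concat (map sp ?g) = as @ el i @ bs" using ab by simp
    show "map sp ?g \<noteq> []" using el_ne by simp
    show "G \<noteq> []" if "G \<in> set (map sp ?g)" for G using that greedy_ne_Atom by auto
    fix w assume w: "w \<in> set (tl (el i))"
    have "\<not> start ?A (vr i0) w"
      by (rule greedy_tl_not_start[OF _ i0(3) w]) (auto simp: okP_def)
    moreover have "start ?A (vr i0) w" if w': "w \<in> hd ` set (map sp ?g)"
    proof -
      obtain G where G: "G \<in> set ?g" "w = hd (sp G)" using w' by auto
      have "Pair (vr i0) G \<in> set (J l)" using G(1) i0(1) ok by (auto simp: mem_gparts)
      hence "Pair (vr i0) G \<in> set ?A" using l by (auto simp: mem_alls)
      moreover have "data_fst G = w" using G(2) data_fst_hd[OF greedy_ne_Atom[OF G(1)]] by simp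
      ultimately show ?thesis unfolding start_def by (intro bexI[of _ "Pair (vr i0) G"]) auto
    qed
    ultimately show "w \<notin> hd ` set (map sp ?g)" by blast
  qed
  then obtain G where G: "G \<in> set ?g" "set (el i) \<subseteq> set (sp G)" by auto
  have "Pair (vr i0) G \<in> set (J l)" using G(1) i0(1) ok by (auto simp: mem_gparts)
  thus thesis using that[of "Pair (vr i0) G"] G(2) i0(2) by simp
qed

lemma F_length:
  assumes i: "i \<in> set F"
  shows "length (el i) \<le> max 1 (n div 2 ^ u)"
proof -
  obtain j where j: "j \<in> set (J 0)" "vr j = vr i" "set (el i) \<subseteq> set (el j)" using F_below[OF i] by blast
  then obtain i0 where "data_snd j \<in> set (greedy (okP (n div 2 ^ u) [] cs u [] (vr i0)) (el i0))"
    by (auto simp: parts_gparts mem_gparts)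
  hence "length (el j) \<le> max 1 (n div 2 ^ u)" by (auto dest!: greedy_ok simp: okP_def)
  moreover have "distinct (el i)" using F_blk[OF i] distinct_dm unfolding blk_def by (metis distinct_append)
  hence "length (el i) \<le> length (el j)"
    using j(3) by (metis card_length card_mono distinct_card finite_set le_trans)
  ultimately show ?thesis by linarith
qed

text \<open>\<open>F\<close> has no cuts of its own: it is cut with the full length \<open>n\<close>
  and with no blocks to count neighbours in, so only forced starts remain. The part of
  \<open>J l\<close> beginning at the head of a block of \<open>F\<close> also contains the block,
  by disjointness.\<close>

lemma F_start:
  assumes i: "i \<in> set F"
  obtains l j where "l \<le> u" "j \<in> set (J l)" "vr j = vr i" "hd (el j) = hd (el i)" "set (el i) \<subseteq> set (el j)"
proof -
  let ?A = "alls (parts (n div 2 ^ u) [] cs u [] S) S n cs u u"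
  obtain i0 where i0: "i0 \<in> set S" "vr i = vr i0" "data_snd i \<in> set (greedy (okP n [] cs u ?A (vr i0)) (el i0))"
    using i by (auto simp: F_gparts mem_gparts)
  obtain G Gs where g: "greedy (okP n [] cs u ?A (vr i0)) (el i0) = G # Gs"
    using i0(3) by (cases "greedy (okP n [] cs u ?A (vr i0)) (el i0)") auto
  have "\<exists>l\<le>u. \<exists>j\<in>set (J l). vr j = vr i \<and> hd (el j) = hd (el i)"
  proof (cases "data_snd i = G")
    case True
    \<comment> \<open>The first block of an item begins where the item does, as does the first part
      in every partition; \<open>J 0\<close> is an arbitrary choice.\<close>
    obtain ok where ok: "J 0 = gparts ok S" using J_gparts by blast
    have "el i0 \<noteq> []" using g by auto
    then obtain G' Gs' where g': "greedy (ok (vr i0)) (el i0) = G' # Gs'"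
      by (cases "greedy (ok (vr i0)) (el i0)") auto
    have "Pair (vr i0) G' \<in> set (J 0)" using g' i0(1) unfolding ok by (auto simp: mem_gparts)
    moreover have "hd (sp G') = hd (el i)" using True greedy_hd_first[OF g] greedy_hd_first[OF g'] by simp
    ultimately show ?thesis using i0(2) by (intro exI[of _ 0] conjI bexI[of _ "Pair (vr i0) G'"]) auto
  next
    case False
    hence "data_snd i \<in> set Gs" using i0(3) g by auto
    hence "start ?A (vr i0) (hd (el i))"
      by (rule greedy_hd_start[where n = n, OF _ length_S[OF i0(1)] g, rotated]) (auto simp: okP_def)
    then obtain j l where j: "l \<le> u" "j \<in> set (J l)" "vr j = vr i0" "data_fst (data_snd j) = hd (el i)"
      by (auto simp: start_def mem_alls)
    have "el j \<noteq> []" using j(2) J_gparts[of l] gparts_ne by auto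
    hence "data_fst (data_snd j) = hd (el j)" by (cases "data_snd j") auto
    thus ?thesis using j i0(2) by auto
  qed
  then obtain l j where j: "l \<le> u" "j \<in> set (J l)" "vr j = vr i" "hd (el j) = hd (el i)" by blast
  obtain j' where j': "j' \<in> set (J l)" "vr j' = vr i" "set (el i) \<subseteq> set (el j')" using F_below[OF i j(1)] by blast
  have "el j \<noteq> []" using j(2) J_gparts[of l] gparts_ne by auto
  hence "hd (el i) \<in> set (el j)" using j(4) by (metis hd_in_set)
  moreover have "hd (el i) \<in> set (el j')" using j'(3) F_ne[OF i] by auto
  ultimately have "j = j'" using plist_disjoint[OF J_plist j(2) j'(1)] j(3) j'(2) by auto
  thus thesis using that j j' by blast
qed

text \<open>A block of \<open>F\<close> is determined by its variable and its first element, and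
  shares both with a part of some \<open>J l\<close> that contains it. A property inherited by
  larger blocks can thus be counted in the partitions.\<close>

lemma F_filter_count:
  assumes "\<And>l i j. l \<le> u \<Longrightarrow> i \<in> set F \<Longrightarrow> p i \<Longrightarrow> j \<in> set (J l) \<Longrightarrow> vr j = vr i \<Longrightarrow> set (el i) \<subseteq> set (el j) \<Longrightarrow> q j"
  shows "length (filter p F) \<le> (\<Sum>l\<le>u. length (filter q (J l)))"
proof -
  let ?f = "\<lambda>i. (vr i, hd (el i))"
  have inj: "inj_on ?f (set F)"
  proof (rule inj_onI)
    fix i j assume ij: "i \<in> set F" "j \<in> set F" "?f i = ?f j"
    have "hd (el i) \<in> set (el i)" "hd (el j) \<in> set (el j)" using F_ne ij by (meson hd_in_set)+
    thus "i = j" using plist_disjoint[OF F_plist ij(1,2), of "hd (el i)"] ij(3) by auto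
  qed
  have "distinct F"
  proof -
    have "distinct I" if "distinct (plist I)" "\<And>i. i \<in> set I \<Longrightarrow> el i \<noteq> []" for I
      using that
    proof (induction I)
      case (Cons i I)
      have "i \<notin> set I"
      proof
        assume i: "i \<in> set I"
        obtain w where w: "w \<in> set (el i)" using Cons.prems(2)[of i] by (cases "el i") auto
        hence "(vr i, w) \<in> set (plist I)" using i by (auto simp: set_plist)
        moreover have "(vr i, w) \<notin> set (plist I)" using Cons.prems(1) w by (auto simp: plist_Cons)
        ultimately show False by blast
      qed
      thus ?case using Cons by (auto simp: plist_Cons)
    qed simp
    thus ?thesis using F_plist F_ne by blast
  qed
  hence "length (filter p F) = card (set (filter p F))" by (metis distinct_card distinct_filter)
  also have "\<dots> = card (?f ` set (filter p F))"
    by (rule card_image[symmetric]) (rule inj_on_subset[OF inj], auto)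
  also have "?f ` set (filter p F) \<subseteq> (\<Union>l\<le>u. ?f ` set (filter q (J l)))"
  proof
    fix y assume "y \<in> ?f ` set (filter p F)"
    then obtain i where i: "i \<in> set F" "p i" "y = ?f i" by auto
    obtain l j where j: "l \<le> u" "j \<in> set (J l)" "vr j = vr i" "hd (el j) = hd (el i)" "set (el i) \<subseteq> set (el j)"
      using F_start[OF i(1)] by blast
    have "q j" using assms j i by blast
    hence "?f j \<in> ?f ` set (filter q (J l))" using j(2) by simp
    moreover have "y = ?f j" using i(3) j(3,4) by simp
    ultimately show "y \<in> (\<Union>l\<le>u. ?f ` set (filter q (J l)))" using j(1) by blast
  qed
  hence "card (?f ` set (filter p F)) \<le> card (\<Union>l\<le>u. ?f ` set (filter q (J l)))"
    by (intro card_mono) auto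
  also have "\<dots> \<le> (\<Sum>l\<le>u. card (?f ` set (filter q (J l))))" by (intro card_UN_le) auto
  also have "\<dots> \<le> (\<Sum>l\<le>u. length (filter q (J l)))"
    by (intro sum_mono) (meson card_image_le card_length finite_set le_trans)
  finally show ?thesis .
qed

lemma F_count: "length F \<le> (u + 1) * (5 * k * 2 ^ u)"
proof -
  have "length F \<le> (\<Sum>l\<le>u. length (J l))" using F_filter_count[of "\<lambda>_. True" "\<lambda>_. True"] by simp
  also have "\<dots> \<le> (\<Sum>l\<le>u. 5 * k * 2 ^ u)" by (intro sum_mono J_le)
  finally show ?thesis by simp
qed

text \<open>A neighbour is charged to the part of \<open>J l\<close> at whose start it begins. For
  \<open>l < u\<close> that part is a neighbour of the part of \<open>J (Suc l)\<close> containing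
  \<open>i\<close>, which has at most \<open>u\<close> neighbours in \<open>J l\<close>. For
  \<open>l = u\<close> no next level exists, but \<open>J u\<close> has at most \<open>5 * k\<close>
  parts in all.\<close>

lemma F_deg:
  assumes i: "i \<in> set F"
  shows "length (nbrs cs F i) \<le> u * u + 5 * k"
proof -
  have up: "\<exists>i'\<in>set (J l). vr i' = vr i \<and> set (el i) \<subseteq> set (el i')" if "l \<le> u" for l
    using F_below[OF i that] by blast
  have "length (nbrs cs F i) \<le> (\<Sum>l\<le>u. length (nbrs cs (J l) i))"
    by (rule F_filter_count) (rule bad_mono, auto)
  also have "\<dots> = (\<Sum>l<u. length (nbrs cs (J l) i)) + length (nbrs cs (J u) i)"
    by (simp add: lessThan_Suc_atMost[symmetric])
  also have "\<dots> \<le> (\<Sum>l<u. u) + 5 * k"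
  proof (intro add_mono sum_mono)
    fix l assume "l \<in> {..<u}"
    then obtain i' where i': "i' \<in> set (J (Suc l))" "vr i' = vr i" "set (el i) \<subseteq> set (el i')"
      using up[of "Suc l"] by auto
    have "length (nbrs cs (J l) i) = length (filter (bad True cs i) (nbrs cs (J l) i'))"
    proof -
      have "filter (bad True cs i) (nbrs cs (J l) i') = nbrs cs (J l) i"
        unfolding filter_filter by (rule filter_cong) (auto intro: bad_mono[OF _ i'(2,3) refl order_refl])
      thus ?thesis by simp
    qed
    also have "\<dots> \<le> length (nbrs cs (J l) i')" by (rule length_filter_le)
    also have "\<dots> \<le> u" by (rule J_deg[OF i'(1)])
    finally show "length (nbrs cs (J l) i) \<le> u" .
  next
    show "length (nbrs cs (J u) i) \<le> 5 * k" using J_last length_filter_le le_trans by blast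
  qed
  finally show ?thesis by simp
qed

sublocale refinement cs S F
proof
  show "distinct (map vr S)" by (rule distinct_S)
next
  fix j assume "j \<in> set F"
  then obtain i where i: "i \<in> set S" "vr j = vr i"
    "data_snd j \<in> set (greedy (okP n [] cs u (alls (parts (n div 2 ^ u) [] cs u [] S) S n cs u u) (vr i)) (el i))"
    by (auto simp: F_gparts mem_gparts)
  then obtain as bs where "el i = as @ el j @ bs" using greedy_block by blast
  thus "\<exists>i\<in>set S. vr j = vr i \<and> set (el j) \<subseteq> set (el i)" using i by (intro bexI[OF _ i(1)]) auto
next
  fix i v assume i: "i \<in> set S" "v \<in> set (el i)"
  hence "(vr i, v) \<in> set (plist S)" by (auto simp: set_plist)
  hence "(vr i, v) \<in> set (plist F)" by (simp add: F_gparts)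
  thus "\<exists>j\<in>set F. vr j = vr i \<and> v \<in> set (el j)" by (auto simp: set_plist)
qed

lemma ext_count:
  assumes "set (sp g) \<subseteq> set F" "length (sp g) \<le> k"
  shows "length (ext cs F g) \<le> k * (u * u + 5 * k)"
proof -
  have "length (ext cs F g) \<le> length (filter (anyb True cs (sp g)) F)"
  proof -
    have "length (filter (\<lambda>j. vr j \<notin> X \<and> p j) I) \<le> length (filter p I)" for X p I
      by (induction I) auto
    thus ?thesis by (simp add: ext_def)
  qed
  also have "\<dots> \<le> (\<Sum>i\<leftarrow>sp g. length (nbrs cs F i))"
  proof -
    have "length (filter (anyb True cs is) F) \<le> (\<Sum>i\<leftarrow>is. length (nbrs cs F i))" for "is"
    proof (induction "is")
      case (Cons i "is")
      have "length (filter (anyb True cs (i # is)) I) \<le> length (nbrs cs I i) + length (filter (anyb True cs is) I)" for I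
        by (induction I) (auto simp: anyb_def bad_commute)
      from this[of F] Cons show ?case by simp
    qed (simp add: anyb_def)
    thus ?thesis .
  qed
  also have "\<dots> \<le> length (sp g) * (u * u + 5 * k)"
    by (rule sum_list_le_const) (use assms(1) F_deg in auto)
  also have "\<dots> \<le> k * (u * u + 5 * k)" using assms(2) by (rule mult_right_mono) simp
  finally show ?thesis .
qed

text \<open>Only the starting block is chosen among all of \<open>F\<close>; each extension has a
  number of choices bounded through the degree, independently of \<open>length F\<close>.\<close>

lemma grow_count: "length (grow cs F t) \<le> length F * (1 + k * (u * u + 5 * k)) ^ t"
proof (induction t)
  case (Suc t)
  let ?L = "grow cs F t" and ?m = "1 + k * (u * u + 5 * k)"
  have "length (growl cs F ?L) = (\<Sum>g\<leftarrow>?L. length (ext cs F g) + 1)"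
    by (simp add: growl_def length_concat comp_def)
  also have "\<dots> \<le> length ?L * ?m"
  proof (rule sum_list_le_const)
    fix g assume "g \<in> set ?L"
    thus "length (ext cs F g) + 1 \<le> ?m" using ext_count[of g] grow_inv[of g cs F t] grow_length_le[of g t] by simp
  qed
  also have "\<dots> \<le> (length F * ?m ^ t) * ?m" using Suc by (rule mult_right_mono) simp
  finally show ?case by (simp only: grow_Suc power_Suc2 mult.assoc)
qed simp

end

text \<open>A crude bound with exponent \<open>t\<close> is good enough: covers add to the work
  within a recursion step, not to the number of recursive calls.\<close>

lemma cover_count: "length (cover cs G t) \<le> (1 + length G) ^ t"
proof (induction t)
  case (Suc t)
  have "length (covl cs G (cover cs G t)) = (\<Sum>a\<leftarrow>cover cs G t. length (cext cs G a) + 1)"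
    by (simp add: covl_def length_concat comp_def)
  also have "\<dots> \<le> length (cover cs G t) * (1 + length G)"
    by (rule sum_list_le_const) (simp add: cext_def)
  also have "\<dots> \<le> (1 + length G) ^ t * (1 + length G)" using Suc by (rule mult_right_mono) simp
  finally show ?case by (simp add: cover_Suc mult.commute)
qed simp

section \<open>Hulls of blocks under segment reversions, and staircase boundaries\<close>

section \<open>Segment reversions\<close>

definition pos :: "'a list \<Rightarrow> 'a \<Rightarrow> nat" where
  "pos D v = length (takeWhile (\<lambda>w. w \<noteq> v) D)"

lemma pos_less: "v \<in> set D \<Longrightarrow> pos D v < length D"
  unfolding pos_def by (induction D) auto

lemma nth_pos: "v \<in> set D \<Longrightarrow> D ! pos D v = v"
  unfolding pos_def by (induction D) auto

lemma pos_nth: "distinct D \<Longrightarrow> i < length D \<Longrightarrow> pos D (D ! i) = i"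
  by (metis nth_eq_iff_index_eq nth_mem nth_pos pos_less)

text \<open>Only the segment of \<open>v\<close> matters: it is reflected, and whatever lies before
  or after it stays there.\<close>

lemma segment_reversion_segment:
  assumes D: "distinct D" and rev: "segment_reversion D \<pi>" and v: "v \<in> set D"
  obtains lo hi where "lo \<le> pos D v" "pos D v \<le> hi" "hi < length D"
    "\<And>w. w \<in> set D \<Longrightarrow> lo \<le> pos D w \<Longrightarrow> pos D w \<le> hi \<Longrightarrow> pos D (\<pi> w) = lo + hi - pos D w"
    "\<And>w. w \<in> set D \<Longrightarrow> pos D w < lo \<Longrightarrow> pos D (\<pi> w) < lo"
    "\<And>w. w \<in> set D \<Longrightarrow> hi < pos D w \<Longrightarrow> hi < pos D (\<pi> w)"
proof -
  obtain bs where bs: "bs \<noteq> []" "hd bs = 1" "last bs = length D + 1" "sorted_wrt (<) bs"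
    and seg: "\<And>j x. Suc j < length bs \<Longrightarrow> bs ! j \<le> x \<Longrightarrow> x < bs ! Suc j \<Longrightarrow>
          \<pi> (elt D x) = elt D (bs ! Suc j - 1 - (x - bs ! j))"
    using rev unfolding segment_reversion_def by blast
  have b0: "bs ! 0 = 1" using bs by (simp add: hd_conv_nth)
  have bl: "bs ! (length bs - 1) = length D + 1" using bs by (simp add: last_conv_nth)
  have mono: "bs ! i < bs ! j" if "i < j" "j < length bs" for i j
    using bs(4) that by (simp add: sorted_wrt_iff_nth_less)
  have mono_le: "bs ! i \<le> bs ! j" if "i \<le> j" "j < length bs" for i j
    using mono[of i j] that by (cases "i = j") auto
  have b_ge: "1 \<le> bs ! i" if "i < length bs" for i using mono_le[of 0 i] that b0 by simp
  have b_le: "bs ! i \<le> length D + 1" if "i < length bs" for i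
    using mono_le[of i "length bs - 1"] that bl by simp
  have ex: "\<exists>j. Suc j < length bs \<and> bs ! j \<le> Suc (pos D w) \<and> Suc (pos D w) < bs ! Suc j" if "w \<in> set D" for w
  proof -
    let ?x = "Suc (pos D w)"
    define j where "j = Max {j. j < length bs \<and> bs ! j \<le> ?x}"
    have fin: "finite {j. j < length bs \<and> bs ! j \<le> ?x}" by simp
    have ne: "0 \<in> {j. j < length bs \<and> bs ! j \<le> ?x}" using bs(1) b0 by simp
    have j: "j < length bs" "bs ! j \<le> ?x" using Max_in[OF fin] ne unfolding j_def by blast+
    have "j \<noteq> length bs - 1" using j(2) bl pos_less[OF that] by auto
    hence Sj: "Suc j < length bs" using j(1) by simp
    moreover have "?x < bs ! Suc j"
    proof (rule ccontr)
      assume "\<not> ?x < bs ! Suc j"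
      hence "Suc j \<in> {j. j < length bs \<and> bs ! j \<le> ?x}" using Sj by simp
      from Max_ge[OF fin this] show False unfolding j_def by simp
    qed
    ultimately show ?thesis using j by blast
  qed
  \<comment> \<open>The reflection written as a sum, which avoids truncated subtraction. Two of the
    3 units come from 0-based positions, the third from the right boundary being exclusive.\<close>
  have im: "pos D (\<pi> w) + pos D w + 3 = bs ! j + bs ! Suc j"
    if "w \<in> set D" "Suc j < length bs" "bs ! j \<le> Suc (pos D w)" "Suc (pos D w) < bs ! Suc j" for w j
  proof -
    have "elt D (Suc (pos D w)) = w" using nth_pos[OF that(1)] by (simp add: elt_def)
    hence "\<pi> w = elt D (bs ! Suc j - 1 - (Suc (pos D w) - bs ! j))" using seg[OF that(2-4)] by simp
    hence e: "\<pi> w = D ! (bs ! Suc j - 1 - (Suc (pos D w) - bs ! j) - 1)" by (simp add: elt_def)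
    have "bs ! Suc j - 1 - (Suc (pos D w) - bs ! j) - 1 < length D"
      using b_le[of "Suc j"] b_ge[of j] that by linarith
    from pos_nth[OF D this] show ?thesis using e that b_ge[of j] by simp
  qed
  obtain j where j: "Suc j < length bs" "bs ! j \<le> Suc (pos D v)" "Suc (pos D v) < bs ! Suc j"
    using ex[OF v] by blast
  have bj: "1 \<le> bs ! j" "bs ! Suc j \<le> length D + 1" using b_ge[of j] b_le[of "Suc j"] j(1) by auto
  show thesis
  \<comment> \<open>The boundaries \<open>bs\<close> are 1-based with exclusive right end, while
    \<open>lo\<close> and \<open>hi\<close> are 0-based and inclusive.\<close>
  proof (rule that[of "bs ! j - 1" "bs ! Suc j - 2"])
    show "bs ! j - 1 \<le> pos D v" "pos D v \<le> bs ! Suc j - 2" "bs ! Suc j - 2 < length D" using j bj by auto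
  next
    fix w assume w: "w \<in> set D" "bs ! j - 1 \<le> pos D w" "pos D w \<le> bs ! Suc j - 2"
    have "pos D (\<pi> w) + pos D w + 3 = bs ! j + bs ! Suc j" by (rule im) (use w j bj in auto)
    thus "pos D (\<pi> w) = bs ! j - 1 + (bs ! Suc j - 2) - pos D w" using bj j by linarith
  next
    fix w assume w: "w \<in> set D" "pos D w < bs ! j - 1"
    obtain i where i: "Suc i < length bs" "bs ! i \<le> Suc (pos D w)" "Suc (pos D w) < bs ! Suc i"
      using ex[OF w(1)] by blast
    have "i < j" using w(2) i(2) mono_le[of j i] i(1) by (cases "i < j") auto
    hence "bs ! Suc i \<le> bs ! j" using mono_le[of "Suc i" j] j(1) by simp
    thus "pos D (\<pi> w) < bs ! j - 1" using im[OF w(1) i] i bj by linarith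
  next
    fix w assume w: "w \<in> set D" "bs ! Suc j - 2 < pos D w"
    obtain i where i: "Suc i < length bs" "bs ! i \<le> Suc (pos D w)" "Suc (pos D w) < bs ! Suc i"
      using ex[OF w(1)] by blast
    have "j < i" using w(2) i(3) mono_le[of "Suc i" "Suc j"] j(1) by (cases "j < i") auto
    hence "bs ! Suc j \<le> bs ! i" using mono_le[of "Suc j" i] i(1) by simp
    thus "bs ! Suc j - 2 < pos D (\<pi> w)" using im[OF w(1) i] i bj j by linarith
  qed
qed

text \<open>
  The blocks of \<open>X\<close> whose hull in the order given by \<open>f\<close> contains \<open>v\<close> all meet a set of at most
  \<open>c\<close> elements.
\<close>

definition hull_bounded :: "nat \<Rightarrow> 'a list \<Rightarrow> ('a \<Rightarrow> nat) \<Rightarrow> bool" where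
  "hull_bounded c X f \<longleftrightarrow> (\<forall>v\<in>set X. \<exists>W. finite W \<and> card W \<le> c \<and>
     (\<forall>as P bs. X = as @ P @ bs \<longrightarrow> (\<exists>p\<in>set P. \<exists>q\<in>set P. f p \<le> f v \<and> f v \<le> f q) \<longrightarrow> W \<inter> set P \<noteq> {}))"

lemma compose_snoc: "compose (ps @ [p]) = p \<circ> compose ps"
  by (simp add: compose_def)

lemma compose_permutes: "(\<And>p. p \<in> set ps \<Longrightarrow> p permutes A) \<Longrightarrow> compose ps permutes A"
proof (induction ps rule: rev_induct)
  case Nil
  show ?case by (simp add: compose_def permutes_id[unfolded id_def] id_def)
next
  case (snoc p ps)
  thus ?case unfolding compose_snoc by (intro permutes_compose) auto
qed

text \<open>Without reversions a block is its own hull, so \<open>{v}\<close> suffices. One more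
  reversion triples the set: if \<open>v\<close> lies in the new hull of a block, then the old hull
  contains \<open>v\<close> or one of the two ends of the segment of \<open>v\<close>.\<close>

lemma hull_bounded_compose:
  assumes D: "distinct D"
  shows "(\<And>p. p \<in> set ps \<Longrightarrow> segment_reversion D p) \<Longrightarrow> hull_bounded (3 ^ length ps) D (\<lambda>v. pos D (compose ps v))"
proof (induction ps rule: rev_induct)
  case Nil
  show ?case unfolding hull_bounded_def
  proof (intro ballI exI conjI allI impI)
    fix v as P bs
    assume v: "v \<in> set D" and P: "D = as @ P @ bs"
      and "\<exists>p\<in>set P. \<exists>q\<in>set P. pos D (compose [] p) \<le> pos D (compose [] v) \<and> pos D (compose [] v) \<le> pos D (compose [] q)"
    then obtain p q where pq: "p \<in> set P" "q \<in> set P" "pos D p \<le> pos D v" "pos D v \<le> pos D q"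
      by (auto simp: compose_def)
    obtain i where i: "i < length P" "p = P ! i" using pq(1) by (auto simp: in_set_conv_nth)
    obtain j where j: "j < length P" "q = P ! j" using pq(2) by (auto simp: in_set_conv_nth)
    have "D ! (length as + i) = p" "D ! (length as + j) = q"
      using i j P by (auto simp: nth_append)
    hence "pos D p = length as + i" "pos D q = length as + j"
      using pos_nth[OF D, of "length as + i"] pos_nth[OF D, of "length as + j"] i j P by auto
    hence "D ! pos D v = P ! (pos D v - length as)" "pos D v - length as < length P"
      using pq(3,4) j P by (auto simp: nth_append)
    hence "v \<in> set P" using nth_pos[OF v] by (metis nth_mem)
    thus "{v} \<inter> set P \<noteq> {}" by blast
  qed auto
next
  case (snoc \<pi> ps)
  let ?\<rho> = "compose ps"
  let ?f = "\<lambda>v. pos D (?\<rho> v)"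
  have IH: "hull_bounded (3 ^ length ps) D ?f" using snoc by simp
  have \<pi>: "segment_reversion D \<pi>" using snoc.prems by simp
  have "p permutes set D" if "p \<in> set ps" for p
    using snoc.prems that by (auto simp: segment_reversion_def)
  hence \<rho>: "?\<rho> permutes set D" by (rule compose_permutes)
  have \<rho>_in: "?\<rho> v \<in> set D" if "v \<in> set D" for v using permutes_in_image[OF \<rho>] that by simp
  have \<rho>_pre: "\<exists>w\<in>set D. ?\<rho> w = v" if "v \<in> set D" for v
    using permutes_surj[OF \<rho>] permutes_in_image[OF \<rho>] that by (metis surjD)
  show ?case unfolding hull_bounded_def
  proof
    fix v assume v: "v \<in> set D"
    obtain lo hi where seg: "lo \<le> ?f v" "?f v \<le> hi" "hi < length D"
      "\<And>w. w \<in> set D \<Longrightarrow> lo \<le> pos D w \<Longrightarrow> pos D w \<le> hi \<Longrightarrow> pos D (\<pi> w) = lo + hi - pos D w"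
      "\<And>w. w \<in> set D \<Longrightarrow> pos D w < lo \<Longrightarrow> pos D (\<pi> w) < lo"
      "\<And>w. w \<in> set D \<Longrightarrow> hi < pos D w \<Longrightarrow> hi < pos D (\<pi> w)"
      using segment_reversion_segment[OF D \<pi> \<rho>_in[OF v]] by metis
    \<comment> \<open>\<open>a\<close> and \<open>b\<close> are the elements that the earlier
      reversions put at the two ends of the segment of \<open>v\<close>.\<close>
    obtain a where a: "a \<in> set D" "?f a = lo"
      using \<rho>_pre[of "D ! lo"] pos_nth[OF D, of lo] seg(1-3) by (metis nth_mem le_trans le_less_trans)
    obtain b where b: "b \<in> set D" "?f b = hi"
      using \<rho>_pre[of "D ! hi"] pos_nth[OF D, of hi] seg(3) by (metis nth_mem)
    obtain W1 where W1: "finite W1" "card W1 \<le> 3 ^ length ps"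
      "\<And>as P bs p q. D = as @ P @ bs \<Longrightarrow> p \<in> set P \<Longrightarrow> q \<in> set P \<Longrightarrow> ?f p \<le> ?f v \<Longrightarrow> ?f v \<le> ?f q \<Longrightarrow> W1 \<inter> set P \<noteq> {}"
      using IH v unfolding hull_bounded_def by meson
    obtain W2 where W2: "finite W2" "card W2 \<le> 3 ^ length ps"
      "\<And>as P bs p q. D = as @ P @ bs \<Longrightarrow> p \<in> set P \<Longrightarrow> q \<in> set P \<Longrightarrow> ?f p \<le> ?f a \<Longrightarrow> ?f a \<le> ?f q \<Longrightarrow> W2 \<inter> set P \<noteq> {}"
      using IH a(1) unfolding hull_bounded_def by meson
    obtain W3 where W3: "finite W3" "card W3 \<le> 3 ^ length ps"
      "\<And>as P bs p q. D = as @ P @ bs \<Longrightarrow> p \<in> set P \<Longrightarrow> q \<in> set P \<Longrightarrow> ?f p \<le> ?f b \<Longrightarrow> ?f b \<le> ?f q \<Longrightarrow> W3 \<inter> set P \<noteq> {}"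
      using IH b(1) unfolding hull_bounded_def by meson
    let ?W = "W1 \<union> W2 \<union> W3"
    have "card ?W \<le> card W1 + card W2 + card W3"
      using card_Un_le[of "W1 \<union> W2" W3] card_Un_le[of W1 W2] by linarith
    hence card: "card ?W \<le> 3 ^ length (ps @ [\<pi>])" using W1(2) W2(2) W3(2) by simp
    have "?W \<inter> set P \<noteq> {}"
      if P: "D = as @ P @ bs" and pq: "p \<in> set P" "q \<in> set P"
        and le: "pos D (\<pi> (?\<rho> p)) \<le> pos D (\<pi> (?\<rho> v))" "pos D (\<pi> (?\<rho> v)) \<le> pos D (\<pi> (?\<rho> q))" for as P bs p q
    proof -
      have D: "?\<rho> p \<in> set D" "?\<rho> q \<in> set D" "?\<rho> v \<in> set D" using P pq v \<rho>_in by auto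
      have img: "lo \<le> pos D (\<pi> (?\<rho> v))" "pos D (\<pi> (?\<rho> v)) \<le> hi" using seg(4)[OF D(3) seg(1,2)] seg(1,2) by auto
      consider "?f p < lo" | "lo \<le> ?f p" "?f p \<le> hi" | "hi < ?f p" by linarith
      thus ?thesis
      proof cases
        case 1
        have "lo \<le> ?f q" using seg(5)[OF D(2)] img le(2) by force
        hence "W2 \<inter> set P \<noteq> {}" using W2(3)[OF P pq] 1 a(2) by simp
        thus ?thesis by blast
      next
        case 2
        have q: "lo \<le> ?f q" using seg(5)[OF D(2)] img le(2) by force
        show ?thesis
        proof (cases "?f q \<le> hi")
          case True
          \<comment> \<open>Inside the segment the order is reversed, so \<open>p\<close> and
            \<open>q\<close> exchange their roles.\<close>
          have "?f v \<le> ?f p" "?f q \<le> ?f v"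
            using seg(4)[OF D(1) 2] seg(4)[OF D(2) q True] seg(4)[OF D(3) seg(1,2)] le 2 q True seg(1,2) by linarith+
          hence "W1 \<inter> set P \<noteq> {}" using W1(3)[OF P pq(2,1)] by simp
          thus ?thesis by blast
        next
          case False
          hence "W3 \<inter> set P \<noteq> {}" using W3(3)[OF P pq] 2 b(2) by simp
          thus ?thesis by blast
        qed
      next
        case 3
        hence False using seg(6)[OF D(1)] img le(1) by linarith
        thus ?thesis ..
      qed
    qed
    thus "\<exists>W. finite W \<and> card W \<le> 3 ^ length (ps @ [\<pi>]) \<and>
      (\<forall>as P bs. D = as @ P @ bs \<longrightarrow> (\<exists>p\<in>set P. \<exists>q\<in>set P.
         pos D (compose (ps @ [\<pi>]) p) \<le> pos D (compose (ps @ [\<pi>]) v) \<and>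
         pos D (compose (ps @ [\<pi>]) v) \<le> pos D (compose (ps @ [\<pi>]) q)) \<longrightarrow> W \<inter> set P \<noteq> {})"
      using card W1(1) W2(1) W3(1) unfolding compose_snoc
      by (intro exI[of _ ?W] conjI allI impI) (auto simp: comp_def)
  qed
qed

text \<open>\<open>W A\<close> meets every block whose hull contains the last element of
  \<open>A\<close> in the order given by \<open>f\<close>. The maximum is not named because
  \<open>A\<close> may have no element in \<open>X\<close>.\<close>

definition hits_max :: "nat \<Rightarrow> 'a list \<Rightarrow> ('a \<Rightarrow> nat) \<Rightarrow> ('a set \<Rightarrow> 'a set) \<Rightarrow> bool" where
  "hits_max c X f W \<longleftrightarrow> (\<forall>A. finite (W A) \<and> card (W A) \<le> c \<and> (\<forall>as P bs p q. X = as @ P @ bs \<longrightarrow>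
    p \<in> set P \<longrightarrow> q \<in> set P \<longrightarrow> (\<exists>a\<in>A \<inter> set X. f p \<le> f a) \<longrightarrow> (\<forall>a\<in>A \<inter> set X. f a \<le> f q) \<longrightarrow>
    W A \<inter> set P \<noteq> {}))"

lemma hits_maxD:
  assumes "hits_max c X f W" "X = as @ P @ bs" "p \<in> set P" "q \<in> set P" "a \<in> A" "a \<in> set X" "f p \<le> f a"
    "\<And>a. a \<in> A \<Longrightarrow> a \<in> set X \<Longrightarrow> f a \<le> f q"
  shows "W A \<inter> set P \<noteq> {}"
  using assms unfolding hits_max_def by (metis (no_types, lifting) IntD1 IntD2 IntI)

lemma hull_bounded_max:
  assumes "hull_bounded c X f"
  shows "\<exists>W. hits_max c X f W"
  unfolding hits_max_def
proof (intro choice allI)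
  fix A
  show "\<exists>W. finite W \<and> card W \<le> c \<and> (\<forall>as P bs p q. X = as @ P @ bs \<longrightarrow>
    p \<in> set P \<longrightarrow> q \<in> set P \<longrightarrow> (\<exists>a\<in>A \<inter> set X. f p \<le> f a) \<longrightarrow> (\<forall>a\<in>A \<inter> set X. f a \<le> f q) \<longrightarrow>
    W \<inter> set P \<noteq> {})"
  proof (cases "A \<inter> set X = {}")
    case False
    hence "Max (f ` (A \<inter> set X)) \<in> f ` (A \<inter> set X)" by (intro Max_in) auto
    then obtain v where v: "v \<in> A \<inter> set X" "f v = Max (f ` (A \<inter> set X))" by auto
    hence max: "\<forall>a\<in>A \<inter> set X. f a \<le> f v" by simp
    obtain W where W: "finite W" "card W \<le> c"
      "\<And>as P bs p q. X = as @ P @ bs \<Longrightarrow> p \<in> set P \<Longrightarrow> q \<in> set P \<Longrightarrow> f p \<le> f v \<Longrightarrow> f v \<le> f q \<Longrightarrow> W \<inter> set P \<noteq> {}"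
      using assms v(1) unfolding hull_bounded_def by (meson IntD2)
    show ?thesis
    proof (intro exI[of _ W] conjI W(1,2) allI impI)
      fix as P bs p q
      assume *: "X = as @ P @ bs" "p \<in> set P" "q \<in> set P" "\<exists>a\<in>A \<inter> set X. f p \<le> f a" "\<forall>a\<in>A \<inter> set X. f a \<le> f q"
      show "W \<inter> set P \<noteq> {}" by (rule W(3)[OF *(1-3)]) (use *(4,5) v(1) max in \<open>auto intro: le_trans\<close>)
    qed
  qed (auto intro!: exI[of _ "{}"])
qed

text \<open>\<open>W1\<close> depends on \<open>P\<close> alone and \<open>W2\<close> on
  \<open>Q\<close> alone. This allows all partners of one block to be counted by a single
  set.\<close>

definition crossing_sets ::
    "nat \<Rightarrow> 'a list \<Rightarrow> 'b list \<Rightarrow> ('a \<Rightarrow> 'b \<Rightarrow> bool) \<Rightarrow> ('a list \<Rightarrow> 'b set) \<Rightarrow> ('b list \<Rightarrow> 'a set) \<Rightarrow> bool" where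
  "crossing_sets c X Y R W1 W2 \<longleftrightarrow> (\<forall>P. finite (W1 P) \<and> card (W1 P) \<le> c) \<and> (\<forall>Q. finite (W2 Q) \<and> card (W2 Q) \<le> c) \<and>
    (\<forall>as P bs as' Q bs'. X = as @ P @ bs \<longrightarrow> Y = as' @ Q @ bs' \<longrightarrow>
      (\<exists>p\<in>set P. \<exists>q\<in>set Q. R p q) \<longrightarrow> (\<exists>p\<in>set P. \<exists>q\<in>set Q. \<not> R p q) \<longrightarrow>
      W1 P \<inter> set Q \<noteq> {} \<or> 2 \<le> length P \<and> W2 Q \<inter> set P \<noteq> {})"

text \<open>
  The boundary of a downwards-closed relation is a staircase.  If it crosses \<open>P \<times> Q\<close>, then either
  the last column element related to all of \<open>P\<close> lies in the hull of \<open>Q\<close>, or the last row element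
  related to some element of \<open>Q\<close> lies in the hull of \<open>P\<close>.
\<close>

lemma staircase_crossing:
  assumes X: "hull_bounded c X f" and Y: "hull_bounded c Y g"
    and mono: "\<And>a a' b b'. a \<in> set X \<Longrightarrow> a' \<in> set X \<Longrightarrow> b \<in> set Y \<Longrightarrow> b' \<in> set Y \<Longrightarrow>
      R a b \<Longrightarrow> f a' \<le> f a \<Longrightarrow> g b' \<le> g b \<Longrightarrow> R a' b'"
  shows "\<exists>W1 W2. crossing_sets c X Y R W1 W2"
proof -
  obtain Wx Wy where Wx: "hits_max c X f Wx" and Wy: "hits_max c Y g Wy"
    using hull_bounded_max X Y by metis
  let ?A = "\<lambda>P. {v. \<forall>p\<in>set P. R p v}" and ?B = "\<lambda>Q. {v. \<exists>q\<in>set Q. R v q}"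
  have cross: "Wy (?A P) \<inter> set Q \<noteq> {} \<or> 2 \<le> length P \<and> Wx (?B Q) \<inter> set P \<noteq> {}"
    if P: "X = as @ P @ bs" and Q: "Y = as' @ Q @ bs'" and p: "p \<in> set P" and q: "q \<in> set Q" and R: "R p q"
      and p': "p' \<in> set P" and q': "q' \<in> set Q" and nR: "\<not> R p' q'" for as P bs as' Q bs' p q p' q'
  proof -
    have inX: "a \<in> set X" if "a \<in> set P" for a using P that by auto
    have inY: "b \<in> set Y" if "b \<in> set Q" for b using Q that by auto
    show ?thesis
    proof (cases "\<exists>b\<in>set Q. \<forall>a\<in>set P. R a b")
      case True
      \<comment> \<open>The last element of \<open>Y\<close> related to all of \<open>P\<close> is
        not before \<open>b\<close>, and not after \<open>q'\<close>: otherwise \<open>p'\<close>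
        would be related to \<open>q'\<close> by downward closure.\<close>
      then obtain b where b: "b \<in> set Q" "b \<in> ?A P" by blast
      have "g v \<le> g q'" if "v \<in> ?A P" "v \<in> set Y" for v
      proof (rule ccontr)
        assume "\<not> g v \<le> g q'"
        moreover have "R p' v" using that(1) p' by blast
        ultimately show False using mono[of p' p' v q'] that(2) nR inX[OF p'] inY[OF q'] by auto
      qed
      hence "Wy (?A P) \<inter> set Q \<noteq> {}" by (rule hits_maxD[OF Wy Q b(1) q' b(2) inY[OF b(1)] order_refl])
      thus ?thesis ..
    next
      case False
      then obtain a where a: "a \<in> set P" "\<not> R a q" using q by blast
      obtain m where m: "m \<in> set P" "\<forall>b\<in>set P. f b \<le> f m"
      proof -
        have "Max (f ` set P) \<in> f ` set P" using p by (intro Max_in) auto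
        then obtain m where "m \<in> set P" "f m = Max (f ` set P)" by auto
        thus thesis using that by auto
      qed
      \<comment> \<open>No element of \<open>Q\<close> is related to all of \<open>P\<close>, so
        each \<open>v\<close> related to some \<open>b\<close> in \<open>Q\<close> comes no later
        than an element of \<open>P\<close> unrelated to \<open>b\<close>, and hence no later than
        \<open>m\<close>.\<close>
      have "f v \<le> f m" if v: "v \<in> ?B Q" "v \<in> set X" for v
      proof -
        obtain b where b: "b \<in> set Q" "R v b" using v by blast
        obtain a where a: "a \<in> set P" "\<not> R a b" using False b(1) by blast
        have "f v \<le> f a"
        proof (rule ccontr)
          assume "\<not> f v \<le> f a"
          thus False using mono[of v a b b] a(2) b(2) v(2) inX[OF a(1)] inY[OF b(1)] by auto
        qed
        thus ?thesis using m(2) a(1) le_trans by blast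
      qed
      moreover have "p \<in> ?B Q" using R q by blast
      ultimately have "Wx (?B Q) \<inter> set P \<noteq> {}" by (intro hits_maxD[OF Wx P p m(1) _ inX[OF p] order_refl])
      moreover have "a \<noteq> p" using a R by auto
      hence "2 \<le> length P" using p a(1) by (cases P; cases "tl P") auto
      ultimately show ?thesis by blast
    qed
  qed
  have "crossing_sets c X Y R (\<lambda>P. Wy (?A P)) (\<lambda>Q. Wx (?B Q))"
    unfolding crossing_sets_def
  proof (intro conjI allI impI)
    fix as P bs as' Q bs'
    assume "X = as @ P @ bs" "Y = as' @ Q @ bs'" "\<exists>p\<in>set P. \<exists>q\<in>set Q. R p q" "\<exists>p\<in>set P. \<exists>q\<in>set Q. \<not> R p q"
    thus "Wy (?A P) \<inter> set Q \<noteq> {} \<or> 2 \<le> length P \<and> Wx (?B Q) \<inter> set P \<noteq> {}" using cross by (elim bexE)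
  qed (use Wx Wy in \<open>auto simp: hits_max_def\<close>)
  thus ?thesis by blast
qed

section \<open>Encoded constraints have staircase boundaries\<close>

section \<open>Encoded instances\<close>

lemma enc_nat_0 [simp]: "enc_nat 0 = Atom"
  by (simp add: enc_nat.simps)

lemma enc_nat_eq_Atom [simp]: "enc_nat n = Atom \<longleftrightarrow> n = 0"
  by (subst enc_nat.simps) auto

lemma enc_nat_pos: "n \<noteq> 0 \<Longrightarrow> enc_nat n = Pair (enc_bool (odd n)) (enc_nat (n div 2))"
  by (subst enc_nat.simps) simp

lemma enc_nat_inject [simp]: "enc_nat m = enc_nat n \<longleftrightarrow> m = n"
proof (induction m arbitrary: n rule: less_induct)
  case (less m)
  show ?case
  proof (cases "m = 0 \<or> n = 0")
    case True
    thus ?thesis using enc_nat_eq_Atom by (metis enc_nat_0)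
  next
    case False
    have "odd m = odd n \<Longrightarrow> m div 2 = n div 2 \<Longrightarrow> m = n"
      by (metis odd_two_times_div_two_succ even_two_times_div_two)
    thus ?thesis using False less[of "m div 2" "n div 2"]
      by (auto simp: enc_nat_pos enc_bool_def split: if_splits)
  qed
qed

lemma inc_enc_nat: "inc (enc_nat n) = enc_nat (Suc n)"
proof (induction n rule: less_induct)
  case (less n)
  show ?case
  proof (cases "n = 0")
    case True
    thus ?thesis by (simp add: enc_nat_pos[of "Suc 0"] enc_bool_def)
  next
    case False
    show ?thesis
    proof (cases "odd n")
      case True
      have "Suc n div 2 = Suc (n div 2)" using True by presburger
      thus ?thesis using True False less[of "n div 2"] by (simp add: enc_nat_pos enc_bool_def)
    next
      case even: False
      have "Suc n div 2 = n div 2" using even by presburger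
      thus ?thesis using even False by (simp add: enc_nat_pos enc_bool_def)
    qed
  qed
qed

lemma lab_enc: "lab (map e Ds) (enc_nat k) = map (\<lambda>i. Pair (enc_nat (k + i)) (e (Ds ! i))) [0..<length Ds]"
proof (induction Ds arbitrary: k)
  case (Cons D Ds)
  have "map (\<lambda>i. Pair (enc_nat (Suc k + i)) (e (Ds ! i))) [0..<length Ds] =
      map (\<lambda>i. Pair (enc_nat (k + i)) (e ((D # Ds) ! i))) [Suc 0..<Suc (length Ds)]"
    by (simp add: map_Suc_upt[symmetric] comp_def del: upt_Suc)
  thus ?case using Cons[of "Suc k"]
    by (simp add: inc_enc_nat upt_conv_Cons[of 0 "Suc (length Ds)"] del: upt_Suc)
qed simp

lemma look_map:
  assumes "distinct is" "i \<in> set is"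
  shows "look (map (\<lambda>i. Pair (enc_nat i) (f i)) is) (enc_nat i) = f i"
  using assms by (induction "is") auto

lemma tab_enc: "a \<in> set D \<Longrightarrow> tab (map enc_nat D) (ls (map enc_nat (map p D))) (enc_nat a) = enc_nat (p a)"
  by (induction D) auto

lemma tabs_enc:
  assumes "\<And>p. p \<in> set ps \<Longrightarrow> p permutes set D" "a \<in> set D"
  shows "tabs (map (\<lambda>p. ls (map enc_nat (map p D))) ps) (map enc_nat D) (enc_nat a) = enc_nat (compose ps a)"
  using assms
proof (induction ps arbitrary: a)
  case (Cons p ps)
  have "p a \<in> set D" using Cons.prems by (simp add: permutes_in_image)
  moreover have "compose (p # ps) a = compose ps (p a)"
  proof -
    have "fold (\<circ>) ps q = fold (\<circ>) ps id \<circ> q" for q :: "nat \<Rightarrow> nat"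
    proof (induction ps rule: rev_induct)
      case (snoc x xs)
      thus ?case by (simp add: comp_assoc)
    qed simp
    from this[of p] show ?thesis by (simp add: compose_def)
  qed
  ultimately show ?case using Cons by (simp add: tab_enc del: map_map)
qed (simp add: compose_def)

definition enc_cons :: "nat list list \<Rightarrow> aux_constraint \<Rightarrow> data" where
  "enc_cons Ds C = Pair (Pair (ls (map enc_nat (Ds ! var1 C))) (ls (map enc_nat (Ds ! var2 C)))) (enc_constraint Ds C)"

lemma enc_cons_simps [simp]:
  "cv1 (enc_cons Ds C) = enc_nat (var1 C)" "cv2 (enc_cons Ds C) = enc_nat (var2 C)"
  by (simp_all add: enc_cons_def enc_constraint_def)

text \<open>Reversions map their domain to itself, so no table lookup misses, and
  \<open>enc_nat\<close> is injective, so membership in the encoded base relation is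
  faithful.\<close>

lemma rel_enc_cons:
  assumes C: "rel_segment_rep (Ds ! var1 C) (Ds ! var2 C) k (crep C) (crel C)"
    and a: "a \<in> set (Ds ! var1 C)" and b: "b \<in> set (Ds ! var2 C)"
  shows "rel (enc_cons Ds C) (enc_nat a) (enc_nat b) \<longleftrightarrow>
      (compose (revs1 (crep C)) a, compose (revs2 (crep C)) b) \<in> base_rel (crep C)"
    and "rel (enc_cons Ds C) (enc_nat a) (enc_nat b) \<longleftrightarrow> (a, b) \<in> crel C"
proof -
  let ?D1 = "Ds ! var1 C" and ?D2 = "Ds ! var2 C" and ?S = "crep C"
  have p1: "p permutes set ?D1" if "p \<in> set (revs1 ?S)" for p
    using C that by (auto simp: rel_segment_rep_def perm_segment_rep_def segment_reversion_def)
  have p2: "p permutes set ?D2" if "p \<in> set (revs2 ?S)" for p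
    using C that by (auto simp: rel_segment_rep_def perm_segment_rep_def segment_reversion_def)
  have base: "base_rel ?S \<subseteq> set ?D1 \<times> set ?D2" using C by (simp add: rel_segment_rep_def)
  have crel: "(a, b) \<in> crel C \<longleftrightarrow> (compose (revs1 ?S) a, compose (revs2 ?S) b) \<in> base_rel ?S"
    using C a b by (auto simp: rel_segment_rep_def perm_segment_rep_def)
  have t1: "tabs (map (\<lambda>p. ls (map enc_nat (map p ?D1))) (revs1 ?S)) (map enc_nat ?D1) (enc_nat a) = enc_nat (compose (revs1 ?S) a)"
    by (rule tabs_enc[OF p1 a])
  have t2: "tabs (map (\<lambda>p. ls (map enc_nat (map p ?D2))) (revs2 ?S)) (map enc_nat ?D2) (enc_nat b) = enc_nat (compose (revs2 ?S) b)"
    by (rule tabs_enc[OF p2 b])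
  have "rel (enc_cons Ds C) (enc_nat a) (enc_nat b) \<longleftrightarrow>
     Pair (enc_nat (compose (revs1 ?S) a)) (enc_nat (compose (revs2 ?S) b)) \<in>
      set (map (enc_prod enc_nat enc_nat) (filter (\<lambda>p. p \<in> base_rel ?S) (List.product ?D1 ?D2)))"
    using t1 t2 by (simp add: rel_def enc_cons_def enc_constraint_def enc_segment_rep_def enc_reversions_def
        enc_list_ls comp_def del: map_map)
  also have "\<dots> \<longleftrightarrow> (compose (revs1 ?S) a, compose (revs2 ?S) b) \<in> base_rel ?S"
  proof
    assume b: "(compose (revs1 ?S) a, compose (revs2 ?S) b) \<in> base_rel ?S"
    hence "(compose (revs1 ?S) a, compose (revs2 ?S) b) \<in> set (filter (\<lambda>p. p \<in> base_rel ?S) (List.product ?D1 ?D2))"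
      using base by auto
    from imageI[OF this, of "enc_prod enc_nat enc_nat"] show "Pair (enc_nat (compose (revs1 ?S) a)) (enc_nat (compose (revs2 ?S) b)) \<in>
      set (map (enc_prod enc_nat enc_nat) (filter (\<lambda>p. p \<in> base_rel ?S) (List.product ?D1 ?D2)))"
      by (simp only: set_map enc_prod_def fst_conv snd_conv)
  qed (auto simp: enc_prod_def)
  finally show "rel (enc_cons Ds C) (enc_nat a) (enc_nat b) \<longleftrightarrow>
      (compose (revs1 (crep C)) a, compose (revs2 (crep C)) b) \<in> base_rel (crep C)" .
  thus "rel (enc_cons Ds C) (enc_nat a) (enc_nat b) \<longleftrightarrow> (a, b) \<in> crel C" using crel by simp
qed

text \<open>Hulls only involve positions and carry over along an injective renaming; a block is
  pulled back by taking the same positions.\<close>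

lemma hull_bounded_map:
  assumes hull: "hull_bounded c D f" and e: "\<And>x. x \<in> set D \<Longrightarrow> d (e x) = x"
  shows "hull_bounded c (map e D) (\<lambda>x. f (d x))"
  unfolding hull_bounded_def
proof
  fix v assume "v \<in> set (map e D)"
  then obtain v0 where v: "v0 \<in> set D" "v = e v0" by auto
  obtain W where W: "finite W" "card W \<le> c"
    "\<And>as P bs p q. D = as @ P @ bs \<Longrightarrow> p \<in> set P \<Longrightarrow> q \<in> set P \<Longrightarrow> f p \<le> f v0 \<Longrightarrow> f v0 \<le> f q \<Longrightarrow> W \<inter> set P \<noteq> {}"
    using hull v(1) unfolding hull_bounded_def by meson
  have "(e ` W) \<inter> set P \<noteq> {}"
    if P: "map e D = as @ P @ bs" and pq: "p \<in> set P" "q \<in> set P" "f (d p) \<le> f (d v)" "f (d v) \<le> f (d q)" for as P bs p q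
  proof -
    define as' where "as' = take (length as) D"
    define P' where "P' = take (length P) (drop (length as) D)"
    define bs' where "bs' = drop (length P) (drop (length as) D)"
    have D: "D = as' @ P' @ bs'" unfolding as'_def P'_def bs'_def by (simp only: append_take_drop_id)
    have "map e P' = take (length P) (drop (length as) (as @ P @ bs))"
      unfolding P'_def P[symmetric] by (simp add: take_map drop_map)
    hence PP: "P = map e P'" by simp
    obtain p0 q0 where pq0: "p0 \<in> set P'" "q0 \<in> set P'" "p = e p0" "q = e q0" using pq PP by auto
    have "d p = p0" "d q = q0" "d v = v0" using pq0 v D e by auto
    hence "W \<inter> set P' \<noteq> {}" using W(3)[OF D pq0(1,2)] pq(3,4) by simp
    thus ?thesis using PP by auto
  qed
  thus "\<exists>W. finite W \<and> card W \<le> c \<and> (\<forall>as P bs. map e D = as @ P @ bs \<longrightarrow>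
      (\<exists>p\<in>set P. \<exists>q\<in>set P. f (d p) \<le> f (d v) \<and> f (d v) \<le> f (d q)) \<longrightarrow> W \<inter> set P \<noteq> {})"
    using W(1,2) card_image_le[OF W(1), of e] by (intro exI[of _ "e ` W"]) (auto intro: le_trans)
qed

lemma hull_bounded_mono: "hull_bounded c X f \<Longrightarrow> c \<le> c' \<Longrightarrow> hull_bounded c' X f"
  unfolding hull_bounded_def by (meson le_trans)

definition dec_nat :: "data \<Rightarrow> nat" where
  "dec_nat d = (THE n. enc_nat n = d)"

lemma dec_enc_nat [simp]: "dec_nat (enc_nat n) = n"
  by (simp add: dec_nat_def)

text \<open>\<open>b\<close> is the orientation in which the constraint \<open>C\<close> is read.\<close>

definition stair :: "(data \<Rightarrow> data list) \<Rightarrow> nat \<Rightarrow> data \<Rightarrow> (bool \<Rightarrow> data list \<Rightarrow> data set) \<Rightarrow> (bool \<Rightarrow> data list \<Rightarrow> data set) \<Rightarrow> bool" where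
  "stair dm c C W1 W2 \<longleftrightarrow>
     (\<forall>b P. finite (W1 b P) \<and> card (W1 b P) \<le> c \<and> finite (W2 b P) \<and> card (W2 b P) \<le> c) \<and>
     (\<forall>b i j. blk dm i \<longrightarrow> blk dm j \<longrightarrow> (if b then bad1 True C i j else bad1 True C j i) \<longrightarrow>
       W1 b (el i) \<inter> set (el j) \<noteq> {} \<or> 2 \<le> length (el i) \<and> W2 b (el j) \<inter> set (el i) \<noteq> {})"

lemma dom_le_pos:
  assumes "x \<in> set D" "y \<in> set D" "pos D x \<le> pos D y"
  shows "dom_le D x y"
  unfolding dom_le_def elt_def
  using assms pos_less[OF assms(2)] nth_pos[OF assms(1)] nth_pos[OF assms(2)]
  by (intro exI[of _ "Suc (pos D x)"] exI[of _ "Suc (pos D y)"]) auto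

text \<open>In the orders obtained after the reversions the relation is downwards closed. The
  staircase argument is applied to the relation and to its converse, as either block may take the
  role of \<open>P\<close>.\<close>

lemma stair_enc_cons:
  assumes D: "distinct (Ds ! var1 C)" "distinct (Ds ! var2 C)"
    and C: "rel_segment_rep (Ds ! var1 C) (Ds ! var2 C) k (crep C) (crel C)"
    and dm: "dm (enc_nat (var1 C)) = map enc_nat (Ds ! var1 C)" "dm (enc_nat (var2 C)) = map enc_nat (Ds ! var2 C)"
    and c: "3 ^ depth (crep C) \<le> c"
  shows "\<exists>W1 W2. stair dm c (enc_cons Ds C) W1 W2"
proof -
  let ?D1 = "Ds ! var1 C" and ?D2 = "Ds ! var2 C" and ?S = "crep C"
  let ?X = "map enc_nat ?D1" and ?Y = "map enc_nat ?D2" and ?R = "rel (enc_cons Ds C)"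
  let ?p1 = "compose (revs1 ?S)" and ?p2 = "compose (revs2 ?S)"
  let ?f = "\<lambda>d. pos ?D1 (?p1 (dec_nat d))" and ?g = "\<lambda>d. pos ?D2 (?p2 (dec_nat d))"
  have r1: "segment_reversion ?D1 p" if "p \<in> set (revs1 ?S)" for p
    using C that by (auto simp: rel_segment_rep_def perm_segment_rep_def)
  have r2: "segment_reversion ?D2 p" if "p \<in> set (revs2 ?S)" for p
    using C that by (auto simp: rel_segment_rep_def perm_segment_rep_def)
  have "(3::nat) ^ length (revs1 ?S) \<le> 3 ^ depth ?S" "(3::nat) ^ length (revs2 ?S) \<le> 3 ^ depth ?S"
    by (auto simp: depth_def intro: power_increasing)
  hence c12: "3 ^ length (revs1 ?S) \<le> c" "3 ^ length (revs2 ?S) \<le> c" using c by linarith+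
  have X: "hull_bounded c ?X ?f"
    by (rule hull_bounded_map[where d = dec_nat, OF hull_bounded_mono[OF hull_bounded_compose[OF D(1) r1] c12(1)]]) simp_all
  have Y: "hull_bounded c ?Y ?g"
    by (rule hull_bounded_map[where d = dec_nat, OF hull_bounded_mono[OF hull_bounded_compose[OF D(2) r2] c12(2)]]) simp_all
  have perm1: "?p1 permutes set ?D1" using r1 by (intro compose_permutes) (auto simp: segment_reversion_def)
  have perm2: "?p2 permutes set ?D2" using r2 by (intro compose_permutes) (auto simp: segment_reversion_def)
  have mono: "?R a' b'" if ab: "a \<in> set ?X" "a' \<in> set ?X" "b \<in> set ?Y" "b' \<in> set ?Y" "?R a b" "?f a' \<le> ?f a" "?g b' \<le> ?g b" for a a' b b'
  proof -
    obtain x x' y y' where xy: "a = enc_nat x" "a' = enc_nat x'" "b = enc_nat y" "b' = enc_nat y'"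
      "x \<in> set ?D1" "x' \<in> set ?D1" "y \<in> set ?D2" "y' \<in> set ?D2" using ab(1-4) by auto
    have "(?p1 x, ?p2 y) \<in> base_rel ?S" using ab(5) rel_enc_cons(1)[OF C xy(5,7)] xy by simp
    moreover have "dom_le ?D1 (?p1 x') (?p1 x)" "dom_le ?D2 (?p2 y') (?p2 y)"
      using ab(6,7) xy perm1 perm2 by (auto intro!: dom_le_pos simp: permutes_in_image)
    ultimately have "(?p1 x', ?p2 y') \<in> base_rel ?S"
      using C unfolding rel_segment_rep_def downwards_closed_def by blast
    thus ?thesis using rel_enc_cons(1)[OF C xy(6,8)] xy by simp
  qed
  obtain W1 W2 where W: "crossing_sets c ?X ?Y ?R W1 W2"
    using staircase_crossing[of c ?X ?f ?Y ?g ?R] X Y mono by blast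
  obtain V1 V2 where V: "crossing_sets c ?Y ?X (\<lambda>b a. ?R a b) V1 V2"
    using staircase_crossing[of c ?Y ?g ?X ?f "\<lambda>b a. ?R a b"] X Y mono by blast
  have "stair dm c (enc_cons Ds C) (\<lambda>b. if b then W1 else V1) (\<lambda>b. if b then W2 else V2)"
    unfolding stair_def
  proof (intro conjI allI impI)
    fix b i j
    assume ij: "blk dm i" "blk dm j" and bad: "if b then bad1 True (enc_cons Ds C) i j else bad1 True (enc_cons Ds C) j i"
    obtain as bs as' bs' where ab: "dm (vr i) = as @ el i @ bs" "dm (vr j) = as' @ el j @ bs'"
      using ij unfolding blk_def by blast
    show "(if b then W1 else V1) (el i) \<inter> set (el j) \<noteq> {} \<or>
      2 \<le> length (el i) \<and> (if b then W2 else V2) (el j) \<inter> set (el i) \<noteq> {}"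
    proof (cases b)
      case True
      hence "?X = as @ el i @ bs" "?Y = as' @ el j @ bs'" using bad ab dm by (auto simp: bad1_def)
      from W[unfolded crossing_sets_def, THEN conjunct2, THEN conjunct2, rule_format, OF this] show ?thesis
        using bad True unfolding bad1_def some_rel_def by auto
    next
      case False
      hence "?Y = as @ el i @ bs" "?X = as' @ el j @ bs'" using bad ab dm by (auto simp: bad1_def)
      from V[unfolded crossing_sets_def, THEN conjunct2, THEN conjunct2, rule_format, OF this] show ?thesis
        using bad False unfolding bad1_def some_rel_def by auto
    qed
  qed (use W V in \<open>auto simp: crossing_sets_def\<close>)
  thus ?thesis by blast
qed

text \<open>The sets of all constraints in both orientations are united, each tagged with the
  variable of the block it has to hit. This gives at most \<open>2 * c\<close> points per
  constraint.\<close>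

lemma neat_exists:
  assumes st: "\<And>C. C \<in> set cs \<Longrightarrow> \<exists>W1 W2. stair dm c C W1 W2" and d: "\<And>x. distinct (dm x)"
    and u: "9 * (length cs * (2 * c)) \<le> u"
  shows "\<exists>H1 H2. neat cs dm H1 H2 (length cs * (2 * c)) u"
proof -
  obtain W1 W2 where W: "\<And>C. C \<in> set cs \<Longrightarrow> stair dm c C (W1 C) (W2 C)" using st by metis
  let ?I = "set cs \<times> (UNIV :: bool set)"
  define H1 where "H1 i = (\<Union>(C, b)\<in>?I. {if b then cv2 C else cv1 C} \<times> W1 C b (el i))" for i
  define H2 where "H2 j = (\<Union>(C, b)\<in>?I. {if b then cv1 C else cv2 C} \<times> W2 C b (el j))" for j
  have H: "finite (\<Union>(C, b)\<in>?I. {x C b} \<times> A C b)" "card (\<Union>(C, b)\<in>?I. {x C b} \<times> A C b) \<le> length cs * (2 * c)"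
    if A: "\<And>C b. C \<in> set cs \<Longrightarrow> finite (A C b) \<and> card (A C b) \<le> c" for x :: "data \<Rightarrow> bool \<Rightarrow> data" and A :: "data \<Rightarrow> bool \<Rightarrow> data set"
  proof -
    show "finite (\<Union>(C, b)\<in>?I. {x C b} \<times> A C b)" using A by auto
    have "card (\<Union>(C, b)\<in>?I. {x C b} \<times> A C b) \<le> (\<Sum>(C, b)\<in>?I. card ({x C b} \<times> A C b))"
      using card_UN_le[of ?I "\<lambda>(C, b). {x C b} \<times> A C b"] by (simp add: case_prod_beta)
    also have "\<dots> \<le> (\<Sum>(C, b)\<in>?I. c)" using A by (intro sum_mono) (auto simp: card_cartesian_product)
    also have "\<dots> = card (set cs) * 2 * c" by (simp add: card_cartesian_product case_prod_beta)
    also have "\<dots> \<le> length cs * (2 * c)" using mult_le_mono1[OF card_length[of cs], of "2 * c"] by simp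
    finally show "card (\<Union>(C, b)\<in>?I. {x C b} \<times> A C b) \<le> length cs * (2 * c)" .
  qed
  have "neat cs dm H1 H2 (length cs * (2 * c)) u"
  proof
    show "finite (H1 i)" "card (H1 i) \<le> length cs * (2 * c)" for i
      unfolding H1_def by (rule H; use W in \<open>simp add: stair_def\<close>)+
    show "finite (H2 i)" "card (H2 i) \<le> length cs * (2 * c)" for i
      unfolding H2_def by (rule H; use W in \<open>simp add: stair_def\<close>)+
    fix i j assume ij: "blk dm i" "blk dm j" "bad True cs i j"
    then obtain C b where C: "C \<in> set cs" "if b then bad1 True C i j else bad1 True C j i"
      unfolding bad_def by (metis (full_types))
    have v: "(if b then cv2 C else cv1 C) = vr j" "(if b then cv1 C else cv2 C) = vr i"
      using C(2) by (auto simp: bad1_def split: if_splits)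
    have "(vr j, w) \<in> H1 i" if "w \<in> W1 C b (el i)" for w
      unfolding H1_def v(1)[symmetric] using C(1) that by blast
    moreover have "(vr i, w) \<in> H2 j" if "w \<in> W2 C b (el j)" for w
      unfolding H2_def v(2)[symmetric] using C(1) that by blast
    ultimately show "hit (H1 i) j \<or> 2 \<le> length (el i) \<and> hit (H2 j) i"
      using W[OF C(1), unfolded stair_def, THEN conjunct2, rule_format, OF ij(1,2) C(2)] unfolding hit_def by blast
  qed (use d u in auto)
  thus ?thesis by blast
qed

section \<open>Upper time bounds where results need not be polynomial in the input\<close>

section \<open>Running time of the recursion\<close>

definition tev :: "data list \<Rightarrow> exp \<Rightarrow> data \<Rightarrow> nat \<Rightarrow> bool" where
  "tev env e v T \<longleftrightarrow> (\<exists>t\<le>T. eval prog env e v t)"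

definition tevs :: "data list \<Rightarrow> exp list \<Rightarrow> data list \<Rightarrow> nat \<Rightarrow> bool" where
  "tevs env es vs T \<longleftrightarrow> (\<exists>t\<le>T. evals prog env es vs t)"

lemma tev_mono: "tev env e v T \<Longrightarrow> T \<le> T' \<Longrightarrow> tev env e v T'"
  unfolding tev_def by (meson le_trans)

lemma tev_Var: "i < length env \<Longrightarrow> env ! i = v \<Longrightarrow> tev env (Var i) v 1"
  unfolding tev_def using eval_Var by blast

lemma tev_Atom: "tev env AtomE Atom 1"
  unfolding tev_def using eval_Atom by blast

lemma tev_Pair: "tev env e1 v1 T1 \<Longrightarrow> tev env e2 v2 T2 \<Longrightarrow> tev env (PairE e1 e2) (Pair v1 v2) (T1 + T2 + 1)"
  unfolding tev_def using eval_Pair by (metis add_le_mono le_refl)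

lemma tev_Fst: "tev env e v T \<Longrightarrow> data_fst v = w \<Longrightarrow> tev env (FstE e) w (T + 1)"
  unfolding tev_def using eval_Fst by (metis add_le_mono le_refl)

lemma tev_Snd: "tev env e v T \<Longrightarrow> data_snd v = w \<Longrightarrow> tev env (SndE e) w (T + 1)"
  unfolding tev_def using eval_Snd by (metis add_le_mono le_refl)

lemma tev_If:
  assumes "tev env e b T" "b \<noteq> Atom \<Longrightarrow> tev env e1 v T'" "b = Atom \<Longrightarrow> tev env e2 v T'"
  shows "tev env (IfE e e1 e2) v (T + T' + 1)"
proof -
  obtain t where t: "t \<le> T" "eval prog env e b t" using assms(1) by (auto simp: tev_def)
  show ?thesis
  proof (cases "b = Atom")
    case True
    then obtain t' where t': "t' \<le> T'" "eval prog env e2 v t'" using assms(3) by (auto simp: tev_def)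
    have "eval prog env (IfE e e1 e2) v (t + t' + 1)" using eval_If_False t(2) t'(2) True by blast
    thus ?thesis unfolding tev_def using t(1) t'(1) by (intro exI[of _ "t + t' + 1"]) simp
  next
    case False
    then obtain t' where t': "t' \<le> T'" "eval prog env e1 v t'" using assms(2) by (auto simp: tev_def)
    have "eval prog env (IfE e e1 e2) v (t + t' + 1)" using eval_If_True[OF t(2) False t'(2)] .
    thus ?thesis unfolding tev_def using t(1) t'(1) by (intro exI[of _ "t + t' + 1"]) simp
  qed
qed

lemma tevs_Nil: "tevs env [] [] 0"
  unfolding tevs_def using evals_Nil by blast

lemma tevs_Cons: "tev env e v T \<Longrightarrow> tevs env es vs T' \<Longrightarrow> tevs env (e # es) (v # vs) (T + T')"
  unfolding tev_def tevs_def using evals_Cons by (metis add_le_mono)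

lemma tev_Call:
  assumes "tevs env es vs T" "tev vs (prog ! g) v T'" "g < length prog"
  shows "tev env (Call g es) v (T + T' + 1)"
proof -
  obtain t where t: "t \<le> T" "evals prog env es vs t" using assms(1) by (auto simp: tevs_def)
  obtain t' where t': "t' \<le> T'" "eval prog vs (prog ! g) v t'" using assms(2) by (auto simp: tev_def)
  from eval_Call[OF t(2) assms(3) t'(2)] t(1) t'(1) show ?thesis
    unfolding tev_def by (intro exI[of _ "t + t' + 1"]) simp
qed

lemma fn_tev:
  assumes "fn prog m g F"
  obtains c where "\<And>env Z. length env = m \<Longrightarrow> sz env \<le> Z \<Longrightarrow> tev env (prog ! g) (F env) ((Z + 2) ^ c)"
proof -
  obtain c where c: "\<And>env. length env = m \<Longrightarrow> \<exists>t \<le> (sz env + 2) ^ c. eval prog env (prog ! g) (F env) t"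
    using assms unfolding fn_def pt_def by blast
  show thesis
  proof (rule that[of c])
    fix env :: "data list" and Z assume e: "length env = m" "sz env \<le> Z"
    have "(sz env + 2) ^ c \<le> (Z + 2) ^ c" using e(2) by (intro power_mono) auto
    thus "tev env (prog ! g) (F env) ((Z + 2) ^ c)" unfolding tev_def using c[OF e(1)] by (meson le_trans)
  qed
qed

text \<open>The results of \<open>grow\<close>, \<open>cover\<close> and \<open>iPow\<close> can be
  exponential in the parameter. The time is polynomial in any bound \<open>Z\<close> on the input
  and all intermediate results, with an exponent that does not depend on the data.\<close>

definition fold_bound :: "nat \<Rightarrow> nat \<Rightarrow> (data list \<Rightarrow> data) \<Rightarrow> (data list \<Rightarrow> data) \<Rightarrow> nat \<Rightarrow> bool" where
  "fold_bound g n H B c \<longleftrightarrow> (\<forall>F es d Z. length es = n \<longrightarrow> F Atom = B (Atom # es) \<longrightarrow>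
      (\<forall>x xs. F (Pair x xs) = H (F xs # Pair x xs # es)) \<longrightarrow>
      data_size d + sz es \<le> Z \<longrightarrow> (\<forall>j. data_size (F ((data_snd ^^ j) d)) \<le> Z) \<longrightarrow>
      tev (d # es) (prog ! g) (F d) ((Z + 2) ^ c))"

lemma fold_tev:
  assumes g: "prog ! g = foldE g (Suc n) b" "Suc g < length prog" "prog ! Suc g = e"
    and H: "pt prog (Suc (Suc n)) e H" and B: "pt prog (Suc n) b B"
  shows "\<exists>c. fold_bound g n H B c"
proof -
  note U = pts_fold_args[of prog n]
  have l: "length (SndE (Var 0) # map Var [1..<Suc n]) = Suc n" by simp
  obtain c where c: "\<And>I Z F env. (\<And>v. v \<in> I \<Longrightarrow> length v = Suc n \<and> sz v \<le> Z \<and> data_size (F v) \<le> Z \<and>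
        (v ! 0 = Atom \<longrightarrow> F v = B v) \<and>
        (v ! 0 \<noteq> Atom \<longrightarrow> (data_snd (v ! 0) # drop 1 v) \<in> I \<and>
           data_size ((data_snd (v ! 0) # drop 1 v) ! 0) < data_size (v ! 0) \<and> F v = H (F (data_snd (v ! 0) # drop 1 v) # v)))
      \<Longrightarrow> env \<in> I \<Longrightarrow> \<exists>t \<le> (Z + 2) ^ c. eval prog env (prog ! g) (F env) t"
    using loop_time[OF g(1)[unfolded foldE_def] _ g(2) l _ H[folded g(3)] U B] g(2) by auto
  have "fold_bound g n H B c" unfolding fold_bound_def
  proof (intro allI impI)
    fix F es d Z
    assume es: "length es = n" and F0: "F Atom = B (Atom # es)"
      and F1: "\<forall>x xs. F (Pair x xs) = H (F xs # Pair x xs # es)"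
      and Z: "data_size d + sz es \<le> Z" and s: "\<forall>j. data_size (F ((data_snd ^^ j) d)) \<le> Z"
    let ?I = "{(data_snd ^^ j) d # es |j. True}"
    have "\<exists>t \<le> (Z + 2) ^ c. eval prog (d # es) (prog ! g) ((\<lambda>v. F (v ! 0)) (d # es)) t"
    proof (rule c[of ?I])
      show "d # es \<in> ?I" by (rule CollectI) (rule exI[of _ 0], simp)
      fix v assume "v \<in> ?I"
      then obtain j where v: "v = (data_snd ^^ j) d # es" by blast
      let ?d = "(data_snd ^^ j) d"
      have "data_snd ?d # es \<in> ?I" by (rule CollectI) (rule exI[of _ "Suc j"], simp)
      moreover have "?d \<noteq> Atom \<Longrightarrow> F ?d = H (F (data_snd ?d) # ?d # es)" using F1 by (cases ?d) auto
      moreover have "data_size ?d \<le> data_size d" by (rule size_snd_pow_le)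
      ultimately show "length v = Suc n \<and> sz v \<le> Z \<and> data_size (F (v ! 0)) \<le> Z \<and>
        (v ! 0 = Atom \<longrightarrow> F (v ! 0) = B v) \<and>
        (v ! 0 \<noteq> Atom \<longrightarrow> (data_snd (v ! 0) # drop 1 v) \<in> ?I \<and>
           data_size ((data_snd (v ! 0) # drop 1 v) ! 0) < data_size (v ! 0) \<and>
           F (v ! 0) = H (F ((data_snd (v ! 0) # drop 1 v) ! 0) # v))"
        using es F0 Z s[rule_format, of j] size_snd_less[of ?d] by (auto simp: v)
    qed
    thus "tev (d # es) (prog ! g) (F d) ((Z + 2) ^ c)" by (simp add: tev_def)
  qed
  thus ?thesis ..
qed

lemma sp_snd_pow: "sp ((data_snd ^^ j) d) = drop j (sp d)"
proof (induction j)
  case (Suc j)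
  have "sp (data_snd x) = tl (sp x)" for x by (cases x) auto
  thus ?case using Suc by (simp add: drop_Suc tl_drop)
qed simp

lemma grow_tev:
  "\<exists>c. \<forall>S F cs Z. sz [ls S, ls F, ls cs] \<le> Z \<longrightarrow>
      (\<forall>j\<le>length S. data_size (ls (grow cs F j)) \<le> Z) \<longrightarrow>
      tev [ls S, ls F, ls cs] (prog ! iGrow) (ls (grow cs F (length S))) ((Z + 2) ^ c)"
proof -
  have H: "pt prog (Suc (Suc 2)) (Call iGrowl [Var 0, Var 2, Var 3]) (\<lambda>v. ls (growl (sp (v ! 3)) (sp (v ! 2)) (sp (v ! 0))))"
    by (rule pt_cong, (rule pt_intros pt_Call[OF fn_growl] | (simp; fail))+)
  have B: "pt prog (Suc 2) (Call iSingles [Var 1]) (\<lambda>v. ls (map (\<lambda>i. Pair i Atom) (sp (v ! 1))))"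
    by (rule pt_cong, (rule pt_intros pt_Call[OF fn_singles] | (simp; fail))+)
  have g: "prog ! iGrow = foldE iGrow (Suc 2) (Call iSingles [Var 1])" "Suc iGrow < length prog"
    "prog ! Suc iGrow = Call iGrowl [Var 0, Var 2, Var 3]"
    by (simp_all add: prog_def)
  obtain c where c: "fold_bound iGrow 2 (\<lambda>v. ls (growl (sp (v ! 3)) (sp (v ! 2)) (sp (v ! 0)))) (\<lambda>v. ls (map (\<lambda>i. Pair i Atom) (sp (v ! 1)))) c"
    using fold_tev[OF g H B] by blast
  show ?thesis
  proof (intro exI[of _ c] allI impI)
    fix S F cs Z
    assume Z: "sz [ls S, ls F, ls cs] \<le> Z" and s: "\<forall>j\<le>length S. data_size (ls (grow cs F j)) \<le> Z"
    show "tev [ls S, ls F, ls cs] (prog ! iGrow) (ls (grow cs F (length S))) ((Z + 2) ^ c)"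
      using c[unfolded fold_bound_def, rule_format, of "[ls F, ls cs]" "\<lambda>d. ls (grow cs F (length (sp d)))" "ls S" Z] Z s
      by (simp add: grow_Suc sp_snd_pow)
  qed
qed

lemma cover_tev:
  "\<exists>c. \<forall>S G cs Z. sz [ls S, ls G, ls cs] \<le> Z \<longrightarrow>
      (\<forall>j\<le>length S. data_size (ls (cover cs G j)) \<le> Z) \<longrightarrow>
      tev [ls S, ls G, ls cs] (prog ! iCover) (ls (cover cs G (length S))) ((Z + 2) ^ c)"
proof -
  have H: "pt prog (Suc (Suc 2)) (Call iCovl [Var 0, Var 2, Var 3]) (\<lambda>v. ls (covl (sp (v ! 3)) (sp (v ! 2)) (sp (v ! 0))))"
    by (rule pt_cong, (rule pt_intros pt_Call[OF fn_covl] | (simp; fail))+)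
  have B: "pt prog (Suc 2) (TrueE) (\<lambda>v. Pair Atom Atom)"
    by (rule pt_cong, (rule pt_intros  | (simp; fail))+)
  have g: "prog ! iCover = foldE iCover (Suc 2) (TrueE)" "Suc iCover < length prog"
    "prog ! Suc iCover = Call iCovl [Var 0, Var 2, Var 3]"
    by (simp_all add: prog_def)
  obtain c where c: "fold_bound iCover 2 (\<lambda>v. ls (covl (sp (v ! 3)) (sp (v ! 2)) (sp (v ! 0)))) (\<lambda>v. Pair Atom Atom) c"
    using fold_tev[OF g H B] by blast
  show ?thesis
  proof (intro exI[of _ c] allI impI)
    fix S G cs Z
    assume Z: "sz [ls S, ls G, ls cs] \<le> Z" and s: "\<forall>j\<le>length S. data_size (ls (cover cs G j)) \<le> Z"
    show "tev [ls S, ls G, ls cs] (prog ! iCover) (ls (cover cs G (length S))) ((Z + 2) ^ c)"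
      using c[unfolded fold_bound_def, rule_format, of "[ls G, ls cs]" "\<lambda>d. ls (cover cs G (length (sp d)))" "ls S" Z] Z s
      by (simp add: cover_Suc sp_snd_pow)
  qed
qed

lemma prog_filt:
  "prog ! iFilt = IfE (Var 0) (Call (Suc iFilt) [Call iFilt [SndE (Var 0), Var 1, Var 2, Var 3],
     Var 0, Var 1, Var 2, Var 3]) AtomE"
  "prog ! Suc iFilt = IfE (Call iSolve [Var 2, FstE (Var 1), Var 3, Var 4]) (PairE (FstE (Var 1)) (Var 0)) (Var 0)"
  by (simp_all add: prog_def foldE_def loop_def upt_rec)

text \<open>\<open>iFilt\<close> and \<open>iSolve\<close> are mutually recursive; the bound
  \<open>T\<close> on the calls of \<open>iSolve\<close> stands for what the induction hypothesis
  will supply.\<close>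

lemma filt_tev:
  assumes "\<And>g. g \<in> set L \<Longrightarrow> tev [nl, g, cs, u] (prog ! iSolve) (enc_bool (p g)) T"
  shows "tev [ls L, nl, cs, u] (prog ! iFilt) (ls (filter p L)) (length L * (T + 30) + 5)"
  using assms
proof (induction L)
  case Nil
  have "tev [Atom, nl, cs, u] (prog ! iFilt) Atom (1 + 1 + 1)"
    unfolding prog_filt by (rule tev_If[where b = Atom], rule tev_Var) (simp_all add: tev_Atom[simplified])
  thus ?case by (auto intro: tev_mono)
next
  case (Cons g L)
  let ?T = "length L * (T + 30) + 5" and ?r = "ls (filter p L)" and ?d = "Pair g (ls L)"
  have IH: "tev [ls L, nl, cs, u] (prog ! iFilt) ?r ?T" using Cons by simp
  have g: "tev [nl, g, cs, u] (prog ! iSolve) (enc_bool (p g)) T" using Cons.prems by simp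
  have v: "tev [?d, nl, cs, u] (Var 0) ?d 1" "tev [?d, nl, cs, u] (Var 1) nl 1" "tev [?d, nl, cs, u] (Var 2) cs 1"
    "tev [?d, nl, cs, u] (Var 3) u 1" by (rule tev_Var; simp)+
  have w: "tev [?r, ?d, nl, cs, u] (Var 0) ?r 1" "tev [?r, ?d, nl, cs, u] (Var 1) ?d 1"
    "tev [?r, ?d, nl, cs, u] (Var 2) nl 1" "tev [?r, ?d, nl, cs, u] (Var 3) cs 1" "tev [?r, ?d, nl, cs, u] (Var 4) u 1"
    by (rule tev_Var; simp)+
  have wg: "tev [?r, ?d, nl, cs, u] (FstE (Var 1)) g (1 + 1)" by (rule tev_Fst[OF w(2)]) simp
  have sv: "tev [?d, nl, cs, u] (SndE (Var 0)) (ls L) (1 + 1)" by (rule tev_Snd[OF v(1)]) simp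
  have "tevs [?d, nl, cs, u] [SndE (Var 0), Var 1, Var 2, Var 3] [ls L, nl, cs, u] (1 + 1 + (1 + (1 + (1 + 0))))"
    by (intro tevs_Cons tevs_Nil sv v)
  from tev_Call[OF this IH]
  have r: "tev [?d, nl, cs, u] (Call iFilt [SndE (Var 0), Var 1, Var 2, Var 3]) ?r (5 + ?T + 1)"
    by (rule tev_mono) auto
  have args: "tevs [?d, nl, cs, u] [Call iFilt [SndE (Var 0), Var 1, Var 2, Var 3], Var 0, Var 1, Var 2, Var 3]
      [?r, ?d, nl, cs, u] (5 + ?T + 1 + (1 + (1 + (1 + (1 + 0)))))"
    by (intro tevs_Cons tevs_Nil r v)
  have "tevs [?r, ?d, nl, cs, u] [Var 2, FstE (Var 1), Var 3, Var 4] [nl, g, cs, u] (1 + (1 + 1 + (1 + (1 + 0))))"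
    by (intro tevs_Cons tevs_Nil w wg)
  from tev_Call[OF this g]
  have s: "tev [?r, ?d, nl, cs, u] (Call iSolve [Var 2, FstE (Var 1), Var 3, Var 4]) (enc_bool (p g)) (5 + T + 1)"
    by (rule tev_mono) auto
  have "tev [?r, ?d, nl, cs, u] (prog ! Suc iFilt) (ls (filter p (g # L))) (5 + T + 1 + 4 + 1)"
    unfolding prog_filt
  proof (rule tev_If[OF s])
    assume "enc_bool (p g) \<noteq> Atom"
    thus "tev [?r, ?d, nl, cs, u] (PairE (FstE (Var 1)) (Var 0)) (ls (filter p (g # L))) 4"
      using tev_mono[OF tev_Pair[OF wg w(1)], of 4] by simp
  next
    assume "enc_bool (p g) = Atom"
    thus "tev [?r, ?d, nl, cs, u] (Var 0) (ls (filter p (g # L))) 4"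
      using tev_mono[OF w(1)] by simp
  qed
  from tev_Call[OF args this]
  have "tev [?d, nl, cs, u] (Call (Suc iFilt) [Call iFilt [SndE (Var 0), Var 1, Var 2, Var 3], Var 0, Var 1, Var 2, Var 3])
    (ls (filter p (g # L))) (?T + T + 22)" by (auto intro: tev_mono)
  from tev_If[OF v(1) this, of AtomE]
  have "tev [?d, nl, cs, u] (prog ! iFilt) (ls (filter p (g # L))) (?T + T + 24)"
    unfolding prog_filt by (auto intro: tev_mono)
  hence "tev [?d, nl, cs, u] (prog ! iFilt) (ls (filter p (g # L))) (length (g # L) * (T + 30) + 5)"
    by (rule tev_mono) simp
  thus ?case by simp
qed

lemma length_half: "length (half xs) = length xs div 2"
  by (induction xs rule: half.induct) auto

text \<open>Division by \<open>2 ^ u\<close> is done by \<open>u\<close> halvings, without computing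
  \<open>2 ^ u\<close>.\<close>

lemma length_halves: "length ((half ^^ k) xs) = length xs div 2 ^ k"
  by (induction k) (auto simp: length_half div_mult2_eq[symmetric] mult.commute)

definition fn_time :: "nat \<Rightarrow> nat \<Rightarrow> (data list \<Rightarrow> data) \<Rightarrow> nat \<Rightarrow> bool" where
  "fn_time m g F c \<longleftrightarrow> (\<forall>env Z. length env = m \<longrightarrow> sz env \<le> Z \<longrightarrow> tev env (prog ! g) (F env) ((Z + 2) ^ c))"

lemma fn_time: "fn prog m g F \<Longrightarrow> \<exists>c. fn_time m g F c"
  by (erule fn_tev) (auto simp: fn_time_def)

lemma pow2_mono: "c \<le> d \<Longrightarrow> (Z + 2) ^ c \<le> (Z + 2 :: nat) ^ d"
  by (intro power_increasing) auto

lemma fn_time_mono: "fn_time m g F c \<Longrightarrow> c \<le> d \<Longrightarrow> fn_time m g F d"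
  unfolding fn_time_def using pow2_mono tev_mono by blast

text \<open>One exponent for all nonrecursive work of a recursion step, fixed before the instance is
  known.\<close>

definition rec_time :: "nat \<Rightarrow> bool" where
  "rec_time c \<longleftrightarrow>
    fn_time 2 iHalves (\<lambda>v. ls ((half ^^ length (sp (v ! 0))) (sp (v ! 1)))) c \<and>
    fn_time 3 iChk (\<lambda>v. enc_bool (\<exists>i\<in>set (sp (v ! 0)). anyb False (sp (v ! 2)) (sp (v ! 1)) i)) c \<and>
    fn_time 2 iLong (\<lambda>v. enc_bool (\<exists>a\<in>set (sp (v ! 0)). length (sp (v ! 1)) \<le> length (sp a))) c \<and>
    fn_time 5 iFinal (\<lambda>v. ls (refine (length (sp (v ! 0))) (length (sp (v ! 1))) (sp (v ! 3))
      (length (sp (v ! 4))) (sp (v ! 2)))) c \<and>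
    (\<forall>S F cs Z. sz [ls S, ls F, ls cs] \<le> Z \<longrightarrow> (\<forall>j\<le>length S. data_size (ls (grow cs F j)) \<le> Z) \<longrightarrow>
      tev [ls S, ls F, ls cs] (prog ! iGrow) (ls (grow cs F (length S))) ((Z + 2) ^ c)) \<and>
    (\<forall>S G cs Z. sz [ls S, ls G, ls cs] \<le> Z \<longrightarrow> (\<forall>j\<le>length S. data_size (ls (cover cs G j)) \<le> Z) \<longrightarrow>
      tev [ls S, ls G, ls cs] (prog ! iCover) (ls (cover cs G (length S))) ((Z + 2) ^ c))"

lemma rec_time: "\<exists>c. rec_time c"
proof -
  obtain c1 c2 c3 c4 where c1: "fn_time 2 iHalves (\<lambda>v. ls ((half ^^ length (sp (v ! 0))) (sp (v ! 1)))) c1"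
    and c2: "fn_time 3 iChk (\<lambda>v. enc_bool (\<exists>i\<in>set (sp (v ! 0)). anyb False (sp (v ! 2)) (sp (v ! 1)) i)) c2"
    and c3: "fn_time 2 iLong (\<lambda>v. enc_bool (\<exists>a\<in>set (sp (v ! 0)). length (sp (v ! 1)) \<le> length (sp a))) c3"
    and c4: "fn_time 5 iFinal (\<lambda>v. ls (refine (length (sp (v ! 0))) (length (sp (v ! 1))) (sp (v ! 3))
      (length (sp (v ! 4))) (sp (v ! 2)))) c4"
    using fn_time[OF fn_halves] fn_time[OF fn_chk] fn_time[OF fn_long] fn_time[OF fn_final] by blast
  obtain c5 where c5: "\<forall>S F cs Z. sz [ls S, ls F, ls cs] \<le> Z \<longrightarrow>
      (\<forall>j\<le>length S. data_size (ls (grow cs F j)) \<le> Z) \<longrightarrow>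
      tev [ls S, ls F, ls cs] (prog ! iGrow) (ls (grow cs F (length S))) ((Z + 2) ^ c5)"
    using grow_tev by blast
  obtain c6 where c6: "\<forall>S F cs Z. sz [ls S, ls F, ls cs] \<le> Z \<longrightarrow>
      (\<forall>j\<le>length S. data_size (ls (cover cs F j)) \<le> Z) \<longrightarrow>
      tev [ls S, ls F, ls cs] (prog ! iCover) (ls (cover cs F (length S))) ((Z + 2) ^ c6)"
    using cover_tev by blast
  let ?c = "c1 + c2 + c3 + c4 + c5 + c6"
  have "rec_time ?c"
    unfolding rec_time_def
  proof (intro conjI allI impI)
    fix S F cs Z assume "sz [ls S, ls F, ls cs] \<le> Z" "\<forall>j\<le>length S. data_size (ls (grow cs F j)) \<le> Z"
    hence "tev [ls S, ls F, ls cs] (prog ! iGrow) (ls (grow cs F (length S))) ((Z + 2) ^ c5)" using c5 by blast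
    thus "tev [ls S, ls F, ls cs] (prog ! iGrow) (ls (grow cs F (length S))) ((Z + 2) ^ ?c)"
      by (rule tev_mono) (rule pow2_mono, simp)
  next
    fix S F cs Z assume "sz [ls S, ls F, ls cs] \<le> Z" "\<forall>j\<le>length S. data_size (ls (cover cs F j)) \<le> Z"
    hence "tev [ls S, ls F, ls cs] (prog ! iCover) (ls (cover cs F (length S))) ((Z + 2) ^ c6)" using c6 by blast
    thus "tev [ls S, ls F, ls cs] (prog ! iCover) (ls (cover cs F (length S))) ((Z + 2) ^ ?c)"
      by (rule tev_mono) (rule pow2_mono, simp)
  qed (rule fn_time_mono, rule c1 c2 c3 c4, simp)+
  thus ?thesis ..
qed

lemma prog_solve:
  "prog ! iSolve = IfE (SndE (Var 0)) (Call iStep [Call iHalves [Var 3, Var 0], Var 0, Var 1, Var 2, Var 3])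
      (NotE (Call iChk [Var 1, Var 1, Var 2]))"
  "prog ! iStep = Call iLong [Call iCover [Var 2, Call iFilt [Call iGrow [Var 2,
        Call iFinal [Var 0, Var 1, Var 2, Var 3, Var 4], Var 3], Var 0, Var 3, Var 4], Var 3], Var 2]"
  by (simp_all add: prog_def)

section \<open>Number of recursive calls, sizes, and total time\<close>

section \<open>The recurrence\<close>

lemma le_pow_two: "n \<le> 2 ^ (n :: nat)"
  using less_exp[of n] by simp

text \<open>With \<open>q = p + 1\<close>, all factors except \<open>2 ^ u\<close> amount to at most
  \<open>u ^ (4 * q)\<close>. Since \<open>u = 2 ^ (8 * q)\<close>, this is 2 to the power
  \<open>32 * q * q\<close>, and that exponent is at most \<open>256 ^ q = u\<close>.\<close>

lemma branching_le:
  fixes u p k :: nat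
  assumes u: "u = 2 ^ (8 * (p + 1))" and k: "k \<le> p"
  shows "(u + 1) * (5 * k * 2 ^ u) * (1 + k * (u * u + 5 * k)) ^ k \<le> (2 ^ u) ^ 2"
proof -
  let ?q = "p + 1"
  have u': "u = 256 ^ ?q" unfolding u power_mult by simp
  have q2: "?q \<le> 2 ^ ?q" by (rule le_pow_two)
  have pw: "m \<le> m ^ ?q" if "1 \<le> m" for m :: nat using that by (intro self_le_power) auto
  have "10 * ?q \<le> 128 ^ ?q * 2 ^ ?q"
    using pw[of 128] q2 by (intro mult_mono) linarith+
  also have "\<dots> = u" unfolding u' by (simp flip: power_mult_distrib)
  finally have kq: "10 * ?q \<le> u" .
  hence ku: "10 * k \<le> u" "k \<le> u" "10 \<le> u" using k by auto
  have a: "(u + 1) * (5 * k) \<le> u * u"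
  proof -
    have "(u + 1) * (5 * k) \<le> (2 * u) * (5 * k)" using ku(3) by (intro mult_right_mono) auto
    also have "\<dots> = u * (10 * k)" by simp
    also have "\<dots> \<le> u * u" using ku(1) by (intro mult_left_mono) auto
    finally show ?thesis .
  qed
  have b: "1 + k * (u * u + 5 * k) \<le> u ^ 4"
  proof -
    have "5 * k \<le> u * 1" using ku(1) by simp
    also have "\<dots> \<le> u * u" using ku(3) by (intro mult_left_mono) auto
    finally have "k * (u * u + 5 * k) \<le> u * (u * u + u * u)" using ku(2) by (intro mult_mono) auto
    also have "\<dots> = 2 * u ^ 3" by (simp add: power3_eq_cube)
    finally have "1 + k * (u * u + 5 * k) \<le> u ^ 3 + 2 * u ^ 3" using one_le_power[of u 3] ku(3) by linarith
    also have "\<dots> \<le> u * u ^ 3" using ku(3) mult_right_mono[of 3 u "u ^ 3"] by simp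
    also have "\<dots> = u ^ 4" by (simp add: eval_nat_numeral)
    finally show ?thesis .
  qed
  have "(u + 1) * (5 * k * 2 ^ u) * (1 + k * (u * u + 5 * k)) ^ k = ((u + 1) * (5 * k)) * (1 + k * (u * u + 5 * k)) ^ k * 2 ^ u"
    by (simp only: mult_ac)
  also have "\<dots> \<le> (u * u) * (u ^ 4) ^ k * 2 ^ u"
    by (intro mult_le_mono1 mult_le_mono[OF a] power_mono[OF b]) simp
  also have "(u * u) * (u ^ 4) ^ k = u ^ (2 + 4 * k)" by (simp add: power_add power_mult power2_eq_square)
  also have "u ^ (2 + 4 * k) \<le> u ^ (4 * ?q)" using ku(3) k by (intro power_increasing) auto
  also have "u ^ (4 * ?q) = 2 ^ (8 * ?q * (4 * ?q))" unfolding u by (simp only: power_mult)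
  also have "(2::nat) ^ (8 * ?q * (4 * ?q)) \<le> 2 ^ u"
  proof (rule power_increasing)
    have "8 * ?q * (4 * ?q) = 32 * (?q * ?q)" by (simp add: algebra_simps)
    also have "\<dots> \<le> 64 ^ ?q * (2 ^ ?q * 2 ^ ?q)"
      using pw[of 64] q2 by (intro mult_mono) linarith+
    also have "\<dots> = u" unfolding u' by (simp flip: power_mult_distrib)
    finally show "8 * ?q * (4 * ?q) \<le> u" .
  qed simp
  finally show ?thesis by (simp add: power2_eq_square)
qed

lemma size_ls_le:
  assumes "\<And>x. x \<in> set xs \<Longrightarrow> data_size x \<le> b"
  shows "data_size (ls xs) \<le> 1 + length xs * (b + 1)"
  using assms
proof (induction xs)
  case (Cons x xs)
  have "data_size x \<le> b" "data_size (ls xs) \<le> 1 + length xs * (b + 1)" using Cons by auto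
  thus ?case by simp
qed simp

locale bounded_neat = neat +
  fixes p N :: nat and Vs :: "data set"
  assumes finite_Vs: "finite Vs" and card_Vs: "card Vs \<le> p" and u: "u = 2 ^ (8 * (p + 1))"
    and size_dm: "\<And>x. x \<in> Vs \<Longrightarrow> data_size (Pair x (ls (dm x))) \<le> N"
    and size_cs: "data_size (ls cs) \<le> N"
begin

text \<open>A domain may be empty at the top level. There \<open>n\<close> is at least 2, and
  refinement produces no empty blocks, so at the base case every block has exactly one element; the
  last clause records this.\<close>

definition inv :: "nat \<Rightarrow> data list \<Rightarrow> bool" where
  "inv n S \<longleftrightarrow> distinct (map vr S) \<and>
     (\<forall>i\<in>set S. vr i \<in> Vs \<and> blk dm i \<and> length (el i) \<le> max 1 n \<and> (n < 2 \<longrightarrow> el i \<noteq> []))"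

lemma length_le_p:
  assumes "distinct (map vr S)" "\<And>i. i \<in> set S \<Longrightarrow> vr i \<in> Vs"
  shows "length S \<le> p"
proof -
  have "length S = card (vr ` set S)" using assms(1) by (metis distinct_card length_map list.set_map)
  also have "\<dots> \<le> card Vs" using assms(2) finite_Vs by (intro card_mono) auto
  finally show ?thesis using card_Vs by simp
qed

lemma size_item:
  assumes "vr i \<in> Vs" "blk dm i"
  shows "data_size i \<le> N"
proof -
  obtain as bs where ab: "dm (vr i) = as @ el i @ bs" using assms(2) by (auto simp: blk_def)
  have "data_size (data_snd i) \<le> data_size (ls (dm (vr i)))"
    using size_ls_append[of as "el i @ bs"] size_ls_append[of "el i" bs] size_pos[of "ls as"] size_pos[of "ls bs"] ab
    by (simp add: Suc_le_eq del: size_pos)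
  hence "data_size (Pair (vr i) (data_snd i)) \<le> N" using size_dm[OF assms(1)] by simp
  moreover have "data_size i \<le> data_size (Pair (vr i) (data_snd i))" by (cases i) auto
  ultimately show ?thesis by linarith
qed

lemma size_tuple:
  assumes "distinct (map vr S)" "\<And>i. i \<in> set S \<Longrightarrow> vr i \<in> Vs \<and> blk dm i"
  shows "data_size (ls S) \<le> 1 + p * (N + 1)"
proof -
  have "data_size (ls S) \<le> 1 + length S * (N + 1)" using assms size_item by (intro size_ls_le) auto
  also have "\<dots> \<le> 1 + p * (N + 1)" using length_le_p assms by (intro add_left_mono mult_right_mono) auto
  finally show ?thesis .
qed

text \<open>Bounds every list of a recursion step. The longest are the covers, with at most
  \<open>(2 ^ u) ^ (3 * p)\<close> tuples, each of size at most
  \<open>1 + p * (N + 1)\<close>.\<close>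

definition "B = (2 ^ u) ^ (3 * p + 6) * (N + 1)"

lemma p_le: "p + 3 \<le> 2 ^ u"
proof -
  have "p + 3 \<le> 2 ^ (p + 3)" by (rule le_pow_two)
  also have "\<dots> \<le> 2 ^ (8 * (p + 1))" by (intro power_increasing) auto
  also have "\<dots> \<le> 2 ^ u" unfolding u[symmetric] by (rule le_pow_two)
  finally show ?thesis .
qed

lemma u_ge: "256 \<le> u"
proof -
  have "(2::nat) ^ 8 \<le> 2 ^ (8 * (p + 1))" by (intro power_increasing) auto
  thus ?thesis using u by simp
qed

lemma B_ge: "m \<le> 3 * p + 6 \<Longrightarrow> (2 ^ u) ^ m * (N + 1) \<le> B"
  unfolding B_def by (intro mult_right_mono power_increasing) auto

lemma tuple_le: "3 + p * (N + 1) \<le> 2 ^ u * (N + 1)"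
proof -
  have "3 + p * (N + 1) \<le> (p + 3) * (N + 1)" by (simp add: algebra_simps)
  also have "\<dots> \<le> 2 ^ u * (N + 1)" using p_le by (intro mult_right_mono) auto
  finally show ?thesis .
qed

lemma size_tuples:
  assumes "\<And>g. g \<in> set L \<Longrightarrow> data_size g \<le> 1 + p * (N + 1)" "length L \<le> (2 ^ u) ^ (3 * p + 4)"
  shows "data_size (ls L) \<le> B"
proof -
  have "data_size (ls L) \<le> 1 + length L * (1 + p * (N + 1) + 1)" using assms(1) by (intro size_ls_le) auto
  also have "\<dots> \<le> (2 ^ u) ^ (3 * p + 4) + (2 ^ u) ^ (3 * p + 4) * (2 + p * (N + 1))"
  proof (rule add_mono)
    show "1 \<le> (2 ^ u :: nat) ^ (3 * p + 4)" by simp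
    have "1 + p * (N + 1) + 1 = 2 + p * (N + 1)" by simp
    thus "length L * (1 + p * (N + 1) + 1) \<le> (2 ^ u) ^ (3 * p + 4) * (2 + p * (N + 1))"
      using mult_le_mono1[OF assms(2)] by metis
  qed
  also have "\<dots> = (2 ^ u) ^ (3 * p + 4) * (3 + p * (N + 1))" by (simp add: algebra_simps)
  also have "\<dots> \<le> (2 ^ u) ^ (3 * p + 4) * (2 ^ u * (N + 1))" using tuple_le by (intro mult_left_mono) auto
  also have "\<dots> = (2 ^ u) ^ Suc (3 * p + 4) * (N + 1)" by (simp only: power_Suc2 mult.assoc)
  also have "\<dots> \<le> B" by (rule B_ge) simp
  finally show ?thesis .
qed

definition "W c = 6 * (6 * B + 2) ^ c + 100 + 30 * (2 ^ u) ^ 2"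

text \<open>The subtracted \<open>W c\<close> is slack that lets the induction absorb the cost added
  at each level.\<close>

definition "Tb c n = (if n \<le> 1 then W c else 2 * W c * (2 ^ u) ^ 2 * n ^ 2 - W c)"

lemma recurrence:
  assumes n: "2 \<le> n"
  shows "W c + (2 ^ u) ^ 2 * Tb c (n div 2 ^ u) \<le> Tb c n"
proof -
  let ?r = "(2 ^ u) :: nat" and ?w = "W c"
  have r2: "4 \<le> ?r ^ 2"
  proof -
    have "(2::nat) ^ 2 \<le> (2 ^ u) ^ 2" using u_ge self_le_power[of 2 u] by (intro power_mono) auto
    thus ?thesis by simp
  qed
  have "?w + (?w + ?r ^ 2 * Tb c (n div ?r)) \<le> 2 * ?w * ?r ^ 2 * n ^ 2"
  proof (cases "n div ?r \<le> 1")
    case True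
    have "?w + (?w + ?r ^ 2 * ?w) = (2 + ?r ^ 2) * ?w" by (simp add: algebra_simps)
    also have "\<dots> \<le> (2 * ?r ^ 2) * ?w" using r2 by (intro mult_right_mono) auto
    also have "\<dots> \<le> (2 * ?r ^ 2) * ?w * n ^ 2" using n by simp
    finally show ?thesis using True by (simp add: Tb_def mult_ac)
  next
    case False
    let ?m = "n div ?r"
    have "?r * ?m \<le> n" by simp
    hence rn: "?r ^ 2 * ?m ^ 2 \<le> n ^ 2" using power_mono[of "?r * ?m" n 2] by (simp add: power_mult_distrib)
    have le: "?w \<le> 2 * ?w * ?r ^ 2 * ?m ^ 2"
    proof -
      have "1 * ?w \<le> (2 * ?r ^ 2 * ?m ^ 2) * ?w" by (intro mult_right_mono) (use False in auto)
      thus ?thesis by (simp add: mult_ac)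
    qed
    have "?r ^ 2 * Tb c ?m + ?r ^ 2 * ?w = ?r ^ 2 * (2 * ?w * ?r ^ 2 * ?m ^ 2)"
      using False le by (simp add: Tb_def flip: distrib_left)
    also have "\<dots> = 2 * ?w * ?r ^ 2 * (?r ^ 2 * ?m ^ 2)" by (simp add: mult_ac)
    also have "\<dots> \<le> 2 * ?w * ?r ^ 2 * n ^ 2" using rn by (intro mult_left_mono) auto
    finally have "?r ^ 2 * Tb c ?m + ?r ^ 2 * ?w \<le> 2 * ?w * ?r ^ 2 * n ^ 2" .
    \<comment> \<open>The slack of the \<open>(2 ^ u) ^ 2\<close> recursive calls exceeds the two
      summands \<open>W c\<close> that have to be paid here.\<close>
    moreover have "2 * ?w \<le> ?r ^ 2 * ?w" using r2 by (intro mult_right_mono) auto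
    ultimately show ?thesis by linarith
  qed
  thus ?thesis using n by (simp add: Tb_def)
qed

text \<open>Value and time are proved together: the filter keeps the right tuples only because the
  recursive calls return the right answers.\<close>

theorem solve_tev:
  assumes c: "rec_time c"
    and ul: "length ul = u" "data_size (ls ul) \<le> B"
  shows "inv (length nl) S \<Longrightarrow> data_size (ls nl) \<le> B \<Longrightarrow>
    tev [ls nl, ls S, ls cs, ls ul] (prog ! iSolve) (enc_bool (sat cs S)) (Tb c (length nl))"
proof (induction "length nl" arbitrary: nl S rule: less_induct)
  case less
  note time = c[unfolded rec_time_def fn_time_def]
  note halves_time = time[THEN conjunct1, rule_format]
    and time = time[THEN conjunct2]
  note chk_time = time[THEN conjunct1, rule_format] and time = time[THEN conjunct2]
  note long_time = time[THEN conjunct1, rule_format] and time = time[THEN conjunct2]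
  note final_time = time[THEN conjunct1, rule_format] and time = time[THEN conjunct2]
  note grow_time = time[THEN conjunct1, rule_format] and cover_time = time[THEN conjunct2, rule_format]
  \<comment> \<open>No subroutine called below has more than five arguments, each of size at most
    \<open>B\<close>.\<close>
  let ?n = "length nl" and ?Z = "6 * B" and ?env = "[ls nl, ls S, ls cs, ls ul]"
  have S: "distinct (map vr S)" "\<And>i. i \<in> set S \<Longrightarrow> vr i \<in> Vs \<and> blk dm i"
    "\<And>i. i \<in> set S \<Longrightarrow> length (el i) \<le> max 1 ?n" "\<And>i. i \<in> set S \<Longrightarrow> ?n < 2 \<Longrightarrow> el i \<noteq> []"
    using less.prems(1) by (auto simp: inv_def)
  have kp: "length S \<le> p" using S length_le_p by blast
  have NB: "N \<le> B" using B_ge[of 0] by simp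
  have sS: "data_size (ls S) \<le> B"
  proof -
    have "data_size (ls S) \<le> 3 + p * (N + 1)" using size_tuple[OF S(1,2)] by simp
    also have "\<dots> \<le> (2 ^ u) ^ 1 * (N + 1)" using tuple_le by simp
    also have "\<dots> \<le> B" by (rule B_ge) simp
    finally show ?thesis .
  qed
  have scs: "data_size (ls cs) \<le> B" using size_cs NB by simp
  have v: "tev ?env (Var 0) (ls nl) 1" "tev ?env (Var 1) (ls S) 1" "tev ?env (Var 2) (ls cs) 1"
    "tev ?env (Var 3) (ls ul) 1" by (rule tev_Var; simp)+
  have snd: "tev ?env (SndE (Var 0)) (data_snd (ls nl)) 2" by (rule tev_mono[OF tev_Snd[OF v(1) refl]]) simp
  have snd_iff: "data_snd (ls nl) = Atom \<longleftrightarrow> ?n < 2" by (cases nl; cases "tl nl") auto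
  let ?X = "(?Z + 2) ^ c"
  show ?case
  proof (cases "?n < 2")
    case True
    have "length (el i) = 1" if "i \<in> set S" for i
      using S(3,4)[OF that] True by (cases "el i") auto
    hence sat: "sat cs S \<longleftrightarrow> \<not> (\<exists>i\<in>set S. anyb False cs S i)" by (rule sat_singletons[OF S(1)])
    have chk: "tev [ls S, ls S, ls cs] (prog ! iChk) (enc_bool (\<exists>i\<in>set S. anyb False cs S i)) ?X"
      using chk_time[of "[ls S, ls S, ls cs]" ?Z] sS scs by simp
    have "tevs ?env [Var 1, Var 1, Var 2] [ls S, ls S, ls cs] (1 + (1 + (1 + 0)))"
      by (intro tevs_Cons tevs_Nil v)
    note call = tev_Call[OF this chk]
    have T: "tev ?env TrueE (Pair Atom Atom) 3" by (rule tev_mono[OF tev_Pair[OF tev_Atom tev_Atom]]) simp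
    have A: "tev ?env AtomE Atom 3" by (rule tev_mono[OF tev_Atom]) simp
    have not: "tev ?env (NotE (Call iChk [Var 1, Var 1, Var 2])) (enc_bool (sat cs S)) (1 + (1 + (1 + 0)) + ?X + 1 + 3 + 1)"
      by (rule tev_If[OF call]) (use T A sat in \<open>auto simp: enc_bool_def[of True] enc_bool_def[of False]\<close>)
    have "tev ?env (prog ! iSolve) (enc_bool (sat cs S)) (2 + (1 + (1 + (1 + 0)) + ?X + 1 + 3 + 1) + 1)"
      unfolding prog_solve by (rule tev_If[OF snd]) (use not snd_iff True in auto)
    moreover have "2 + (1 + (1 + (1 + 0)) + ?X + 1 + 3 + 1) + 1 \<le> Tb c ?n"
      using True by (simp add: Tb_def W_def)
    ultimately show ?thesis by (rule tev_mono)
  next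
    case False
    hence n2: "2 \<le> ?n" by simp
    interpret L: level cs dm H1 H2 h u S ?n
      by unfold_locales (use S n2 in auto)
    let ?F = L.F and ?n' = "?n div 2 ^ u" and ?nl' = "(half ^^ u) nl"
    let ?L = "grow cs ?F (length S)"
    let ?G = "filter (\<lambda>g. sat cs (sp g)) ?L"
    let ?C = "cover cs ?G (length S)"
    let ?s5 = "[ls ?nl', ls nl, ls S, ls cs, ls ul]"
    have len': "length ?nl' = ?n'" by (rule length_halves)
    have "1 < (2::nat) ^ u" using u_ge by (intro one_less_power) auto
    hence n'n: "?n' < ?n" using n2 by (intro div_less_dividend) auto
    have snl': "data_size (ls ?nl') \<le> B" using size_halves[of u nl] less.prems(2) by simp
    have FV: "vr i \<in> Vs \<and> blk dm i" if "i \<in> set ?F" for i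
      using L.F_sub[OF that] S(2) L.F_blk[OF that] by metis
    have pows: "(2 ^ u) ^ 2 \<le> (2 ^ u :: nat) ^ (3 * p + 4)" by (intro power_increasing) auto
    \<comment> \<open>The last round bounds the number of recursive calls; the earlier ones are
      needed because the time of the loop depends on all intermediate results.\<close>
    have growB: "length (grow cs ?F j) \<le> (2 ^ u) ^ 2" if "j \<le> length S" for j
    proof -
      let ?m = "1 + length S * (u * u + 5 * length S)"
      have "length (grow cs ?F j) \<le> length ?F * ?m ^ j" by (rule L.grow_count)
      also have "\<dots> \<le> ((u + 1) * (5 * length S * 2 ^ u)) * ?m ^ length S"
        using L.F_count that by (intro mult_mono power_increasing) auto
      also have "\<dots> \<le> (2 ^ u) ^ 2" by (rule branching_le[OF u kp])
      finally show ?thesis .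
    qed
    have grow_items: "distinct (map vr (sp g)) \<and> (\<forall>i\<in>set (sp g). i \<in> set ?F)" if "g \<in> set (grow cs ?F j)" for g j
      using grow_inv[OF that] by auto
    have size_g: "data_size g \<le> 1 + p * (N + 1)" if "distinct (map vr (sp g))" "\<And>i. i \<in> set (sp g) \<Longrightarrow> i \<in> set ?F" for g
      using size_tuple[of "sp g"] that FV by simp
    have growS: "data_size (ls (grow cs ?F j)) \<le> B" if "j \<le> length S" for j
      by (rule size_tuples) (use grow_items size_g growB[OF that] pows in \<open>auto intro: le_trans\<close>)
    have sF: "data_size (ls ?F) \<le> B"
    proof -
      have "data_size (ls I) \<le> data_size (ls (map (\<lambda>i. Pair i Atom) I))" for I by (induction I) auto
      thus ?thesis using growS[of 0] le_trans by fastforce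
    qed
    have sG: "data_size (ls ?G) \<le> B" using size_filter growS[of "length S"] le_trans by blast
    have lG: "length ?G \<le> (2 ^ u) ^ 2" using growB[of "length S"] length_filter_le le_trans by blast
    have coverS: "data_size (ls (cover cs ?G j)) \<le> B" if j: "j \<le> length S" for j
    proof (rule size_tuples)
      fix a assume a: "a \<in> set (cover cs ?G j)"
      have "set (sp a) \<subseteq> set ?F \<and> distinct (map vr (sp a))"
        by (rule cover_inv[OF _ a]) (use grow_items in auto)
      thus "data_size a \<le> 1 + p * (N + 1)" by (intro size_g) auto
    next
      have "length (cover cs ?G j) \<le> (1 + length ?G) ^ j" by (rule cover_count)
      also have "\<dots> \<le> (2 ^ u * (2 ^ u) ^ 2) ^ j"
      proof (rule power_mono)
        have "1 + length ?G \<le> (2 ^ u) ^ 2 + (2 ^ u) ^ 2" using lG by (intro add_mono) auto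
        also have "\<dots> = 2 * (2 ^ u) ^ 2" by simp
        also have "\<dots> \<le> 2 ^ u * (2 ^ u) ^ 2"
          using u_ge self_le_power[of 2 u] by (intro mult_right_mono) auto
        finally show "1 + length ?G \<le> 2 ^ u * (2 ^ u) ^ 2" .
      qed simp
      also have "\<dots> = (2 ^ u) ^ (3 * j)"
        unfolding power_mult by (simp add: power3_eq_cube power2_eq_square mult.assoc)
      also have "\<dots> \<le> (2 ^ u) ^ (3 * p + 4)" using j kp by (intro power_increasing) auto
      finally show "length (cover cs ?G j) \<le> (2 ^ u) ^ (3 * p + 4)" .
    qed
    have w: "tev ?s5 (Var 0) (ls ?nl') 1" "tev ?s5 (Var 1) (ls nl) 1" "tev ?s5 (Var 2) (ls S) 1"
      "tev ?s5 (Var 3) (ls cs) 1" "tev ?s5 (Var 4) (ls ul) 1" by (rule tev_Var; simp)+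
    have final: "tev ?s5 (prog ! iFinal) (ls ?F) ?X"
      using final_time[of ?s5 ?Z] snl' less.prems(2) sS scs ul len' by simp
    have e1: "tev ?s5 (Call iFinal [Var 0, Var 1, Var 2, Var 3, Var 4]) (ls ?F) (1 + (1 + (1 + (1 + (1 + 0)))) + ?X + 1)"
      by (rule tev_Call[OF _ final]) (intro tevs_Cons tevs_Nil w, simp)
    have "tev [ls S, ls ?F, ls cs] (prog ! iGrow) (ls ?L) ?X"
      using grow_time[of S ?F cs ?Z] sS sF scs growS by fastforce
    note e2 = tev_Call[OF tevs_Cons[OF w(3) tevs_Cons[OF e1 tevs_Cons[OF w(4) tevs_Nil]]] this]
    have IH: "tev [ls ?nl', g, ls cs, ls ul] (prog ! iSolve) (enc_bool (sat cs (sp g))) (Tb c ?n')"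
      if g: "g \<in> set ?L" for g
    proof -
      have "inv ?n' (sp g)"
        unfolding inv_def using grow_items[OF g] FV L.F_length L.F_ne by auto
      thus ?thesis using less.hyps[of ?nl' "sp g"] len' n'n snl' by simp
    qed
    have filt: "tev [ls ?L, ls ?nl', ls cs, ls ul] (prog ! iFilt) (ls ?G) (length ?L * (Tb c ?n' + 30) + 5)"
      by (rule filt_tev[OF IH])
    note e3 = tev_Call[OF tevs_Cons[OF e2 tevs_Cons[OF w(1) tevs_Cons[OF w(4) tevs_Cons[OF w(5) tevs_Nil]]]] filt]
    have "tev [ls S, ls ?G, ls cs] (prog ! iCover) (ls ?C) ?X"
      using cover_time[of S ?G cs ?Z] sS sG scs coverS by fastforce
    note e4 = tev_Call[OF tevs_Cons[OF w(3) tevs_Cons[OF e3 tevs_Cons[OF w(4) tevs_Nil]]] this]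
    have "tev [ls ?C, ls S] (prog ! iLong) (enc_bool (\<exists>a\<in>set ?C. length S \<le> length (sp a))) ?X"
      using long_time[of "[ls ?C, ls S]" ?Z] sS coverS[of "length S"] by simp
    hence long: "tev [ls ?C, ls S] (prog ! iLong) (enc_bool (sat cs S)) ?X" by (simp add: L.cover_correct)
    note e5 = tev_Call[OF tevs_Cons[OF e4 tevs_Cons[OF w(3) tevs_Nil]] long]
    have step: "tev ?s5 (prog ! iStep) (enc_bool (sat cs S)) (length ?L * (Tb c ?n' + 30) + 4 * ?X + 40)"
      unfolding prog_solve by (rule tev_mono[OF e5]) simp_all
    have "tev [ls ul, ls nl] (prog ! iHalves) (ls ?nl') ?X"
      using halves_time[of "[ls ul, ls nl]" ?Z] ul less.prems(2) by simp
    note h1 = tev_Call[OF tevs_Cons[OF v(4) tevs_Cons[OF v(1) tevs_Nil]] this]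
    note h2 = tev_Call[OF tevs_Cons[OF h1 tevs_Cons[OF v(1) tevs_Cons[OF v(2) tevs_Cons[OF v(3) tevs_Cons[OF v(4) tevs_Nil]]]]] step]
    have h3: "tev ?env (Call iStep [Call iHalves [Var 3, Var 0], Var 0, Var 1, Var 2, Var 3]) (enc_bool (sat cs S))
        (length ?L * (Tb c ?n' + 30) + 5 * ?X + 60)"
      by (rule tev_mono[OF h2]) simp_all
    have "tev ?env (prog ! iSolve) (enc_bool (sat cs S)) (2 + (length ?L * (Tb c ?n' + 30) + 5 * ?X + 60) + 1)"
      unfolding prog_solve by (rule tev_If[OF snd]) (use h3 snd_iff False in auto)
    moreover have "2 + (length ?L * (Tb c ?n' + 30) + 5 * ?X + 60) + 1 \<le> Tb c ?n"
    proof -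
      have "length ?L * (Tb c ?n' + 30) \<le> (2 ^ u) ^ 2 * (Tb c ?n' + 30)"
        using growB[of "length S"] by (intro mult_right_mono) auto
      also have "\<dots> = (2 ^ u) ^ 2 * Tb c ?n' + 30 * (2 ^ u) ^ 2" by (simp add: algebra_simps)
      finally have "2 + (length ?L * (Tb c ?n' + 30) + 5 * ?X + 60) + 1 \<le> W c + (2 ^ u) ^ 2 * Tb c ?n'"
        unfolding W_def by simp
      also have "\<dots> \<le> Tb c ?n" by (rule recurrence[OF n2])
      finally show ?thesis .
    qed
    ultimately show ?thesis by (rule tev_mono)
  qed
qed

end

section \<open>A doubly exponential function is computable\<close>

section \<open>A computable bound\<close>

definition cev :: "program \<Rightarrow> data list \<Rightarrow> exp \<Rightarrow> data \<Rightarrow> bool" where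
  "cev P env e v \<longleftrightarrow> (\<exists>t. eval P env e v t)"

lemma cev_Var: "i < length env \<Longrightarrow> env ! i = v \<Longrightarrow> cev P env (Var i) v"
  unfolding cev_def using eval_Var by blast

lemma cev_Atom: "cev P env AtomE Atom"
  unfolding cev_def using eval_Atom by blast

lemma cev_Pair: "cev P env e1 v1 \<Longrightarrow> cev P env e2 v2 \<Longrightarrow> cev P env (PairE e1 e2) (Pair v1 v2)"
  unfolding cev_def using eval_Pair by blast

lemma cev_Fst: "cev P env e v \<Longrightarrow> data_fst v = w \<Longrightarrow> cev P env (FstE e) w"
  unfolding cev_def using eval_Fst by blast

lemma cev_Snd: "cev P env e v \<Longrightarrow> data_snd v = w \<Longrightarrow> cev P env (SndE e) w"
  unfolding cev_def using eval_Snd by blast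

lemma cev_If: "cev P env e b \<Longrightarrow> (b \<noteq> Atom \<Longrightarrow> cev P env e1 v) \<Longrightarrow> (b = Atom \<Longrightarrow> cev P env e2 v) \<Longrightarrow> cev P env (IfE e e1 e2) v"
  unfolding cev_def using eval_If_True eval_If_False by metis

lemma cev_Call1: "cev P env e v \<Longrightarrow> g < length P \<Longrightarrow> cev P [v] (P ! g) w \<Longrightarrow> cev P env (Call g [e]) w"
  unfolding cev_def using eval_Call[OF evals_Cons[OF _ evals_Nil]] by blast

lemma cev_Call2: "cev P env e1 v1 \<Longrightarrow> cev P env e2 v2 \<Longrightarrow> g < length P \<Longrightarrow> cev P [v1, v2] (P ! g) w \<Longrightarrow>
    cev P env (Call g [e1, e2]) w"
  unfolding cev_def using eval_Call[OF evals_Cons[OF _ evals_Cons[OF _ evals_Nil]]] by blast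

fun lit :: "data \<Rightarrow> exp" where
  "lit Atom = AtomE"
| "lit (Pair a b) = PairE (lit a) (lit b)"

lemma cev_lit: "cev P env (lit d) d"
  by (induction d) (auto intro: cev_Atom cev_Pair)

abbreviation unary :: "nat \<Rightarrow> data" where
  "unary m \<equiv> ls (replicate m Atom)"

definition bound_prog :: "nat \<Rightarrow> program" where
  "bound_prog e = [
    Call 5 [Call 4 [Call 2 [Var 0]]],
    \<comment> \<open>append\<close>
    IfE (Var 0) (PairE (FstE (Var 0)) (Call 1 [SndE (Var 0), Var 1])) (Var 1),
    \<comment> \<open>binary to unary\<close>
    IfE (Var 0) (IfE (FstE (Var 0))
      (PairE AtomE (Call 3 [Call 2 [SndE (Var 0)]])) (Call 3 [Call 2 [SndE (Var 0)]])) AtomE,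
    \<comment> \<open>double\<close>
    Call 1 [Var 0, Var 0],
    \<comment> \<open>unary \<open>n\<close> to unary \<open>e * 512 ^ (n + 1)\<close>\<close>
    IfE (Var 0) (Call 3 [Call 3 [Call 3 [Call 3 [Call 3 [Call 3 [Call 3 [Call 3 [Call 3 [Call 4 [SndE (Var 0)]]]]]]]]]])
      (lit (unary (e * 512))),
    \<comment> \<open>unary \<open>m\<close> to binary \<open>2 ^ m\<close>\<close>
    IfE (Var 0) (PairE AtomE (Call 5 [SndE (Var 0)])) (PairE TrueE AtomE)
  ]"

lemma bound_append: "cev (bound_prog e) [ls xs, ls ys] (bound_prog e ! 1) (ls (xs @ ys))"
proof (induction xs)
  case Nil
  have "cev (bound_prog e) [Atom, ls ys] (bound_prog e ! 1) (ls ys)"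
    unfolding bound_prog_def by (simp, rule cev_If, rule cev_Var) (auto intro: cev_Var)
  thus ?case by simp
next
  case (Cons x xs)
  let ?P = "bound_prog e" and ?env = "[Pair x (ls xs), ls ys]"
  have v: "cev ?P ?env (Var 0) (Pair x (ls xs))" "cev ?P ?env (Var 1) (ls ys)" by (rule cev_Var; simp)+
  have "cev ?P ?env (Call 1 [SndE (Var 0), Var 1]) (ls (xs @ ys))"
    by (rule cev_Call2[OF cev_Snd[OF v(1)] v(2) _ Cons]) (simp_all add: bound_prog_def)
  from cev_Pair[OF cev_Fst[OF v(1)] this]
  have "cev ?P ?env (PairE (FstE (Var 0)) (Call 1 [SndE (Var 0), Var 1])) (ls ((x # xs) @ ys))" by simp
  hence "cev ?P ?env (IfE (Var 0) (PairE (FstE (Var 0)) (Call 1 [SndE (Var 0), Var 1])) (Var 1)) (ls ((x # xs) @ ys))"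
    by (intro cev_If[OF v(1)]) auto
  thus ?case by (simp add: bound_prog_def)
qed

lemma bound_double:
  assumes "cev (bound_prog e) env f (unary m)"
  shows "cev (bound_prog e) env (Call 3 [f]) (unary (2 * m))"
proof (rule cev_Call1[OF assms])
  have "cev (bound_prog e) [unary m] (Call 1 [Var 0, Var 0]) (ls (replicate m Atom @ replicate m Atom))"
    by (rule cev_Call2[OF _ _ _ bound_append]) (auto intro: cev_Var simp: bound_prog_def)
  thus "cev (bound_prog e) [unary m] (bound_prog e ! 3) (unary (2 * m))"
    by (simp add: bound_prog_def replicate_add[symmetric] mult_2)
qed (simp add: bound_prog_def)

lemma bound_unary: "cev (bound_prog e) [enc_nat n] (bound_prog e ! 2) (unary n)"
proof (induction n rule: less_induct)
  case (less n)
  let ?P = "bound_prog e" and ?env = "[enc_nat n]"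
  let ?rec = "Call 3 [Call 2 [SndE (Var 0)]]"
  have v: "cev ?P ?env (Var 0) (enc_nat n)" by (rule cev_Var; simp)
  have "cev ?P ?env (IfE (Var 0) (IfE (FstE (Var 0)) (PairE AtomE ?rec) ?rec) AtomE) (unary n)"
  proof (rule cev_If[OF v])
    assume "enc_nat n = Atom"
    thus "cev ?P ?env AtomE (unary n)" by (simp add: cev_Atom)
  next
    assume "enc_nat n \<noteq> Atom"
    hence n: "n \<noteq> 0" by simp
    have s: "cev ?P ?env (SndE (Var 0)) (enc_nat (n div 2))" by (rule cev_Snd[OF v]) (simp add: enc_nat_pos[OF n])
    have b: "cev ?P ?env (FstE (Var 0)) (enc_bool (odd n))" by (rule cev_Fst[OF v]) (simp add: enc_nat_pos[OF n])
    have "cev ?P ?env (Call 2 [SndE (Var 0)]) (unary (n div 2))"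
      by (rule cev_Call1[OF s _ less]) (use n in \<open>simp_all add: bound_prog_def\<close>)
    hence r: "cev ?P ?env ?rec (unary (2 * (n div 2)))" by (rule bound_double)
    show "cev ?P ?env (IfE (FstE (Var 0)) (PairE AtomE ?rec) ?rec) (unary n)"
    proof (rule cev_If[OF b])
      assume "enc_bool (odd n) \<noteq> Atom"
      hence "n = Suc (2 * (n div 2))" by simp
      thus "cev ?P ?env (PairE AtomE ?rec) (unary n)" using cev_Pair[OF cev_Atom r] by (metis ls.simps(2) replicate_Suc)
    next
      assume "enc_bool (odd n) = Atom"
      hence "n = 2 * (n div 2)" by simp
      thus "cev ?P ?env ?rec (unary n)" using r by simp
    qed
  qed
  thus ?case by (simp add: bound_prog_def)
qed

lemma bound_power: "cev (bound_prog e) [unary n] (bound_prog e ! 4) (unary (e * 512 ^ (n + 1)))"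
proof (induction n)
  case 0
  have "cev (bound_prog e) [Atom] (bound_prog e ! 4) (unary (e * 512))"
    unfolding bound_prog_def by (simp, rule cev_If, rule cev_Var) (auto intro: cev_lit)
  thus ?case by simp
next
  case (Suc n)
  let ?P = "bound_prog e" and ?env = "[unary (Suc n)]" and ?m = "e * 512 ^ (n + 1)"
  have v: "cev ?P ?env (Var 0) (unary (Suc n))" by (rule cev_Var; simp)
  have s: "cev ?P ?env (SndE (Var 0)) (unary n)" by (rule cev_Snd[OF v]) simp
  have r: "cev ?P ?env (Call 4 [SndE (Var 0)]) (unary ?m)"
    by (rule cev_Call1[OF s _ Suc]) (simp add: bound_prog_def)
  note d = bound_double
  have "2 * (2 * (2 * (2 * (2 * (2 * (2 * (2 * (2 * ?m)))))))) = e * 512 ^ (Suc n + 1)" by simp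
  with d[OF d[OF d[OF d[OF d[OF d[OF d[OF d[OF d[OF r]]]]]]]]]
  have "cev ?P ?env (Call 3 [Call 3 [Call 3 [Call 3 [Call 3 [Call 3 [Call 3 [Call 3 [Call 3 [Call 4 [SndE (Var 0)]]]]]]]]]])
    (unary (e * 512 ^ (Suc n + 1)))" by argo
  hence "cev ?P ?env (IfE (Var 0) (Call 3 [Call 3 [Call 3 [Call 3 [Call 3 [Call 3 [Call 3 [Call 3 [Call 3 [Call 4 [SndE (Var 0)]]]]]]]]]])
    (lit (unary (e * 512)))) (unary (e * 512 ^ (Suc n + 1)))"
    by (intro cev_If[OF v]) auto
  thus ?case by (simp add: bound_prog_def)
qed

lemma bound_exp: "cev (bound_prog e) [unary m] (bound_prog e ! 5) (enc_nat (2 ^ m))"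
proof (induction m)
  case 0
  have "cev (bound_prog e) [Atom] (bound_prog e ! 5) (Pair (Pair Atom Atom) Atom)"
    unfolding bound_prog_def by (simp, rule cev_If, rule cev_Var) (auto intro: cev_Pair cev_Atom)
  thus ?case using enc_nat_pos[of 1] by (simp add: enc_bool_def)
next
  case (Suc m)
  let ?P = "bound_prog e" and ?env = "[unary (Suc m)]"
  have v: "cev ?P ?env (Var 0) (unary (Suc m))" by (rule cev_Var; simp)
  have s: "cev ?P ?env (SndE (Var 0)) (unary m)" by (rule cev_Snd[OF v]) simp
  have r: "cev ?P ?env (Call 5 [SndE (Var 0)]) (enc_nat (2 ^ m))"
    by (rule cev_Call1[OF s _ Suc]) (simp add: bound_prog_def)
  have "enc_nat (2 ^ Suc m) = Pair Atom (enc_nat (2 ^ m))"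
    by (subst enc_nat_pos) (auto simp: enc_bool_def)
  with cev_Pair[OF cev_Atom r] have "cev ?P ?env (PairE AtomE (Call 5 [SndE (Var 0)])) (enc_nat (2 ^ Suc m))" by simp
  hence "cev ?P ?env (IfE (Var 0) (PairE AtomE (Call 5 [SndE (Var 0)])) (PairE TrueE AtomE)) (enc_nat (2 ^ Suc m))"
    by (intro cev_If[OF v]) auto
  thus ?case by (simp add: bound_prog_def)
qed

text \<open>The exponent dominates that of \<open>fpt_base n ^ e\<close>, namely
  \<open>256 ^ (n + 1) * (n + 1) * e\<close>, because \<open>n + 1\<close> is at most
  \<open>2 ^ (n + 1)\<close>, and unlike that one it can be computed from a literal by doubling
  alone.\<close>

lemma computable_double_exp: "computable (\<lambda>n. 2 ^ (e * 512 ^ (n + 1)))"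
proof -
  let ?P = "bound_prog e"
  have len: "length ?P = 6" by (simp add: bound_prog_def)
  have "cev ?P [enc_nat n] (?P ! 0) (enc_nat (2 ^ (e * 512 ^ (n + 1))))" for n
  proof -
    have "cev ?P [enc_nat n] (Call 5 [Call 4 [Call 2 [Var 0]]]) (enc_nat (2 ^ (e * 512 ^ (n + 1))))"
      by (rule cev_Call1[OF cev_Call1[OF cev_Call1[OF cev_Var _ bound_unary] _ bound_power] _ bound_exp])
        (simp_all add: len)
    thus ?thesis by (simp add: bound_prog_def)
  qed
  thus ?thesis unfolding computable_def runs_def cev_def
    by (intro exI[of _ ?P]) (auto simp: bound_prog_def)
qed

section \<open>Preprocessing\<close>

definition dbl :: "data \<Rightarrow> data" where
  "dbl d = ls (sp d @ sp d)"

lemma dbl_unary [simp]: "dbl (unary m) = unary (2 * m)"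
  by (simp add: dbl_def replicate_add[symmetric] mult_2)

lemma size_unary: "data_size (unary m) = 2 * m + 1"
  by (induction m) auto

text \<open>\<open>u\<close> is produced in unary. This takes time exponential in the parameter,
  which the factor depending on it may contain.\<close>

lemma pow_tev:
  "\<exists>c. \<forall>xs Z. data_size (ls xs) + 2 * 256 ^ (length xs + 1) + 1 \<le> Z \<longrightarrow>
    tev [ls xs] (prog ! iPow) (unary (256 ^ (length xs + 1))) ((Z + 2) ^ c)"
proof -
  let ?e = "\<lambda>b. Call iDbl [Call iDbl [Call iDbl [Call iDbl [Call iDbl [Call iDbl [Call iDbl [Call iDbl [b]]]]]]]]"
  let ?d = "\<lambda>x. dbl (dbl (dbl (dbl (dbl (dbl (dbl (dbl x)))))))"
  have fd: "fn prog 1 iDbl (\<lambda>v. dbl (v ! 0))" unfolding dbl_def by (rule fn_dbl)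
  have H: "pt prog (Suc (Suc 0)) (?e (Var 0)) (\<lambda>v. ?d (v ! 0))"
    by (rule pt_cong, (rule pt_intros pt_Call[OF fd] | (simp; fail))+)
  have B: "pt prog (Suc 0) (?e TrueE) (\<lambda>v. ?d (Pair Atom Atom))"
    by (rule pt_cong, (rule pt_intros pt_Call[OF fd] | (simp; fail))+)
  have g: "prog ! iPow = foldE iPow (Suc 0) (?e TrueE)" "Suc iPow < length prog" "prog ! Suc iPow = ?e (Var 0)"
    by (simp_all add: prog_def)
  obtain c where c: "fold_bound iPow 0 (\<lambda>v. ?d (v ! 0)) (\<lambda>v. ?d (Pair Atom Atom)) c"
    using fold_tev[OF g H B] by blast
  have un1: "Pair Atom Atom = unary 1" by simp
  show ?thesis
  proof (intro exI[of _ c] allI impI)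
    fix xs Z assume Z: "data_size (ls xs) + 2 * 256 ^ (length xs + 1) + 1 \<le> Z"
    let ?F = "\<lambda>d. unary (256 ^ (length (sp d) + 1))"
    have "data_size (?F ((data_snd ^^ j) (ls xs))) \<le> Z" for j
    proof -
      have "(256::nat) ^ (length xs - j + 1) \<le> 256 ^ (length xs + 1)" by (intro power_increasing) auto
      moreover have "data_size (?F ((data_snd ^^ j) (ls xs))) = 2 * 256 ^ (length xs - j + 1) + 1"
        by (simp add: size_unary sp_snd_pow)
      ultimately show ?thesis using Z by linarith
    qed
    moreover have "?F Atom = ?d (Pair Atom Atom)" unfolding un1 dbl_unary by simp
    moreover have "?F (Pair x ys) = ?d (?F ys)" for x ys unfolding dbl_unary by simp
    ultimately show "tev [ls xs] (prog ! iPow) (unary (256 ^ (length xs + 1))) ((Z + 2) ^ c)"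
      using c[unfolded fold_bound_def, rule_format, of "[]" ?F "ls xs" Z] Z by simp
  qed
qed

section \<open>Closure properties of parameterized time bounds\<close>

section \<open>Bounds of the form f(p) * N^O(1)\<close>

text \<open>This is \<open>(2 ^ u) ^ (p + 1)\<close>. Every factor that depends on the parameter is
  at most a power of it with a fixed exponent; for example \<open>(2 ^ u) ^ (3 * p + 6)\<close> is
  at most its sixth power.\<close>

abbreviation "fpt_base p \<equiv> (2 ^ (256 ^ (p + 1))) ^ (p + 1) :: nat"

definition fpt_bounded :: "(aux_csp \<Rightarrow> nat) \<Rightarrow> bool" where
  "fpt_bounded T \<longleftrightarrow> (\<exists>e d. \<forall>A. aux_csp_instance A \<longrightarrow>
     T A \<le> fpt_base (csp_parameter A) ^ e * (data_size (enc_aux_csp A) + 2) ^ d)"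

lemma fpt_bounded_mono: "fpt_bounded T \<Longrightarrow> (\<And>A. aux_csp_instance A \<Longrightarrow> T' A \<le> T A) \<Longrightarrow> fpt_bounded T'"
  unfolding fpt_bounded_def by (meson le_trans)

lemma fpt_bounded_base: "fpt_bounded (\<lambda>A. fpt_base (csp_parameter A))"
  unfolding fpt_bounded_def by (rule exI[of _ 1], rule exI[of _ 0]) simp

lemma fpt_bounded_size: "fpt_bounded (\<lambda>A. data_size (enc_aux_csp A))"
  unfolding fpt_bounded_def by (rule exI[of _ 0], rule exI[of _ 1]) simp

lemma fpt_bounded_const: "fpt_bounded (\<lambda>A. c)"
proof -
  have "c \<le> (data_size (enc_aux_csp A) + 2) ^ c" for A
    using le_pow_two[of c] power_mono[of 2 "data_size (enc_aux_csp A) + 2" c] by simp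
  hence "\<forall>A. aux_csp_instance A \<longrightarrow> c \<le> fpt_base (csp_parameter A) ^ 0 * (data_size (enc_aux_csp A) + 2) ^ c"
    unfolding power_0 mult_1 by blast
  thus ?thesis unfolding fpt_bounded_def by blast
qed

lemma fpt_bounded_mult:
  assumes "fpt_bounded T" "fpt_bounded T'"
  shows "fpt_bounded (\<lambda>A. T A * T' A)"
proof -
  obtain e d where 1: "\<And>A. aux_csp_instance A \<Longrightarrow> T A \<le> fpt_base (csp_parameter A) ^ e * (data_size (enc_aux_csp A) + 2) ^ d"
    using assms(1) unfolding fpt_bounded_def by blast
  obtain e' d' where 2: "\<And>A. aux_csp_instance A \<Longrightarrow> T' A \<le> fpt_base (csp_parameter A) ^ e' * (data_size (enc_aux_csp A) + 2) ^ d'"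
    using assms(2) unfolding fpt_bounded_def by blast
  show ?thesis unfolding fpt_bounded_def
  proof (rule exI[of _ "e + e'"], rule exI[of _ "d + d'"], intro allI impI)
    fix A assume A: "aux_csp_instance A"
    from mult_le_mono[OF 1[OF A] 2[OF A]]
    show "T A * T' A \<le> fpt_base (csp_parameter A) ^ (e + e') * (data_size (enc_aux_csp A) + 2) ^ (d + d')"
      by (simp only: power_add mult_ac)
  qed
qed

lemma fpt_bounded_add:
  assumes "fpt_bounded T" "fpt_bounded T'"
  shows "fpt_bounded (\<lambda>A. T A + T' A)"
proof (rule fpt_bounded_mono)
  have s: "fpt_bounded (\<lambda>A. T A + 1)" if T: "fpt_bounded T" for T
  proof -
    obtain e d where 1: "\<And>A. aux_csp_instance A \<Longrightarrow> T A \<le> fpt_base (csp_parameter A) ^ e * (data_size (enc_aux_csp A) + 2) ^ d"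
      using T unfolding fpt_bounded_def by blast
    have "T A + 1 \<le> fpt_base (csp_parameter A) ^ e * (data_size (enc_aux_csp A) + 2) ^ Suc d" if A: "aux_csp_instance A" for A
    proof -
      let ?b = "fpt_base (csp_parameter A) ^ e * (data_size (enc_aux_csp A) + 2) ^ d"
      have "1 \<le> ?b" by simp
      hence "T A + 1 \<le> ?b * 2" using 1[OF A] by linarith
      also have "\<dots> \<le> ?b * (data_size (enc_aux_csp A) + 2)" by (intro mult_left_mono) auto
      finally show ?thesis by (simp only: power_Suc2 mult.assoc)
    qed
    thus ?thesis unfolding fpt_bounded_def by blast
  qed
  show "fpt_bounded (\<lambda>A. (T A + 1) * (T' A + 1))" by (intro fpt_bounded_mult s assms)
qed (simp add: algebra_simps)

lemma fpt_bounded_power: "fpt_bounded T \<Longrightarrow> fpt_bounded (\<lambda>A. T A ^ c)"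
proof (induction c)
  case 0
  show ?case using fpt_bounded_const[of 1] by simp
next
  case (Suc c)
  thus ?case using fpt_bounded_mult[of T "\<lambda>A. T A ^ c"] by simp
qed

lemmas fpt_bounded_intros = fpt_bounded_base fpt_bounded_size fpt_bounded_const fpt_bounded_mult fpt_bounded_add fpt_bounded_power

section \<open>From the encoded instance to the recursion\<close>

section \<open>The algorithm\<close>

text \<open>Trees that name no variable get the empty list, since \<open>neat\<close> asks for a
  distinct list at every tree.\<close>

definition dom_of :: "aux_csp \<Rightarrow> data \<Rightarrow> data list" where
  "dom_of A x = (if \<exists>i<length (domains A). x = enc_nat i then map enc_nat (domains A ! dec_nat x) else [])"

lemma dom_of_enc [simp]: "i < length (domains A) \<Longrightarrow> dom_of A (enc_nat i) = map enc_nat (domains A ! i)"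
  by (auto simp: dom_of_def)

abbreviation items_of :: "aux_csp \<Rightarrow> data list" where
  "items_of A \<equiv> map (\<lambda>i. Pair (enc_nat i) (ls (map enc_nat (domains A ! i)))) [0..<length (domains A)]"

abbreviation cons_of :: "aux_csp \<Rightarrow> data list" where
  "cons_of A \<equiv> map (enc_cons (domains A)) (constraints A)"

lemma enc_aux_csp_simps:
  "data_fst (enc_aux_csp A) = ls (map (\<lambda>D. ls (map enc_nat D)) (domains A))"
  "data_snd (enc_aux_csp A) = ls (map (enc_constraint (domains A)) (constraints A))"
  by (simp_all add: enc_aux_csp_def enc_list_ls[abs_def])

lemma lab_items: "lab (sp (data_fst (enc_aux_csp A))) Atom = items_of A"
  using lab_enc[of "\<lambda>D. ls (map enc_nat D)" "domains A" 0] by (simp add: enc_aux_csp_simps)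

lemma att_cons:
  assumes "aux_csp_instance A"
  shows "att (items_of A) (sp (data_snd (enc_aux_csp A))) = cons_of A"
proof -
  have "look (items_of A) (enc_nat i) = ls (map enc_nat (domains A ! i))" if "i < length (domains A)" for i
    by (rule look_map) (use that in auto)
  thus ?thesis using assms
    by (auto simp: att_def enc_aux_csp_simps enc_cons_def enc_constraint_def aux_csp_instance_def)
qed

lemma length_revlists: "length (revlists (sp (data_snd (enc_aux_csp A)))) = (\<Sum>C\<leftarrow>constraints A. depth (crep C))"
  by (simp add: revlists_def enc_aux_csp_simps length_concat comp_def enc_constraint_def enc_segment_rep_def
      enc_reversions_def depth_def)

lemma sat_satisfiable:
  assumes A: "aux_csp_instance A"
  shows "sat (cons_of A) (items_of A) \<longleftrightarrow> satisfiable A"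
proof -
  let ?Ds = "domains A"
  have inst: "\<exists>k. rel_segment_rep (?Ds ! var1 C) (?Ds ! var2 C) k (crep C) (crel C)"
    "var1 C < length ?Ds" "var2 C < length ?Ds" if "C \<in> set (constraints A)" for C
    using A that by (auto simp: aux_csp_instance_def)
  have vars: "vr ` set (items_of A) = enc_nat ` {..<length ?Ds}" by (auto simp: image_image)
  have rel: "rel (enc_cons ?Ds C) (enc_nat a) (enc_nat b) \<longleftrightarrow> (a, b) \<in> crel C"
    if "C \<in> set (constraints A)" "a \<in> set (?Ds ! var1 C)" "b \<in> set (?Ds ! var2 C)" for C a b
    using inst(1)[OF that(1)] rel_enc_cons(2) that(2,3) by blast
  show ?thesis
  proof
    assume "sat (cons_of A) (items_of A)"
    then obtain \<alpha> where \<alpha>: "\<And>i. i \<in> set (items_of A) \<Longrightarrow> \<alpha> (vr i) \<in> set (el i)"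
      "\<And>C. C \<in> set (cons_of A) \<Longrightarrow> cv1 C \<in> vr ` set (items_of A) \<Longrightarrow> cv2 C \<in> vr ` set (items_of A) \<Longrightarrow> rel C (\<alpha> (cv1 C)) (\<alpha> (cv2 C))"
      by (auto simp: sat_def simp del: set_map)
    define \<beta> where "\<beta> i = dec_nat (\<alpha> (enc_nat i))" for i
    have \<beta>: "\<beta> i \<in> set (?Ds ! i)" "\<alpha> (enc_nat i) = enc_nat (\<beta> i)" if "i < length ?Ds" for i
    proof -
      have "Pair (enc_nat i) (ls (map enc_nat (?Ds ! i))) \<in> set (items_of A)" using that by auto
      from \<alpha>(1)[OF this] show "\<beta> i \<in> set (?Ds ! i)" "\<alpha> (enc_nat i) = enc_nat (\<beta> i)" by (auto simp: \<beta>_def)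
    qed
    have "assignment A \<beta>" using \<beta> by (simp add: assignment_def)
    moreover have "satisfying A \<beta>" unfolding satisfying_def
    proof
      fix C assume C: "C \<in> set (constraints A)"
      have "rel (enc_cons ?Ds C) (\<alpha> (enc_nat (var1 C))) (\<alpha> (enc_nat (var2 C)))"
        using \<alpha>(2)[of "enc_cons ?Ds C"] C inst(2,3)[OF C] unfolding vars by simp
      thus "(\<beta> (var1 C), \<beta> (var2 C)) \<in> crel C"
        using rel[OF C] \<beta> inst(2,3)[OF C] by simp
    qed
    ultimately show "satisfiable A" by (auto simp: satisfiable_def)
  next
    assume "satisfiable A"
    then obtain \<beta> where \<beta>: "assignment A \<beta>" "satisfying A \<beta>" by (auto simp: satisfiable_def)
    show "sat (cons_of A) (items_of A)" unfolding sat_def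
    proof (intro exI[of _ "\<lambda>d. enc_nat (\<beta> (dec_nat d))"] conjI ballI impI)
      fix i assume "i \<in> set (items_of A)"
      thus "enc_nat (\<beta> (dec_nat (vr i))) \<in> set (el i)" using \<beta>(1) by (auto simp: assignment_def)
    next
      fix C assume "C \<in> set (cons_of A)"
      then obtain C' where C: "C' \<in> set (constraints A)" "C = enc_cons ?Ds C'" by auto
      have "\<beta> (var1 C') \<in> set (?Ds ! var1 C')" "\<beta> (var2 C') \<in> set (?Ds ! var2 C')"
        using \<beta>(1) inst(2,3)[OF C(1)] by (auto simp: assignment_def)
      thus "rel C (enc_nat (\<beta> (dec_nat (cv1 C)))) (enc_nat (\<beta> (dec_nat (cv2 C))))"
        using rel[OF C(1)] \<beta>(2) C by (simp add: satisfying_def)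
    qed
  qed
qed

text \<open>The demand \<open>9 * h \<le> u\<close> on the constant \<open>u\<close>: at most
  \<open>2 ^ p\<close> constraints with \<open>2 * 3 ^ p\<close> points each give
  \<open>9 * h \<le> 18 * 6 ^ p\<close>, which is below \<open>256 ^ (p + 1)\<close>.\<close>

lemma instance_neat:
  assumes A: "aux_csp_instance A" and p: "p = csp_parameter A"
  shows "\<exists>H1 H2. neat (cons_of A) (dom_of A) H1 H2 (length (cons_of A) * (2 * 3 ^ p)) (2 ^ (8 * (p + 1)))"
proof (rule neat_exists)
  fix x
  have "distinct (map enc_nat (domains A ! i))" if "i < length (domains A)" for i
    using A that by (auto simp: aux_csp_instance_def ordered_domain_def distinct_map inj_on_def)
  thus "distinct (dom_of A x)" by (auto simp: dom_of_def simp del: distinct_map)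
next
  fix C assume "C \<in> set (cons_of A)"
  then obtain C' where C: "C' \<in> set (constraints A)" "C = enc_cons (domains A) C'" by auto
  have v: "var1 C' < length (domains A)" "var2 C' < length (domains A)"
    using A C(1) by (auto simp: aux_csp_instance_def)
  obtain k where k: "rel_segment_rep (domains A ! var1 C') (domains A ! var2 C') k (crep C') (crel C')"
    using A C(1) by (auto simp: aux_csp_instance_def)
  have "depth (crep C') \<le> (\<Sum>C\<leftarrow>constraints A. depth (crep C))"
    using C(1) by (intro member_le_sum_list) auto
  hence "depth (crep C') \<le> p" by (simp add: p csp_parameter_def)
  hence "(3::nat) ^ depth (crep C') \<le> 3 ^ p" by (intro power_increasing) auto
  thus "\<exists>W1 W2. stair (dom_of A) (3 ^ p) C W1 W2" unfolding C(2)
    by (intro stair_enc_cons[OF _ _ k]) (use A v in \<open>auto simp: aux_csp_instance_def ordered_domain_def\<close>)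
next
  have "length (cons_of A) \<le> p" by (simp add: p csp_parameter_def)
  hence "length (cons_of A) \<le> 2 ^ p" using le_pow_two[of p] by linarith
  hence "9 * (length (cons_of A) * (2 * 3 ^ p)) \<le> 9 * (2 ^ p * (2 * 3 ^ p))"
    by (intro mult_left_mono mult_right_mono) auto
  also have "\<dots> = 18 * 6 ^ p" by (simp flip: power_mult_distrib)
  also have "\<dots> \<le> 256 * 256 ^ p" by (intro mult_mono power_mono) auto
  also have "\<dots> = 2 ^ (8 * (p + 1))" unfolding power_mult by simp
  finally show "9 * (length (cons_of A) * (2 * 3 ^ p)) \<le> 2 ^ (8 * (p + 1))" .
qed

lemma prog_main:
  "prog ! 0 = Call iMain2 [Var 0, Call iLab [FstE (Var 0), AtomE]]"
  "prog ! iMain2 = Call iMain3 [Call iCat [FstE (Var 0)], Var 1, Call iAtt [SndE (Var 0), Var 1],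
      Call iApp [FstE (Var 0), Call iApp [SndE (Var 0), Call iRevlists [SndE (Var 0)]]]]"
  "prog ! iMain3 = Call iSolve [Var 0, Var 1, Var 2, Call iPow [Var 3]]"
  by (simp_all add: prog_def)

theorem theorem2:
  "fixed_parameter_tractable {A. aux_csp_instance A} enc_aux_csp csp_parameter satisfiable"
proof -
  let ?lab = "\<lambda>x. ls (lab (sp (data_fst x)) Atom)"
  let ?cat = "\<lambda>x. ls (concat (map sp (sp (data_fst x))) @ [Atom, Atom])"
  let ?att = "\<lambda>x y. ls (att (sp y) (sp (data_snd x)))"
  let ?cnt = "\<lambda>x. ls (sp (data_fst x) @ sp (data_snd x) @ revlists (sp (data_snd x)))"
  let ?e3 = "Call iApp [FstE (Var 0), Call iApp [SndE (Var 0), Call iRevlists [SndE (Var 0)]]]"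
  have "pts prog 1 [Var 0, Call iLab [FstE (Var 0), AtomE]] (\<lambda>v. [v ! 0, ?lab (v ! 0)])"
    by (rule pts_cong, (rule pt_intros pt_Call[OF fn_lab] | (simp; fail))+)
  then obtain c1 where c1: "\<And>v. length v = 1 \<Longrightarrow>
      (\<exists>t\<le>(sz v + 2) ^ c1. evals prog v [Var 0, Call iLab [FstE (Var 0), AtomE]] [v ! 0, ?lab (v ! 0)] t) \<and>
      sz [v ! 0, ?lab (v ! 0)] \<le> (sz v + 2) ^ c1"
    unfolding pts_def by blast
  have "pts prog 2 [Call iCat [FstE (Var 0)], Var 1, Call iAtt [SndE (Var 0), Var 1], ?e3]
      (\<lambda>v. [?cat (v ! 0), v ! 1, ?att (v ! 0) (v ! 1), ?cnt (v ! 0)])"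
    by (rule pts_cong, (rule pt_intros pt_Call[OF fn_cat] pt_Call[OF fn_att] pt_Call[OF fn_app] pt_Call[OF fn_revlists] | (simp; fail))+)
  then obtain c2 where c2: "\<And>v. length v = 2 \<Longrightarrow> (\<exists>t\<le>(sz v + 2) ^ c2. evals prog v [Call iCat [FstE (Var 0)], Var 1, Call iAtt [SndE (Var 0), Var 1], ?e3]
      [?cat (v ! 0), v ! 1, ?att (v ! 0) (v ! 1), ?cnt (v ! 0)] t) \<and>
      sz [?cat (v ! 0), v ! 1, ?att (v ! 0) (v ! 1), ?cnt (v ! 0)] \<le> (sz v + 2) ^ c2"
    unfolding pts_def by blast
  obtain c3 where c3: "\<And>xs Z. data_size (ls xs) + 2 * 256 ^ (length xs + 1) + 1 \<le> Z \<Longrightarrow>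
    tev [ls xs] (prog ! iPow) (unary (256 ^ (length xs + 1))) ((Z + 2) ^ c3)"
    using pow_tev by blast
  obtain c4 where c4: "rec_time c4" using rec_time by blast
  \<comment> \<open>\<open>N\<close> bounds the preprocessed data. \<open>B\<close>,
    \<open>W\<close> and \<open>Tsolve\<close> majorize the bounds of the recursion, with powers of
    \<open>2 ^ u\<close> replaced by powers of \<open>fpt_base\<close>, so that the closure rules
    for \<open>fpt_bounded\<close> apply.\<close>
  define N where "N A = ((data_size (enc_aux_csp A) + 2) ^ c1 + 2) ^ c2" for A
  define B where "B A = fpt_base (csp_parameter A) ^ 6 * (N A + 1)" for A
  define W where "W A = 6 * (6 * B A + 2) ^ c4 + 100 + 30 * fpt_base (csp_parameter A) ^ 2" for A
  define Tsolve where "Tsolve A = W A + 2 * W A * fpt_base (csp_parameter A) ^ 2 * N A ^ 2" for A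
  define Tpow where "Tpow A = (N A + 2 * fpt_base (csp_parameter A) + 1 + 2) ^ c3" for A
  define total where "total A = (data_size (enc_aux_csp A) + 2) ^ c1 + N A + Tpow A + Tsolve A + 10" for A
  have fN: "fpt_bounded N" unfolding N_def by (intro fpt_bounded_intros)
  have fB: "fpt_bounded B" unfolding B_def by (intro fpt_bounded_intros fN)
  have fW: "fpt_bounded W" unfolding W_def by (intro fpt_bounded_intros fB)
  have fT: "fpt_bounded Tsolve" unfolding Tsolve_def by (intro fpt_bounded_intros fW fN)
  have fP: "fpt_bounded Tpow" unfolding Tpow_def by (intro fpt_bounded_intros fN)
  have "fpt_bounded total" unfolding total_def by (intro fpt_bounded_intros fN fT fP)
  then obtain e d where ed: "\<And>A. aux_csp_instance A \<Longrightarrow>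
      total A \<le> fpt_base (csp_parameter A) ^ e * (data_size (enc_aux_csp A) + 2) ^ d"
    unfolding fpt_bounded_def by blast
  have run: "\<exists>t\<le>total A. runs prog (enc_aux_csp A) (enc_bool (satisfiable A)) t" if A: "aux_csp_instance A" for A
  proof -
    define p where "p = csp_parameter A"
    define u where "u = (2::nat) ^ (8 * (p + 1))"
    have u256: "u = 256 ^ (p + 1)" unfolding u_def power_mult by simp
    \<comment> \<open>\<open>?nl\<close> is a unary bound on all domain lengths, padded to length at
      least 2 so that the top call performs a refinement; \<open>?xs\<close> is the parameter in
      unary.\<close>
    let ?x = "enc_aux_csp A" and ?nl = "concat (map sp (sp (data_fst (enc_aux_csp A)))) @ [Atom, Atom]"
    let ?xs = "sp (data_fst (enc_aux_csp A)) @ sp (data_snd (enc_aux_csp A)) @ revlists (sp (data_snd (enc_aux_csp A)))"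
    let ?Vs = "enc_nat ` {..<length (domains A)}"
    obtain t1 where t1: "t1 \<le> (data_size ?x + 2) ^ c1"
      "evals prog [?x] [Var 0, Call iLab [FstE (Var 0), AtomE]] [?x, ls (items_of A)] t1"
      "sz [?x, ls (items_of A)] \<le> (data_size ?x + 2) ^ c1"
      using c1[of "[?x]"] by (auto simp: lab_items)
    have att: "?att ?x (ls (items_of A)) = ls (cons_of A)" using att_cons[OF A] by simp
    have pw: "(sz [?x, ls (items_of A)] + 2) ^ c2 \<le> N A"
      unfolding N_def using t1(3) by (intro power_mono) auto
    obtain t2 where t2: "t2 \<le> N A"
      "evals prog [?x, ls (items_of A)] [Call iCat [FstE (Var 0)], Var 1, Call iAtt [SndE (Var 0), Var 1], ?e3]
        [ls ?nl, ls (items_of A), ls (cons_of A), ls ?xs] t2"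
      "sz [ls ?nl, ls (items_of A), ls (cons_of A), ls ?xs] \<le> N A"
      using c2[of "[?x, ls (items_of A)]"] pw att by (auto intro: le_trans)
    have lxs: "length ?xs = p"
      using length_revlists[of A] by (simp add: p_def csp_parameter_def enc_aux_csp_simps)
    obtain H1 H2 where "neat (cons_of A) (dom_of A) H1 H2 (length (cons_of A) * (2 * 3 ^ p)) u"
      using instance_neat[OF A p_def] unfolding u_def by blast
    then interpret neat "cons_of A" "dom_of A" H1 H2 "length (cons_of A) * (2 * 3 ^ p)" u .
    interpret R: bounded_neat "cons_of A" "dom_of A" H1 H2 "length (cons_of A) * (2 * 3 ^ p)" u p "N A" ?Vs
    proof
      have "card ?Vs \<le> card {..<length (domains A)}" by (rule card_image_le) simp
      thus "card ?Vs \<le> p" by (simp add: p_def csp_parameter_def)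
      show "data_size (ls (cons_of A)) \<le> N A" using t2(3) by simp
      fix x assume "x \<in> ?Vs"
      then obtain i where i: "i < length (domains A)" "x = enc_nat i" by auto
      hence "Pair x (ls (dom_of A x)) \<in> set (sp (ls (items_of A)))" by auto
      from size_mem_sp[OF this] show "data_size (Pair x (ls (dom_of A x))) \<le> N A" using t2(3) by simp
    qed (simp_all add: u_def)
    have r_le: "2 ^ u \<le> fpt_base p"
      unfolding u256 by (rule self_le_power) auto
    have B_le: "R.B \<le> B A"
    proof -
      have "((2::nat) ^ u) ^ (3 * p + 6) \<le> (2 ^ u) ^ ((p + 1) * 6)" by (intro power_increasing) auto
      also have "\<dots> = fpt_base p ^ 6" unfolding u256 by (simp only: power_mult)
      finally show ?thesis unfolding R.B_def B_def p_def[symmetric] by (intro mult_right_mono) auto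
    qed
    have W_le: "R.W c4 \<le> W A"
      unfolding R.W_def W_def p_def[symmetric]
      using B_le r_le by (intro add_mono mult_left_mono power_mono) auto
    have n_le: "length ?nl \<le> N A" using length_le_size[of "ls ?nl"] t2(3) by simp
    have Tb: "R.Tb c4 (length ?nl) \<le> Tsolve A"
    proof -
      have "R.Tb c4 (length ?nl) \<le> R.W c4 + 2 * R.W c4 * (2 ^ u) ^ 2 * length ?nl ^ 2"
        unfolding R.Tb_def by (split if_split) linarith
      also have "\<dots> \<le> Tsolve A"
        unfolding Tsolve_def p_def[symmetric] using W_le r_le n_le by (intro add_mono mult_le_mono power_mono) auto
      finally show ?thesis .
    qed
    have "R.inv (length ?nl) (items_of A)"
      unfolding R.inv_def
    proof (intro conjI ballI)
      show "distinct (map vr (items_of A))" by (simp add: comp_def distinct_map inj_on_def)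
      fix i assume "i \<in> set (items_of A)"
      then obtain j where j: "j < length (domains A)" "i = Pair (enc_nat j) (ls (map enc_nat (domains A ! j)))" by auto
      show "vr i \<in> ?Vs" using j by auto
      show "blk (dom_of A) i" unfolding blk_def using j by (intro exI[of _ "[]"]) auto
      have "length (domains A ! j) \<le> sum_list (map length (domains A))"
        using j(1) by (intro member_le_sum_list) auto
      hence "length (el i) \<le> length ?nl"
        by (simp add: j(2) enc_aux_csp_simps length_concat comp_def)
      thus "length (el i) \<le> max 1 (length ?nl)" by simp
      show "length ?nl < 2 \<longrightarrow> el i \<noteq> []" by simp
    qed
    moreover have "data_size (ls ?nl) \<le> R.B"
    proof -
      have "data_size (ls ?nl) \<le> N A" using t2(3) by simp
      also have "\<dots> \<le> R.B" using R.B_ge[of 0] by simp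
      finally show ?thesis .
    qed
    moreover have "data_size (unary u) \<le> R.B"
    proof -
      have "2 * u + 1 \<le> 3 * 2 ^ u" using le_pow_two[of u] one_le_power[of "2::nat" u] by linarith
      also have "\<dots> \<le> 2 ^ u * 2 ^ u" using R.u_ge self_le_power[of 2 u] le_pow_two[of u] by (intro mult_right_mono) linarith+
      also have "\<dots> \<le> (2 ^ u) ^ 2 * (N A + 1)" by (simp add: power2_eq_square)
      also have "\<dots> \<le> R.B" by (rule R.B_ge) simp
      finally show ?thesis by (simp add: size_unary)
    qed
    ultimately have solve: "tev [ls ?nl, ls (items_of A), ls (cons_of A), unary u] (prog ! iSolve) (enc_bool (satisfiable A)) (Tsolve A)"
      using R.solve_tev[OF c4, of "replicate u Atom" ?nl "items_of A"] Tb sat_satisfiable[OF A] tev_mono by simp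
    have "data_size (ls ?xs) + 2 * 256 ^ (length ?xs + 1) + 1 \<le> N A + 2 * fpt_base p + 1"
    proof -
      have "256 ^ (length ?xs + 1) \<le> fpt_base p" using r_le le_pow_two[of u] unfolding lxs u256 by linarith
      thus ?thesis using t2(3) by simp
    qed
    from c3[OF this] have pow: "tev [ls ?xs] (prog ! iPow) (unary u) (Tpow A)"
      unfolding Tpow_def p_def[symmetric] lxs u256[symmetric] .
    let ?env = "[ls ?nl, ls (items_of A), ls (cons_of A), ls ?xs]"
    have v: "tev ?env (Var 0) (ls ?nl) 1" "tev ?env (Var 1) (ls (items_of A)) 1" "tev ?env (Var 2) (ls (cons_of A)) 1"
      "tev ?env (Var 3) (ls ?xs) 1" by (rule tev_Var; simp)+
    note pow' = tev_Call[OF tevs_Cons[OF v(4) tevs_Nil] pow]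
    have "tev ?env (prog ! iMain3) (enc_bool (satisfiable A)) (Tpow A + Tsolve A + 6)"
      unfolding prog_main
      by (rule tev_mono[OF tev_Call[OF tevs_Cons[OF v(1) tevs_Cons[OF v(2) tevs_Cons[OF v(3) tevs_Cons[OF pow' tevs_Nil]]]] solve]]) simp_all
    from tev_Call[OF _ this, of "[?x, ls (items_of A)]"] t2(1,2)
    have "tev [?x, ls (items_of A)] (prog ! iMain2) (enc_bool (satisfiable A)) (N A + (Tpow A + Tsolve A + 6) + 1)"
      unfolding prog_main(2) tevs_def by auto
    from tev_Call[OF _ this, of "[?x]"] t1(1,2)
    have "tev [?x] (prog ! 0) (enc_bool (satisfiable A)) ((data_size ?x + 2) ^ c1 + (N A + (Tpow A + Tsolve A + 6) + 1) + 1)"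
      unfolding prog_main(1) tevs_def by auto
    hence "tev [?x] (prog ! 0) (enc_bool (satisfiable A)) (total A)" by (rule tev_mono) (simp add: total_def)
    moreover have "prog \<noteq> []" by (simp add: prog_def)
    ultimately show ?thesis unfolding runs_def tev_def by blast
  qed
  have bound: "total A \<le> 2 ^ (e * 512 ^ (csp_parameter A + 1)) * data_size (enc_aux_csp A) ^ (2 * d)"
    if A: "aux_csp_instance A" for A
  proof -
    let ?p = "csp_parameter A" and ?M = "data_size (enc_aux_csp A)"
    have "256 ^ (?p + 1) * (?p + 1) \<le> (256 ^ (?p + 1) * 2 ^ (?p + 1) :: nat)"
      by (intro mult_left_mono le_pow_two) auto
    also have "\<dots> = 512 ^ (?p + 1)" by (simp flip: power_mult_distrib)
    finally have "256 ^ (?p + 1) * (?p + 1) * e \<le> 512 ^ (?p + 1) * e" by (rule mult_right_mono) simp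
    hence "(2::nat) ^ (256 ^ (?p + 1) * (?p + 1) * e) \<le> 2 ^ (512 ^ (?p + 1) * e)"
      by (intro power_increasing) auto
    moreover have "fpt_base ?p ^ e = 2 ^ (256 ^ (?p + 1) * (?p + 1) * e)" by (simp only: power_mult)
    ultimately have 1: "fpt_base ?p ^ e \<le> 2 ^ (e * 512 ^ (?p + 1))" by (metis mult.commute)
    \<comment> \<open>The encoding is a pair, so its size is at least 2 and the added 2 in the base
      is absorbed by squaring.\<close>
    have M: "2 \<le> ?M" by (simp add: enc_aux_csp_def Suc_le_eq)
    hence "?M + 2 \<le> ?M * 2" by simp
    also have "\<dots> \<le> ?M ^ 2" unfolding power2_eq_square using M by (intro mult_left_mono) auto
    finally have "(?M + 2) ^ d \<le> (?M ^ 2) ^ d" by (rule power_mono) simp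
    hence "(?M + 2) ^ d \<le> ?M ^ (2 * d)" by (simp only: power_mult)
    from mult_le_mono[OF 1 this] ed[OF A] show ?thesis by linarith
  qed
  have "\<exists>t. runs prog (enc_aux_csp A) (enc_bool (satisfiable A)) t \<and>
      t \<le> 2 ^ (e * 512 ^ (csp_parameter A + 1)) * data_size (enc_aux_csp A) ^ (2 * d)"
    if "aux_csp_instance A" for A
    using run[OF that] bound[OF that] le_trans by blast
  thus ?thesis unfolding fixed_parameter_tractable_def using computable_double_exp[of e]
    by (intro exI[of _ prog] exI[of _ "\<lambda>n. 2 ^ (e * 512 ^ (n + 1))"] exI[of _ "2 * d"] conjI) simp_all
qed

end
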